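(* Let $T$ be a finite metric tree of length $L=|T|\ge2r>0$. Then there is a fractional marked-ball cover $\xi$ of $T$ on $X_{T,r}=T\times[0,r]$ such that $\pi_*\xi\le\Lambda_{T,r}$, where $\Lambda_{T,r}=\frac{L}{r}\,U[0,r]$.
   Context: A finite metric tree is the metric realization of a finite combinatorial tree whose edges have positive lengths; $|T|$ is the total edge length and $d_T$ the path metric. On $X_{T,r}=T\times[0,r]$ let $\pi(v,s)=s$. A fractional marked-ball cover of $T$ on $X_{T,r}$ is a finite positive Borel measure $\xi$ on $X_{T,r}$ such that $\xi(\{(v,s)\in X_{T,r}:d_T(x,v)\le s\})\ge1$ for every $x\in T$; $\pi_*\xi$ (push-forward under $\pi$) is its radius measure. For positive Borel measures, $\mu\le\mu'$ means $\mu(A)\le\mu'(A)$ for all Borel $A$. $U[0,r]$ is the uniform probability measure on $[0,r]$. *)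

theory Defs
  imports "HOL-Analysis.Analysis"
begin

definition is_cycle :: "'a set set \<Rightarrow> 'a list \<Rightarrow> bool" where
  "is_cycle E c \<longleftrightarrow> 3 \<le> length c \<and> distinct c \<and>
     (\<forall>i<length c. {c ! i, c ! (Suc i mod length c)} \<in> E)"

locale finite_metric_tree =
  fixes V :: "'a set" and E :: "'a set set" and len :: "'a set \<Rightarrow> real"
  assumes finite_V: "finite V"
    and V_nonempty: "V \<noteq> {}"
    and edges: "\<And>e. e \<in> E \<Longrightarrow> e \<subseteq> V \<and> card e = 2"
    and connected: "\<And>u v. u \<in> V \<Longrightarrow> v \<in> V \<Longrightarrow> (u, v) \<in> {(a, b). {a, b} \<in> E}\<^sup>*"
    and acyclic: "\<And>c. \<not> is_cycle E c"
    and len_pos: "\<And>e. e \<in> E \<Longrightarrow> 0 < len e"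

definition tree_length :: "'a set set \<Rightarrow> ('a set \<Rightarrow> real) \<Rightarrow> real" where
  "tree_length E len = (\<Sum>e\<in>E. len e)"


text \<open>Points are given by barycentric coordinates, as in the geometric realization of a
  simplicial complex: the point of an edge \<open>e = {u, v}\<close> at distance \<open>t * len e\<close> from \<open>u\<close> has
  coordinates \<open>1 - t\<close> at \<open>u\<close>, \<open>t\<close> at \<open>v\<close> and \<open>0\<close> elsewhere, so points of different edges
  are equal exactly when they are the same vertex.\<close>

definition simplex_points :: "'a set \<Rightarrow> ('a \<Rightarrow> real) set" where
  "simplex_points S = {p. (\<forall>v. 0 \<le> p v) \<and> {v. p v \<noteq> 0} \<subseteq> S \<and> (\<Sum>v\<in>S. p v) = 1}"

definition tree_points :: "'a set \<Rightarrow> 'a set set \<Rightarrow> ('a \<Rightarrow> real) set" where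
  "tree_points V E = (\<Union>v\<in>V. simplex_points {v}) \<union> (\<Union>e\<in>E. simplex_points e)"

text \<open>Length of the segment between two points of the same edge. On \<open>e = {u, v}\<close> the two
  summands agree, so this is \<open>len e * \<bar>p u - q u\<bar>\<close>.\<close>

definition segment_length :: "('a set \<Rightarrow> real) \<Rightarrow> 'a set \<Rightarrow> ('a \<Rightarrow> real) \<Rightarrow> ('a \<Rightarrow> real) \<Rightarrow> real" where
  "segment_length len e p q = len e * (\<Sum>v\<in>e. \<bar>p v - q v\<bar>) / 2"

text \<open>A piecewise linear path from \<open>p\<close> to \<open>q\<close> with \<open>n\<close> segments: the \<open>i\<close>-th segment joins
  \<open>x i\<close> to \<open>x (Suc i)\<close> inside the closed edge \<open>e i\<close>. The constant path is the case \<open>n = 0\<close>.\<close>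

definition pl_path ::
    "'a set set \<Rightarrow> ('a \<Rightarrow> real) \<Rightarrow> ('a \<Rightarrow> real) \<Rightarrow> nat \<Rightarrow> (nat \<Rightarrow> 'a set) \<Rightarrow> (nat \<Rightarrow> 'a \<Rightarrow> real) \<Rightarrow> bool" where
  "pl_path E p q n e x \<longleftrightarrow> x 0 = p \<and> x n = q \<and>
     (\<forall>i<n. e i \<in> E \<and> x i \<in> simplex_points (e i) \<and> x (Suc i) \<in> simplex_points (e i))"

text \<open>The path metric: infimum of the lengths of piecewise linear paths. The value \<open>0\<close> off the tree
  only serves the locale \<open>Metric_space\<close>, which requires a distance function to be nonnegative
  everywhere.\<close>

definition tree_dist ::
    "'a set \<Rightarrow> 'a set set \<Rightarrow> ('a set \<Rightarrow> real) \<Rightarrow> ('a \<Rightarrow> real) \<Rightarrow> ('a \<Rightarrow> real) \<Rightarrow> real" where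
  "tree_dist V E len p q =
     (if p \<in> tree_points V E \<and> q \<in> tree_points V E
      then Inf {\<Sum>i<n. segment_length len (e i) (x i) (x (Suc i)) | n e x. pl_path E p q n e x}
      else 0)"


definition marked_space ::
    "'a set \<Rightarrow> 'a set set \<Rightarrow> ('a set \<Rightarrow> real) \<Rightarrow> real \<Rightarrow> (('a \<Rightarrow> real) \<times> real) topology" where
  "marked_space V E len r =
     prod_topology (Metric_space.mtopology (tree_points V E) (tree_dist V E len)) (top_of_set {0..r})"

text \<open>The Borel \<open>\<sigma>\<close>-algebra of an abstract topology, carried by the null measure.\<close>

definition borel_of_top :: "'b topology \<Rightarrow> 'b measure" where
  "borel_of_top X = sigma (topspace X) {U. openin X U}"

definition marked_ball ::
    "'a set \<Rightarrow> 'a set set \<Rightarrow> ('a set \<Rightarrow> real) \<Rightarrow> real \<Rightarrow> ('a \<Rightarrow> real) \<Rightarrow> (('a \<Rightarrow> real) \<times> real) set" where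
  "marked_ball V E len r x = {(v, s). v \<in> tree_points V E \<and> s \<in> {0..r} \<and> tree_dist V E len x v \<le> s}"

definition fractional_marked_ball_cover ::
    "'a set \<Rightarrow> 'a set set \<Rightarrow> ('a set \<Rightarrow> real) \<Rightarrow> real \<Rightarrow> (('a \<Rightarrow> real) \<times> real) measure \<Rightarrow> bool" where
  "fractional_marked_ball_cover V E len r \<xi> \<longleftrightarrow>
     sets \<xi> = sets (borel_of_top (marked_space V E len r)) \<and> finite_measure \<xi> \<and>
     (\<forall>x\<in>tree_points V E. 1 \<le> emeasure \<xi> (marked_ball V E len r x))"

text \<open>Radius measures are regarded as Borel measures on \<open>\<real>\<close> concentrated on \<open>[0,r]\<close>.\<close>

definition radius_measure :: "('b \<times> real) measure \<Rightarrow> real measure" where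
  "radius_measure \<xi> = distr \<xi> borel snd"

definition Lambda :: "'a set set \<Rightarrow> ('a set \<Rightarrow> real) \<Rightarrow> real \<Rightarrow> real measure" where
  "Lambda E len r =
     scale_measure (ennreal (tree_length E len / r)) (uniform_measure lborel {0..r})"


lemma segment_length_nonneg: "0 \<le> len e \<Longrightarrow> 0 \<le> segment_length len e p q"
  by (simp add: segment_length_def sum_nonneg)

lemma segment_length_commute: "segment_length len e p q = segment_length len e q p"
  by (simp add: segment_length_def abs_minus_commute)

context finite_metric_tree
begin

lemma finite_E: "finite E"
  using edges finite_V by (meson PowI finite_Pow_iff finite_subset subsetI)

definition path_lengths :: "('a \<Rightarrow> real) \<Rightarrow> ('a \<Rightarrow> real) \<Rightarrow> real set" where
  "path_lengths p q =
     {\<Sum>i<n. segment_length len (e i) (x i) (x (Suc i)) | n e x. pl_path E p q n e x}"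

lemma tree_dist_eq:
  assumes "p \<in> tree_points V E" "q \<in> tree_points V E"
  shows "tree_dist V E len p q = Inf (path_lengths p q)"
  using assms by (simp add: tree_dist_def path_lengths_def)

lemma path_lengths_nonneg: "l \<in> path_lengths p q \<Longrightarrow> 0 \<le> l"
  unfolding path_lengths_def pl_path_def
  by (auto intro!: sum_nonneg segment_length_nonneg simp: len_pos less_imp_le)

lemma bdd_below_path_lengths: "bdd_below (path_lengths p q)"
  by (rule bdd_belowI[of _ 0]) (rule path_lengths_nonneg)

lemma path_lengths_refl: "0 \<in> path_lengths p p"
  unfolding path_lengths_def pl_path_def
  by (rule CollectI, rule exI[of _ 0], rule exI, rule exI[of _ "\<lambda>_. p"]) simp

lemma path_lengths_edge:
  assumes "e \<in> E" "p \<in> simplex_points e" "q \<in> simplex_points e"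
  shows "segment_length len e p q \<in> path_lengths p q"
  unfolding path_lengths_def pl_path_def
  by (rule CollectI, rule exI[of _ 1], rule exI[of _ "\<lambda>_. e"],
      rule exI[of _ "\<lambda>i. if i = 0 then p else q"]) (use assms in auto)

lemma path_lengths_trans:
  assumes "a \<in> path_lengths p q" "b \<in> path_lengths q s"
  shows "a + b \<in> path_lengths p s"
proof -
  obtain n e x where 1: "a = (\<Sum>i<n. segment_length len (e i) (x i) (x (Suc i)))"
    "pl_path E p q n e x" using assms(1) unfolding path_lengths_def by blast
  obtain m f y where 2: "b = (\<Sum>i<m. segment_length len (f i) (y i) (y (Suc i)))"
    "pl_path E q s m f y" using assms(2) unfolding path_lengths_def by blast
  define g where "g i = (if i < n then e i else f (i - n))" for i
  define z where "z i = (if i < n then x i else y (i - n))" for i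
  have z1: "z i = x i" if "i \<le> n" for i
    using that 1(2) 2(2) by (cases "i = n") (auto simp: z_def pl_path_def)
  have z2: "z (n + i) = y i" and g2: "g (n + i) = f i" for i by (simp_all add: z_def g_def)
  have "pl_path E p s (n + m) g z"
    unfolding pl_path_def
  proof (intro conjI allI impI)
    show "z 0 = p" using 1(2) z1[of 0] by (simp add: pl_path_def)
    show "z (n + m) = s" using 2(2) z2 by (simp add: pl_path_def)
  next
    fix i assume i: "i < n + m"
    have "g i \<in> E \<and> z i \<in> simplex_points (g i) \<and> z (Suc i) \<in> simplex_points (g i)"
    proof (cases "i < n")
      case True
      then show ?thesis using 1(2) z1[of i] z1[of "Suc i"] by (auto simp: pl_path_def g_def)
    next
      case False
      then obtain j where j: "i = n + j" "j < m" using i by (metis add_diff_inverse_nat nat_add_left_cancel_less)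
      then show ?thesis using 2(2) z2[of j] z2[of "Suc j"] g2[of j] by (auto simp: pl_path_def)
    qed
    then show "g i \<in> E" "z i \<in> simplex_points (g i)" "z (Suc i) \<in> simplex_points (g i)" by auto
  qed
  moreover have "(\<Sum>i<n+m. segment_length len (g i) (z i) (z (Suc i))) = a + b"
  proof -
    have split: "(\<Sum>i<n+m. h i) = (\<Sum>i<n. h i) + (\<Sum>i<m. h (n + i))" for h :: "nat \<Rightarrow> real"
      by (induction m) (simp_all add: add.assoc)
    have "(\<Sum>i<n. segment_length len (g i) (z i) (z (Suc i))) = a"
      unfolding 1(1) by (rule sum.cong) (use z1 in \<open>auto simp: g_def\<close>)
    moreover have "(\<Sum>i<m. segment_length len (g (n + i)) (z (n + i)) (z (Suc (n + i)))) = b"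
      unfolding 2(1) using z2[of "Suc _"] by (simp add: z2 g2)
    ultimately show ?thesis using split by simp
  qed
  ultimately show ?thesis unfolding path_lengths_def by force
qed

lemma path_lengths_sym_sub: "path_lengths p q \<subseteq> path_lengths q p"
proof
  fix l assume "l \<in> path_lengths p q"
  then obtain n e x where l: "l = (\<Sum>i<n. segment_length len (e i) (x i) (x (Suc i)))"
    and path: "pl_path E p q n e x" unfolding path_lengths_def by blast
  have *: "(\<Sum>i<k. segment_length len (e i) (x i) (x (Suc i))) \<in> path_lengths (x k) (x 0)"
    if "k \<le> n" for k
    using that
  proof (induction k)
    case 0 show ?case by (simp add: path_lengths_refl)
  next
    case (Suc k)
    have "segment_length len (e k) (x (Suc k)) (x k) \<in> path_lengths (x (Suc k)) (x k)"
      using Suc.prems path by (intro path_lengths_edge) (auto simp: pl_path_def)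
    from path_lengths_trans[OF this Suc.IH] Suc.prems show ?case
      by (simp add: segment_length_commute add.commute)
  qed
  show "l \<in> path_lengths q p" using *[of n] path l by (simp add: pl_path_def)
qed

lemma path_lengths_sym: "path_lengths p q = path_lengths q p"
  using path_lengths_sym_sub by blast

abbreviation vertex_pt :: "'a \<Rightarrow> 'a \<Rightarrow> real" where
  "vertex_pt v \<equiv> (\<lambda>w. if w = v then 1 else 0)"

lemma vertex_pt_simplex: "finite S \<Longrightarrow> v \<in> S \<Longrightarrow> vertex_pt v \<in> simplex_points S"
  by (auto simp: simplex_points_def)

lemma finite_edge: "e \<in> E \<Longrightarrow> finite e"
  using edges finite_V finite_subset by blast

lemma path_lengths_vertices:
  assumes "u \<in> V" "v \<in> V" shows "path_lengths (vertex_pt u) (vertex_pt v) \<noteq> {}"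
  using connected[OF assms]
proof (induction rule: rtrancl_induct)
  case base show ?case using path_lengths_refl by blast
next
  case (step y z)
  then have e: "{y, z} \<in> E" by simp
  have "segment_length len {y, z} (vertex_pt y) (vertex_pt z) \<in> path_lengths (vertex_pt y) (vertex_pt z)"
    by (intro path_lengths_edge e vertex_pt_simplex) auto
  then show ?case using step.IH path_lengths_trans by blast
qed

lemma path_lengths_to_vertex:
  assumes "p \<in> tree_points V E" obtains u where "u \<in> V" "path_lengths p (vertex_pt u) \<noteq> {}"
proof -
  consider v where "v \<in> V" "p \<in> simplex_points {v}" | e where "e \<in> E" "p \<in> simplex_points e"
    using assms unfolding tree_points_def by blast
  then show thesis
  proof cases
    case 1
    have "p = vertex_pt v" using 1(2) by (auto simp: simplex_points_def fun_eq_iff)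
    then show thesis using that[OF 1(1)] path_lengths_refl by fast
  next
    case 2
    obtain u where u: "u \<in> e" using edges[OF 2(1)] by fastforce
    have "segment_length len e p (vertex_pt u) \<in> path_lengths p (vertex_pt u)"
      by (intro path_lengths_edge 2 vertex_pt_simplex finite_edge u)
    then show thesis using that u edges[OF 2(1)] by blast
  qed
qed

lemma path_lengths_nonempty:
  assumes "p \<in> tree_points V E" "q \<in> tree_points V E" shows "path_lengths p q \<noteq> {}"
proof -
  obtain u where u: "u \<in> V" "path_lengths p (vertex_pt u) \<noteq> {}"
    by (rule path_lengths_to_vertex[OF assms(1)])
  obtain v where v: "v \<in> V" "path_lengths q (vertex_pt v) \<noteq> {}"
    by (rule path_lengths_to_vertex[OF assms(2)])
  have "path_lengths (vertex_pt v) q \<noteq> {}" using v path_lengths_sym by metis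
  then show ?thesis
    using u path_lengths_vertices[OF u(1) v(1)] path_lengths_trans by blast
qed

lemma path_lengths_lower_bound:
  obtains m where "0 < m" "\<And>p q l v. l \<in> path_lengths p q \<Longrightarrow> m * \<bar>p v - q v\<bar> \<le> l"
proof
  define m where "m = Min (insert 1 (len ` E)) / 2"
  show m0: "0 < m" using finite_E len_pos by (auto simp: m_def)
  fix p q l v assume "l \<in> path_lengths p q"
  then obtain n e x where l: "l = (\<Sum>i<n. segment_length len (e i) (x i) (x (Suc i)))"
    and path: "pl_path E p q n e x" unfolding path_lengths_def by blast
  have seg: "m * \<bar>x i v - x (Suc i) v\<bar> \<le> segment_length len (e i) (x i) (x (Suc i))"
    if "i < n" for i
  proof (cases "v \<in> e i")
    case True
    have e: "e i \<in> E" using path that by (simp add: pl_path_def)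
    have "\<bar>x i v - x (Suc i) v\<bar> \<le> (\<Sum>v\<in>e i. \<bar>x i v - x (Suc i) v\<bar>)"
      by (rule member_le_sum[OF True]) (use finite_edge e in auto)
    moreover have "m \<le> len (e i) / 2" using e finite_E by (simp add: m_def)
    ultimately have "m * \<bar>x i v - x (Suc i) v\<bar> \<le> len (e i) / 2 * (\<Sum>v\<in>e i. \<bar>x i v - x (Suc i) v\<bar>)"
      using m0 by (intro mult_mono) auto
    then show ?thesis by (simp add: segment_length_def)
  next
    case False
    have "x i v = 0" "x (Suc i) v = 0" using path that False by (auto simp: pl_path_def simplex_points_def)
    then show ?thesis using path that len_pos
      by (simp add: pl_path_def segment_length_nonneg less_imp_le)
  qed
  have "m * \<bar>x 0 v - x k v\<bar> \<le> (\<Sum>i<k. segment_length len (e i) (x i) (x (Suc i)))" if "k \<le> n" for k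
    using that
  proof (induction k)
    case (Suc k)
    have "m * \<bar>x 0 v - x (Suc k) v\<bar> \<le> m * (\<bar>x 0 v - x k v\<bar> + \<bar>x k v - x (Suc k) v\<bar>)"
      using m0 by (intro mult_left_mono) auto
    also have "\<dots> = m * \<bar>x 0 v - x k v\<bar> + m * \<bar>x k v - x (Suc k) v\<bar>" by (simp add: distrib_left)
    also have "\<dots> \<le> (\<Sum>i<k. segment_length len (e i) (x i) (x (Suc i))) + segment_length len (e k) (x k) (x (Suc k))"
      using Suc seg[of k] by (intro add_mono) auto
    finally show ?case by simp
  qed simp
  from this[of n] show "m * \<bar>p v - q v\<bar> \<le> l" using l path by (simp add: pl_path_def)
qed

sublocale Metric_space "tree_points V E" "tree_dist V E len"
proof
  fix p q
  show "0 \<le> tree_dist V E len p q"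
  proof (cases "p \<in> tree_points V E \<and> q \<in> tree_points V E")
    case True
    then show ?thesis
      using path_lengths_nonempty path_lengths_nonneg
      by (auto simp: tree_dist_eq intro!: cInf_greatest)
  qed (auto simp: tree_dist_def)
  show "tree_dist V E len p q = tree_dist V E len q p"
  proof (cases "p \<in> tree_points V E \<and> q \<in> tree_points V E")
    case True
    then show ?thesis using path_lengths_sym[of p q] by (simp add: tree_dist_eq)
  qed (auto simp: tree_dist_def)
next
  fix p q assume pq: "p \<in> tree_points V E" "q \<in> tree_points V E"
  show "tree_dist V E len p q = 0 \<longleftrightarrow> p = q"
  proof
    assume 0: "tree_dist V E len p q = 0"
    obtain m where m: "0 < m" "\<And>p q l v. l \<in> path_lengths p q \<Longrightarrow> m * \<bar>p v - q v\<bar> \<le> l"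
      using path_lengths_lower_bound by blast
    have "m * \<bar>p v - q v\<bar> \<le> Inf (path_lengths p q)" for v
      using path_lengths_nonempty[OF pq] m(2) by (intro cInf_greatest)
    then have "m * \<bar>p v - q v\<bar> \<le> 0" for v using 0 pq by (simp add: tree_dist_eq)
    then show "p = q" using m(1) by (auto simp: mult_le_0_iff)
  next
    assume "p = q"
    then have "Inf (path_lengths p q) \<le> 0"
      using path_lengths_refl bdd_below_path_lengths by (auto intro!: cInf_lower)
    moreover have "0 \<le> Inf (path_lengths p q)"
      using path_lengths_nonempty[OF pq] path_lengths_nonneg by (intro cInf_greatest)
    ultimately show "tree_dist V E len p q = 0" using pq by (simp add: tree_dist_eq)
  qed
next
  fix p q s assume pqs: "p \<in> tree_points V E" "q \<in> tree_points V E" "s \<in> tree_points V E"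
  have "Inf (path_lengths p s) \<le> a + b" if "a \<in> path_lengths p q" "b \<in> path_lengths q s" for a b
    using path_lengths_trans[OF that] bdd_below_path_lengths by (rule cInf_lower)
  then have "Inf (path_lengths p s) - b \<le> Inf (path_lengths p q)" if "b \<in> path_lengths q s" for b
    using path_lengths_nonempty[OF pqs(1,2)] that by (intro cInf_greatest) (auto simp: diff_le_eq)
  then have "Inf (path_lengths p s) - Inf (path_lengths p q) \<le> Inf (path_lengths q s)"
    using path_lengths_nonempty[OF pqs(2,3)] by (intro cInf_greatest) (auto simp: algebra_simps)
  then show "tree_dist V E len p s \<le> tree_dist V E len p q + tree_dist V E len q s"
    using pqs by (simp add: tree_dist_eq)
qed

lemma topspace_marked_space: "topspace (marked_space V E len r) = tree_points V E \<times> {0..r}"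
  by (simp add: marked_space_def)

lemma space_borel_marked_space:
  "space (borel_of_top (marked_space V E len r)) = tree_points V E \<times> {0..r}"
  by (simp add: borel_of_top_def topspace_marked_space space_measure_of_conv)

lemma openin_borel_of_top: "openin X U \<Longrightarrow> U \<in> sets (borel_of_top X)"
  unfolding borel_of_top_def
  by (subst sets_measure_of) (auto dest: openin_subset)

lemma marked_ball_measurable:
  assumes "x \<in> tree_points V E"
  shows "marked_ball V E len r x \<in> sets (borel_of_top (marked_space V E len r))"
proof -
  let ?X = "marked_space V E len r" and ?T = "tree_points V E" and ?d = "tree_dist V E len"
  let ?C = "{(v, s). v \<in> ?T \<and> s \<in> {0..r} \<and> s < ?d x v}"
  have "openin ?X ?C"
    unfolding marked_space_def openin_prod_topology_alt
  proof (intro allI impI)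
    fix v s assume vs: "(v, s) \<in> ?C"
    define \<epsilon> where "\<epsilon> = (?d x v - s) / 2"
    have "\<epsilon> > 0" using vs by (simp add: \<epsilon>_def)
    have "mball v \<epsilon> \<times> ({0..r} \<inter> {..<s + \<epsilon>}) \<subseteq> ?C"
    proof
      fix z assume z: "z \<in> mball v \<epsilon> \<times> ({0..r} \<inter> {..<s + \<epsilon>})"
      obtain w t where zwt: "z = (w, t)" by fastforce
      have w: "w \<in> mball v \<epsilon>" and t: "0 \<le> t" "t \<le> r" "t < s + \<epsilon>" using z zwt by auto
      then have wT: "w \<in> ?T" and "?d v w < \<epsilon>" by auto
      moreover have "?d x v \<le> ?d x w + ?d w v" using assms vs wT by (intro triangle) auto
      ultimately have "t < ?d x w" using t commute[of v w] by (simp add: \<epsilon>_def field_simps)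
      then show "z \<in> ?C" using wT t zwt by simp
    qed
    moreover have "openin (top_of_set {0..r}) ({0..r} \<inter> {..<s + \<epsilon>})"
      by (simp add: openin_open_Int)
    moreover have "v \<in> mball v \<epsilon>" "s \<in> {0..r} \<inter> {..<s + \<epsilon>}" using vs \<open>\<epsilon> > 0\<close> by auto
    ultimately show "\<exists>A B. openin mtopology A \<and> openin (top_of_set {0..r}) B \<and>
        v \<in> A \<and> s \<in> B \<and> A \<times> B \<subseteq> ?C"
      using openin_mball by blast
  qed
  then have "space (borel_of_top ?X) - ?C \<in> sets (borel_of_top ?X)"
    using openin_borel_of_top by blast
  moreover have "space (borel_of_top ?X) - ?C = marked_ball V E len r x"
    by (auto simp: space_borel_marked_space marked_ball_def)
  ultimately show ?thesis by simp
qed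

lemma snd_measurable_marked_space:
  "snd \<in> borel_of_top (marked_space V E len r) \<rightarrow>\<^sub>M borel"
proof (rule borel_measurableI)
  fix S :: "real set" assume "open S"
  then have "openin (prod_topology mtopology (top_of_set {0..r})) (tree_points V E \<times> ({0..r} \<inter> S))"
    by (auto simp: openin_prod_Times_iff openin_open_Int)
  moreover have "snd -` S \<inter> space (borel_of_top (marked_space V E len r)) =
      tree_points V E \<times> ({0..r} \<inter> S)"
    by (auto simp: space_borel_marked_space)
  ultimately show "snd -` S \<inter> space (borel_of_top (marked_space V E len r))
      \<in> sets (borel_of_top (marked_space V E len r))"
    by (simp add: openin_borel_of_top marked_space_def)
qed

end

end

theory Submission
  imports Defs "HOL-Probability.Distribution_Functions" "HOL-Library.Multiset"
begin

text \<open>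
  Enlarging the radius of a ball keeps a cover a cover, so only the mass carried by the radii above
  each level matters. If a measure on marked balls covers every point with mass at least \<open>1\<close> and gives
  the radii above \<open>t\<close> mass at most \<open>L / r\<^sup>2 * (r - t)\<close>, then pushing its radii up by a monotone
  rearrangement brings their law below \<open>\<Lambda>\<close> (\<open>push_up_law\<close>, \<open>coverable_of_families\<close>). It remains to find
  such a measure. Below it is described up to the factor \<open>2 * r\<^sup>2\<close>; \<open>comb_coverable\<close> carries out the
  construction.

  Choose a longest path of the tree, say of length \<open>D\<close>, with coordinates in \<open>[0, D]\<close> (the spine). The
  rest of the tree consists of bushes hanging at points \<open>q\<close> of the spine, and a bush has height
  \<open>h \<le> min q (D - q)\<close>. Let \<open>\<rho> = min (D / 2) r\<close>. The measure has four parts.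

  \<^item> End balls: with weight \<open>2 * \<rho>\<close>, for \<open>s \<in> [0, \<rho>]\<close> the balls of radius \<open>s\<close> that cover \<open>[0, 2 * s]\<close> and
    \<open>[D - 2 * s, D]\<close>.

  \<^item> Windows: for \<open>u \<in> [0, D - 2 * \<rho>]\<close> cut \<open>[u, u + 2 * \<rho>]\<close> at a uniform point and cover each half by
    a ball whose radius is half the length of that half. Both radii are uniform on \<open>[0, \<rho>]\<close>, and their sum
    is \<open>\<rho>\<close>. On a bare interval the windows and the end balls cover every point with total
    mass exactly \<open>2 * \<rho>\<^sup>2\<close>.

  \<^item> Bush balls: with weight \<open>2 * \<rho>\<close>, for each point \<open>p\<close> of a bush, chosen uniformly by length, the ball
    about \<open>p\<close> whose radius is the height of the bush below \<open>p\<close>. They cover a point at height \<open>a\<close> in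
    a bush of height \<open>h\<close> with mass at least \<open>\<rho> * (a + h)\<close> (\<open>arms_cover\<close>).

  \<^item> If \<open>\<rho> < r\<close>, balls about the midpoint of the spine with radius in \<open>[\<rho>, r]\<close>. They contain the tree.

  A point at height \<open>a\<close> above \<open>q\<close> lies in the ball that covers \<open>[u, w]\<close> as soon as
  \<open>[q - a, q + a] \<subseteq> [u, w]\<close>. Hence it loses mass against \<open>q\<close> itself, and the bush balls alone do not pay for
  this loss. Therefore a window that contains \<open>[q - h, q + h]\<close> is cut so that one of the two halves
  contains the whole bush: the half that contains \<open>q\<close> is stretched (\<open>reach\<close>). Then the balance is right for
  every point (\<open>comb_inequality\<close>). The stretching increases the masses above level \<open>t\<close>, but bush balls are
  small: a bush of total length \<open>\<kappa>\<close> may use \<open>2 * \<kappa> * (\<rho> - t)\<close> and its balls leave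
  \<open>2 * (h * (\<rho> - t) - \<rho> * max 0 (h - t))\<close> of this (\<open>arms_tail\<close>), which is what the stretching on its two
  sides needs (\<open>stretch_measure\<close>).

  The balance requires \<open>min q (D - q) + h \<le> 2 * \<rho>\<close>. If this fails at a bush, then \<open>\<rho> = r\<close> and the foot of
  the bush cuts the tree into the bush and two other parts such that any two of the three have joint length
  at least \<open>2 * r\<close>. By induction on the number of edges the three unions of two parts have covers, and half
  the sum of these covers the tree, with the right radius measure (\<open>coverable_average\<close>, \<open>rtree_coverable\<close>).

  Distances in the tree are only ever bounded from above, by the length of some path. Acyclicity serves to
  write the tree as a rooted tree term in which every edge occurs once (\<open>rtree_of_tree\<close>).
\<close>

section \<open>Sums of measures and images of Lebesgue measure on a region\<close>

text \<open>The reference measure \<open>B\<close> only provides the space and the \<open>\<sigma>\<close>-algebra, so that the empty sum makes sense.\<close>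

definition sum_measure :: "'b measure \<Rightarrow> 'b measure list \<Rightarrow> 'b measure" where
  "sum_measure B Ms = measure_of (space B) (sets B) (\<lambda>A. \<Sum>M\<leftarrow>Ms. emeasure M A)"

lemma space_sum_measure [simp]: "space (sum_measure B Ms) = space B"
  by (simp add: sum_measure_def sets.space_closed space_measure_of)

lemma sets_sum_measure [simp]: "sets (sum_measure B Ms) = sets B"
  by (simp add: sum_measure_def)

lemma emeasure_sum_measure:
  assumes "\<And>M. M \<in> set Ms \<Longrightarrow> sets M = sets B" and "A \<in> sets B"
  shows "emeasure (sum_measure B Ms) A = (\<Sum>M\<leftarrow>Ms. emeasure M A)"
proof (rule emeasure_measure_of[OF sum_measure_def])
  show "sets B \<subseteq> Pow (space B)" by (rule sets.space_closed)
  show "A \<in> sets (sum_measure B Ms)" using assms(2) by simp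
  show "positive (sets (sum_measure B Ms)) (\<lambda>A. \<Sum>M\<leftarrow>Ms. emeasure M A)"
    by (simp add: positive_def sum_list_0)
  show "countably_additive (sets (sum_measure B Ms)) (\<lambda>A. \<Sum>M\<leftarrow>Ms. emeasure M A)"
  proof (rule countably_additiveI)
    fix F :: "nat \<Rightarrow> 'a set"
    assume F: "range F \<subseteq> sets (sum_measure B Ms)" "disjoint_family F"
    show "(\<Sum>i. \<Sum>M\<leftarrow>Ms. emeasure M (F i)) = (\<Sum>M\<leftarrow>Ms. emeasure M (\<Union>i. F i))"
      using assms(1)
    proof (induction Ms)
      case (Cons M Ms)
      have "(\<Sum>i. emeasure M (F i)) = emeasure M (\<Union>i. F i)"
        using F Cons.prems[of M] by (intro suminf_emeasure) auto
      moreover have "(\<Sum>i. \<Sum>M\<leftarrow>Ms. emeasure M (F i)) = (\<Sum>M\<leftarrow>Ms. emeasure M (\<Union>i. F i))"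
        using Cons by auto
      ultimately show ?case by (simp add: suminf_add[symmetric])
    qed simp
  qed
qed

definition image_of_region ::
    "real \<Rightarrow> 'b::euclidean_space set \<Rightarrow> ('b \<Rightarrow> real \<times> real) \<Rightarrow> (real \<times> real) measure" where
  "image_of_region w S f = distr (density lborel (\<lambda>p. ennreal w * indicator S p)) borel f"

lemma sets_image_of_region [simp]: "sets (image_of_region w S f) = sets borel"
  by (simp add: image_of_region_def)

lemma emeasure_image_of_region:
  assumes [measurable]: "S \<in> sets borel" "f \<in> borel_measurable borel" "X \<in> sets borel"
  shows "emeasure (image_of_region w S f) X = ennreal w * emeasure lborel {p \<in> S. f p \<in> X}"
proof -
  have "emeasure (image_of_region w S f) X = emeasure (density lborel (\<lambda>p. ennreal w * indicator S p)) (f -` X)"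
    unfolding image_of_region_def by (subst emeasure_distr) auto
  also have "\<dots> = (\<integral>\<^sup>+p. ennreal w * indicator S p * indicator (f -` X) p \<partial>lborel)"
    by (subst emeasure_density) (use measurable_sets[OF assms(2,3)] in auto)
  also have "\<dots> = (\<integral>\<^sup>+p. ennreal w * indicator {p \<in> S. f p \<in> X} p \<partial>lborel)"
    by (intro nn_integral_cong) (auto split: split_indicator)
  also have "\<dots> = ennreal w * emeasure lborel {p \<in> S. f p \<in> X}"
    by (subst nn_integral_cmult_indicator) auto
  finally show ?thesis .
qed

lemma finite_image_of_region:
  assumes "S \<in> sets borel" "f \<in> borel_measurable borel" "emeasure lborel S < \<infinity>"
  shows "finite_measure (image_of_region w S f)"
proof (rule finite_measureI)
  have "space (image_of_region w S f) = UNIV" by (simp add: image_of_region_def)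
  moreover have "{p \<in> S. f p \<in> UNIV} = S" by auto
  ultimately have "emeasure (image_of_region w S f) (space (image_of_region w S f)) = ennreal w * emeasure lborel S"
    using emeasure_image_of_region[OF assms(1,2), of UNIV w] by simp
  then show "emeasure (image_of_region w S f) (space (image_of_region w S f)) \<noteq> \<infinity>"
    using assms(3) by (simp add: ennreal_mult_eq_top_iff less_top)
qed

lemma finite_sum_measure:
  assumes "\<And>M. M \<in> set Ms \<Longrightarrow> sets M = sets B \<and> finite_measure M"
  shows "finite_measure (sum_measure B Ms)"
proof (rule finite_measureI)
  have "emeasure (sum_measure B Ms) (space B) = (\<Sum>M\<leftarrow>Ms. emeasure M (space B))"
    using assms by (intro emeasure_sum_measure) auto
  also have "\<dots> < \<infinity>"
    using assms
  proof (induction Ms)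
    case (Cons M Ms)
    then have "emeasure M (space B) \<noteq> \<infinity>"
      using finite_measure.emeasure_finite[of M "space B"] by simp
    then show ?case using Cons by (simp add: less_top)
  qed simp
  finally show "emeasure (sum_measure B Ms) (space (sum_measure B Ms)) \<noteq> \<infinity>" by simp
qed

section \<open>Enlarging radii\<close>

text \<open>The monotone rearrangement: \<open>t\<close> moves to the level \<open>t'\<close> at which \<open>lam * (r - t')\<close> equals the \<open>\<nu>\<close>-mass above \<open>t\<close>.\<close>

definition push_up :: "real measure \<Rightarrow> real \<Rightarrow> real \<Rightarrow> real \<Rightarrow> real" where
  "push_up \<nu> lam r t = r - measure \<nu> {t<..} / lam"

text \<open>If \<open>\<nu>\<close> has no atoms, its tail function is continuous, so the rearranged measure gives mass
  \<open>min (\<nu> UNIV) (lam * (r - x))\<close> to the points above \<open>x \<le> r\<close>. Hence it is \<open>lam\<close> times Lebesgue measure on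
  an interval that ends in \<open>r\<close>. The tail bound says that points move to the right.\<close>

lemma push_up_law:
  fixes \<nu> :: "real measure"
  assumes sets: "sets \<nu> = sets borel" and fin: "finite_measure \<nu>"
    and atomless: "\<And>t. emeasure \<nu> {t} = 0"
    and lower: "emeasure \<nu> {..<0} = 0"
    and lam: "0 < lam" and r: "0 \<le> r"
    and tail: "\<And>t. 0 \<le> t \<Longrightarrow> t \<le> r \<Longrightarrow> emeasure \<nu> {t<..} \<le> ennreal (lam * (r - t))"
  shows "mono (push_up \<nu> lam r)"
    and "\<And>t. 0 \<le> t \<Longrightarrow> t \<le> r \<Longrightarrow> t \<le> push_up \<nu> lam r t"
    and "\<And>t. 0 \<le> push_up \<nu> lam r t \<and> push_up \<nu> lam r t \<le> r"
    and "\<And>A. A \<in> sets borel \<Longrightarrow>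
      emeasure \<nu> {t. push_up \<nu> lam r t \<in> A} \<le> ennreal lam * emeasure lborel (A \<inter> {0..r})"
proof -
  interpret finite_measure \<nu> by fact
  interpret finite_borel_measure \<nu>
    by (rule finite_borel_measure.intro, rule fin) (simp add: finite_borel_measure_axioms_def sets)
  have space [simp]: "space \<nu> = UNIV" using sets_eq_imp_space_eq[OF sets] by simp
  let ?G = "\<lambda>t. measure \<nu> {t<..}"
  let ?N = "measure \<nu> UNIV"
  let ?\<phi> = "push_up \<nu> lam r"
  have G_cdf: "?G t = ?N - cdf \<nu> t" for t
  proof -
    have "{t<..} = space \<nu> - {..t}" by auto
    then show ?thesis unfolding cdf_def using finite_measure_compl[of "{..t}"] sets by simp
  qed
  have G_cont: "isCont ?G t" for t
  proof -
    have "measure \<nu> {t} = 0" using atomless by (simp add: measure_def)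
    then have "isCont (cdf \<nu>) t" by (simp add: isCont_cdf)
    then show ?thesis unfolding G_cdf by (intro continuous_intros)
  qed
  have G_mono: "?G t \<le> ?G s" if "s \<le> t" for s t
    using that sets by (intro finite_measure_mono) auto
  have G_tail: "?G t \<le> lam * (r - t)" if "0 \<le> t" "t \<le> r" for t
    using tail[OF that] lam that unfolding emeasure_eq_measure
    by (subst (asm) ennreal_le_iff) auto
  have G0: "?G 0 = ?N"
  proof -
    have "emeasure \<nu> ({..<0} \<union> {0}) \<le> emeasure \<nu> {..<0} + emeasure \<nu> {0}"
      using sets by (intro emeasure_subadditive) auto
    moreover have "{..<0} \<union> {0} = {..0::real}" by auto
    ultimately have "emeasure \<nu> {..0} = 0" using lower atomless[of 0] by simp
    then have "cdf \<nu> 0 = 0" by (simp add: cdf_def measure_def)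
    then show ?thesis using G_cdf[of 0] by linarith
  qed
  have GN: "?G t \<le> ?N" for t using sets by (intro finite_measure_mono) auto
  have Nr: "?N \<le> lam * r" using G_tail[of 0] r G0 by simp
  have Gr: "?G r = 0" using G_tail[of r] r by (simp add: antisym)
  show mono: "mono ?\<phi>"
    unfolding push_up_def mono_def using lam by (auto intro!: divide_right_mono G_mono)
  show "t \<le> ?\<phi> t" if "0 \<le> t" "t \<le> r" for t
  proof -
    have "?G t / lam \<le> r - t" using G_tail[OF that] lam by (simp add: divide_le_eq mult.commute)
    then show ?thesis by (simp add: push_up_def)
  qed
  show "0 \<le> ?\<phi> t \<and> ?\<phi> t \<le> r" for t
  proof -
    have "?G t \<le> lam * r" using GN[of t] Nr by simp
    then have "?G t / lam \<le> r" using lam by (simp add: divide_le_eq mult.commute)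
    then show ?thesis using lam by (simp add: push_up_def)
  qed
  have meas [measurable]: "?\<phi> \<in> borel_measurable borel" using mono by (rule borel_measurable_mono)
  let ?\<mu> = "density lborel (\<lambda>p. ennreal lam * indicator {r - ?N / lam..r} p)"
  have \<mu>: "emeasure ?\<mu> A = ennreal lam * emeasure lborel (A \<inter> {r - ?N / lam..r})" if "A \<in> sets borel" for A
  proof -
    have "emeasure ?\<mu> A = (\<integral>\<^sup>+p. ennreal lam * indicator (A \<inter> {r - ?N / lam..r}) p \<partial>lborel)"
      using that by (subst emeasure_density) (auto intro!: nn_integral_cong split: split_indicator)
    then show ?thesis using that by (simp add: nn_integral_cmult_indicator)
  qed
  have N0: "0 \<le> ?N / lam" using lam by simp
  have eq: "distr \<nu> borel ?\<phi> = ?\<mu>"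
  proof (rule measure_eqI_lessThan)
    fix x
    have d: "emeasure (distr \<nu> borel ?\<phi>) {x<..} = emeasure \<nu> {t. ?G t < lam * (r - x)}"
    proof -
      have "?\<phi> -` {x<..} \<inter> space \<nu> = {t. ?G t < lam * (r - x)}"
        using lam by (auto simp: push_up_def field_simps)
      then show ?thesis by (subst emeasure_distr) (auto simp: measurable_cong_sets[OF sets refl])
    qed
    show "emeasure (distr \<nu> borel ?\<phi>) {x<..} < \<infinity>"
      unfolding d by (simp add: emeasure_eq_measure)
    show "emeasure (distr \<nu> borel ?\<phi>) {x<..} = emeasure ?\<mu> {x<..}"
    proof -
      consider "x \<ge> r" | "x < r - ?N / lam" | "r - ?N / lam \<le> x" "x < r" by linarith
      then show ?thesis
      proof cases
        case 1
        then have "lam * (r - x) \<le> 0" using lam by (simp add: mult_le_0_iff)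
        then have "{t. ?G t < lam * (r - x)} = {}" 
            using measure_nonneg[of \<nu>] by (auto simp: not_less intro: order_trans)
        moreover have "{x<..} \<inter> {r - ?N / lam..r} = {}" using 1 by auto
        ultimately show ?thesis unfolding d \<mu>[OF borel_open[OF open_greaterThan]] by simp
      next
        case 2
        then have "?N < lam * (r - x)" using lam by (simp add: field_simps)
        then have "{t. ?G t < lam * (r - x)} = UNIV" using GN by (auto intro: le_less_trans)
        moreover have "{x<..} \<inter> {r - ?N / lam..r} = {r - ?N / lam..r}" using 2 by auto
        ultimately show ?thesis unfolding d \<mu>[OF borel_open[OF open_greaterThan]]
          using N0 lam by (simp add: emeasure_eq_measure ennreal_mult[symmetric])
      next
        case 3
        define p where "p = lam * (r - x)"
        have p: "0 < p" "p \<le> ?N" using 3 lam by (auto simp: p_def field_simps)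
        define S where "S = {t. p \<le> ?G t}"
        \<comment> \<open>the last point with mass at least \<open>p\<close> above it\<close>
        define t1 where "t1 = Sup S"
        have S0: "0 \<in> S" using p G0 by (simp add: S_def)
        have Sb: "bdd_above S"
        proof (rule bdd_aboveI)
          fix t assume "t \<in> S"
          then show "t \<le> r" using G_mono[of r t] Gr p unfolding S_def by (cases "t \<le> r") auto
        qed
        have "closed S" unfolding S_def
          by (intro closed_Collect_le continuous_intros continuous_at_imp_continuous_on ballI G_cont)
        then have t1S: "t1 \<in> S" unfolding t1_def using S0 Sb by (intro closed_contains_Sup) auto
        have le: "t \<le> t1" if "t \<in> S" for t unfolding t1_def using that Sb by (rule cSup_upper)
        have "?G t1 \<le> p"
        proof (rule tendsto_upperbound)
          show "(?G \<longlongrightarrow> ?G t1) (at_right t1)"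
            using G_cont[of t1] by (simp add: continuous_at filterlim_at_split)
          have "?G t \<le> p" if "t1 < t" for t
            using le[of t] that unfolding S_def by (cases "p \<le> ?G t") auto
          then show "\<forall>\<^sub>F t in at_right t1. ?G t \<le> p"
            by (simp add: eventually_at_filter)
        qed auto
        then have Gt1: "?G t1 = p" using t1S by (simp add: S_def)
        have "?G t < p \<longleftrightarrow> t1 < t" for t
          using le[of t] t1S G_mono[of t t1] unfolding S_def mem_Collect_eq by linarith
        then have "{t. ?G t < p} = {t1<..}" by auto
        then have "emeasure \<nu> {t. ?G t < p} = ennreal p" using Gt1 by (simp add: emeasure_eq_measure)
        moreover have "{x<..} \<inter> {r - ?N / lam..r} = {x<..r}" using 3 by auto
        ultimately show ?thesis unfolding d \<mu>[OF borel_open[OF open_greaterThan]]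
          using 3 lam by (simp add: p_def ennreal_mult[symmetric])
      qed
    qed
  qed (auto simp: )
  fix A :: "real set" assume A: "A \<in> sets borel"
  have "emeasure \<nu> {t. ?\<phi> t \<in> A} = emeasure (distr \<nu> borel ?\<phi>) A"
    using A by (subst emeasure_distr) (auto simp: measurable_cong_sets[OF sets refl] vimage_def)
  also have "\<dots> = ennreal lam * emeasure lborel (A \<inter> {r - ?N / lam..r})" unfolding eq \<mu>[OF A] ..
  also have "\<dots> \<le> ennreal lam * emeasure lborel (A \<inter> {0..r})"
  proof -
    have "?N / lam \<le> r" using Nr lam by (simp add: divide_le_eq mult.commute)
    then have "A \<inter> {r - ?N / lam..r} \<subseteq> A \<inter> {0..r}" by auto
    then show ?thesis using A by (intro mult_left_mono emeasure_mono) auto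
  qed
  finally show "emeasure \<nu> {t. ?\<phi> t \<in> A} \<le> ennreal lam * emeasure lborel (A \<inter> {0..r})" .
qed

section \<open>Families of balls centred on curves\<close>

context finite_metric_tree
begin

abbreviation TP :: "('a \<Rightarrow> real) set" where "TP \<equiv> tree_points V E"
abbreviation td :: "('a \<Rightarrow> real) \<Rightarrow> ('a \<Rightarrow> real) \<Rightarrow> real" where "td \<equiv> tree_dist V E len"

text \<open>Centres are moved along 1-Lipschitz curves. The parameter runs through all of \<open>\<real>\<close>, so that a family of
  balls is a measure on pairs of a parameter and a radius.\<close>

definition short_curve :: "(real \<Rightarrow> 'a \<Rightarrow> real) \<Rightarrow> bool" where
  "short_curve g \<longleftrightarrow> (\<forall>c. g c \<in> TP) \<and> (\<forall>c c'. td (g c) (g c') \<le> \<bar>c - c'\<bar>)"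

text \<open>The conclusion of the theorem for a part \<open>X\<close> of the tree and for an arbitrary density \<open>lam\<close> of the radii.
  The balls are those of the whole tree, so that covers of different parts can be added.\<close>

definition coverable :: "real \<Rightarrow> real \<Rightarrow> ('a \<Rightarrow> real) set \<Rightarrow> bool" where
  "coverable r lam X \<longleftrightarrow> (\<exists>\<xi>. sets \<xi> = sets (borel_of_top (marked_space V E len r)) \<and>
     finite_measure \<xi> \<and> (\<forall>x\<in>X. 1 \<le> emeasure \<xi> (marked_ball V E len r x)) \<and>
     (\<forall>A\<in>sets borel. emeasure (radius_measure \<xi>) A \<le> ennreal lam * emeasure lborel (A \<inter> {0..r})))"

definition balls_over :: "(real \<Rightarrow> 'a \<Rightarrow> real) \<Rightarrow> ('a \<Rightarrow> real) \<Rightarrow> (real \<times> real) set" where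
  "balls_over g x = {(c, s). td x (g c) \<le> s}"

lemma short_curve_in: "short_curve g \<Longrightarrow> g c \<in> TP"
  by (simp add: short_curve_def)

lemma continuous_dist_short_curve:
  assumes "short_curve g" "x \<in> TP" shows "continuous_on UNIV (\<lambda>c. td x (g c))"
proof (rule continuous_onI)
  fix c e :: real assume "0 < e"
  have "\<bar>td x (g c') - td x (g c)\<bar> \<le> \<bar>c' - c\<bar>" for c'
  proof -
    have g: "g c \<in> TP" "g c' \<in> TP" using assms(1) short_curve_in by auto
    have "td (g c) (g c') \<le> \<bar>c - c'\<bar>" using assms(1) by (simp add: short_curve_def)
    then show ?thesis
      using triangle[OF assms(2) g] triangle[OF assms(2) g(2,1)] commute[of "g c" "g c'"] by linarith
  qed
  then show "\<exists>d>0. \<forall>c'\<in>UNIV. dist c' c < d \<longrightarrow> dist (td x (g c')) (td x (g c)) \<le> e"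
    using \<open>0 < e\<close> by (intro exI[of _ e]) (auto simp: dist_real_def intro: order_trans less_imp_le)
qed

lemma balls_over_measurable [measurable]:
  assumes "short_curve g" "x \<in> TP" shows "balls_over g x \<in> sets borel"
proof -
  have [measurable]: "(\<lambda>c. td x (g c)) \<in> borel_measurable borel"
    using continuous_dist_short_curve[OF assms] by (rule borel_measurable_continuous_onI)
  have "{p \<in> space (borel \<Otimes>\<^sub>M borel). td x (g (fst p)) \<le> (snd p :: real)} \<in> sets (borel \<Otimes>\<^sub>M borel)"
    by measurable
  then have "{p :: real \<times> real. td x (g (fst p)) \<le> snd p} \<in> sets borel"
    unfolding borel_prod by simp
  moreover have "balls_over g x = {p. td x (g (fst p)) \<le> snd p}" by (auto simp: balls_over_def)
  ultimately show ?thesis by simp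
qed

text \<open>Measurable components do not make a map measurable into the Borel sets of a product topology in general.
  Here the map factors through a Borel map of the plane and a continuous map from the plane to the marked space.\<close>

lemma measurable_marked_curve:
  fixes f :: "real \<Rightarrow> real"
  assumes "short_curve g" and "f \<in> borel_measurable borel" and "\<And>s. f s \<in> {0..r}"
  shows "(\<lambda>(c, s). (g c, f s)) \<in> borel \<rightarrow>\<^sub>M borel_of_top (marked_space V E len r)"
proof -
  have r: "0 \<le> r" using assms(3)[of 0] by auto
  let ?cl = "\<lambda>s. max 0 (min r s)"
  let ?h = "\<lambda>p :: real \<times> real. (g (fst p), ?cl (snd p))"
  have "continuous_map euclidean mtopology g"
    unfolding continuous_map_to_metric
  proof (intro ballI allI impI)
    fix c e :: real assume e: "0 < e"
    have "\<forall>c'\<in>ball c e. g c' \<in> mball (g c) e"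
    proof
      fix c' assume "c' \<in> ball c e"
      then have "\<bar>c - c'\<bar> < e" by (simp add: dist_real_def)
      moreover have "td (g c) (g c') \<le> \<bar>c - c'\<bar>" using assms(1) by (simp add: short_curve_def)
      ultimately show "g c' \<in> mball (g c) e" using short_curve_in[OF assms(1)] by simp
    qed
    then show "\<exists>U. openin euclidean U \<and> c \<in> U \<and> (\<forall>y\<in>U. g y \<in> mball (g c) e)"
      using e by (intro exI[of _ "ball c e"]) auto
  qed
  then have g: "continuous_map euclidean mtopology (g \<circ> fst)"
    by (rule continuous_map_compose[rotated])
      (unfold continuous_map_iff_continuous2, intro continuous_intros)
  have "continuous_on UNIV (\<lambda>p :: real \<times> real. ?cl (snd p))"
    by (intro continuous_intros)
  then have c: "continuous_map euclidean (top_of_set {0..r}) (\<lambda>p :: real \<times> real. ?cl (snd p))"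
    using r by (auto simp: continuous_map_in_subtopology)
  have cont: "continuous_map euclidean (marked_space V E len r) ?h"
    unfolding marked_space_def using g c by (intro continuous_map_pairedI) (auto simp: comp_def)
  have h: "?h \<in> borel \<rightarrow>\<^sub>M borel_of_top (marked_space V E len r)"
    unfolding borel_of_top_def
  proof (rule measurable_measure_of)
    show "{U. openin (marked_space V E len r) U} \<subseteq> Pow (topspace (marked_space V E len r))"
      by (auto dest: openin_subset)
    show "?h \<in> space borel \<rightarrow> topspace (marked_space V E len r)"
      using r short_curve_in[OF assms(1)] by (auto simp: topspace_marked_space)
    fix U assume "U \<in> {U. openin (marked_space V E len r) U}"
    then have "openin euclidean {p \<in> topspace euclidean. ?h p \<in> U}"
      using cont by (intro openin_continuous_map_preimage[of _ "marked_space V E len r"]) auto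
    then show "?h -` U \<inter> space borel \<in> sets borel"
      by (intro borel_open) (auto simp: vimage_def)
  qed
  have "(\<lambda>(c, s). (g c, f s)) = ?h \<circ> (\<lambda>p :: real \<times> real. (fst p, f (snd p)))"
    using assms(3) by (auto simp: fun_eq_iff)
  moreover have "(\<lambda>p :: real \<times> real. (fst p, f (snd p))) \<in> borel \<rightarrow>\<^sub>M borel"
    using assms(2) unfolding borel_prod[symmetric] by measurable
  ultimately show ?thesis using h by (auto intro: measurable_comp)
qed

type_synonym 'b family = "(real \<Rightarrow> 'b \<Rightarrow> real) \<times> (real \<times> real) measure"

text \<open>Radii without atoms are what the rearrangement of radii needs.\<close>

definition admissible :: "'a family \<Rightarrow> bool" where
  "admissible F \<longleftrightarrow> short_curve (fst F) \<and> sets (snd F) = sets borel \<and> finite_measure (snd F) \<and>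
     emeasure (snd F) {p. snd p < 0} = 0 \<and> (\<forall>t. emeasure (snd F) {p. snd p = t} = 0)"

definition mass_over :: "'a family list \<Rightarrow> ('a \<Rightarrow> real) \<Rightarrow> ennreal" where
  "mass_over Fs x = (\<Sum>F\<leftarrow>Fs. emeasure (snd F) (balls_over (fst F) x))"

definition mass_above :: "'a family list \<Rightarrow> real \<Rightarrow> ennreal" where
  "mass_above Fs t = (\<Sum>F\<leftarrow>Fs. emeasure (snd F) {p. t < snd p})"

lemma sum_list_zero_member:
  "(\<Sum>x\<leftarrow>xs. f x) = (0::ennreal) \<Longrightarrow> y \<in> set xs \<Longrightarrow> f y = 0"
  by (induction xs) auto

text \<open>Pushing up all radii at once by the rearrangement of the total radius law only enlarges balls.\<close>

lemma coverable_of_families: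
  assumes adm: "\<And>F. F \<in> set Fs \<Longrightarrow> admissible F"
    and lam: "0 < lam" and r: "0 \<le> r"
    and above: "\<And>t. 0 \<le> t \<Longrightarrow> t \<le> r \<Longrightarrow> mass_above Fs t \<le> ennreal (lam * (r - t))"
    and X: "X \<subseteq> TP" and over: "\<And>x. x \<in> X \<Longrightarrow> 1 \<le> mass_over Fs x"
  shows "coverable r lam X"
proof -
  let ?B = "borel_of_top (marked_space V E len r)"
  have sb: "sets (snd F) = sets borel" if "F \<in> set Fs" for F using adm[OF that] by (simp add: admissible_def)
  have spc: "space (snd F) = UNIV" if "F \<in> set Fs" for F using sets_eq_imp_space_eq[OF sb[OF that]] by simp
  have snd_m: "(snd :: real \<times> real \<Rightarrow> real) \<in> borel_measurable borel"
    unfolding borel_prod[symmetric] by measurable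
  have [measurable]: "snd \<in> snd F \<rightarrow>\<^sub>M (borel :: real measure)" if "F \<in> set Fs" for F
    using snd_m measurable_cong_sets[OF sb[OF that] refl] by blast
  define \<nu> where "\<nu> = sum_measure borel (map (\<lambda>F. distr (snd F) borel snd) Fs)"
  have \<nu>: "emeasure \<nu> A = (\<Sum>F\<leftarrow>Fs. emeasure (snd F) {p. snd p \<in> A})" if "A \<in> sets borel" for A
  proof -
    have "emeasure \<nu> A = (\<Sum>F\<leftarrow>Fs. emeasure (distr (snd F) borel snd) A)"
      unfolding \<nu>_def using that by (subst emeasure_sum_measure) (auto simp: comp_def)
    also have "\<dots> = (\<Sum>F\<leftarrow>Fs. emeasure (snd F) {p. snd p \<in> A})"
      using that by (intro arg_cong[where f=sum_list] map_cong refl, subst emeasure_distr)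
        (auto simp: spc vimage_def)
    finally show ?thesis .
  qed
  have fin: "finite_measure \<nu>"
    unfolding \<nu>_def
  proof (rule finite_sum_measure)
    fix M assume "M \<in> set (map (\<lambda>F. distr (snd F) borel snd) Fs)"
    then obtain F where F: "F \<in> set Fs" "M = distr (snd F) borel snd" by auto
    then have "finite_measure (snd F)" using adm by (auto simp: admissible_def)
    then show "sets M = sets borel \<and> finite_measure M"
      using F by (auto intro: finite_measure.finite_measure_distr)
  qed
  have z: "(\<Sum>F\<leftarrow>Fs. f F) = (0::ennreal)" if "\<And>F. F \<in> set Fs \<Longrightarrow> f F = 0" for f
    using that by (induction Fs) auto
  have at: "emeasure \<nu> {t} = 0" for t
    using adm by (auto simp: \<nu> admissible_def intro!: z)
  have lo: "emeasure \<nu> {..<0} = 0"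
    using adm by (auto simp: \<nu> admissible_def intro!: z)
  have tl: "emeasure \<nu> {t<..} \<le> ennreal (lam * (r - t))" if "0 \<le> t" "t \<le> r" for t
    using above[OF that] by (simp add: \<nu> mass_above_def)
  define \<phi> where "\<phi> = push_up \<nu> lam r"
  have s\<nu>: "sets \<nu> = sets borel" by (simp add: \<nu>_def)
  note push_law = push_up_law[OF s\<nu> fin at lo lam r, folded \<phi>_def]
  have push1: "mono \<phi>" by (rule push_law(1)) (rule tl)
  have push2: "t \<le> \<phi> t" if "0 \<le> t" "t \<le> r" for t by (rule push_law(2)[OF _ that]) (rule tl)
  have push3: "0 \<le> \<phi> t \<and> \<phi> t \<le> r" for t by (rule push_law(3)) (rule tl)
  have push4: "emeasure \<nu> {t. \<phi> t \<in> A} \<le> ennreal lam * emeasure lborel (A \<inter> {0..r})"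
    if "A \<in> sets borel" for A by (rule push_law(4)[OF _ that]) (rule tl)
  have \<phi>m [measurable]: "\<phi> \<in> borel_measurable borel" using push1 by (rule borel_measurable_mono)
  have \<phi>r: "\<phi> s \<in> {0..r}" for s using push3[of s] by auto
  let ?h = "\<lambda>F :: 'a family. \<lambda>(c, s). (fst F c, \<phi> s)"
  have hm: "?h F \<in> snd F \<rightarrow>\<^sub>M ?B" if "F \<in> set Fs" for F
    using measurable_marked_curve[OF _ \<phi>m \<phi>r, of "fst F"] adm[OF that]
      measurable_cong_sets[OF sb[OF that] refl] unfolding admissible_def by blast
  define \<xi> where "\<xi> = sum_measure ?B (map (\<lambda>F. distr (snd F) ?B (?h F)) Fs)"
  have \<xi>: "emeasure \<xi> A = (\<Sum>F\<leftarrow>Fs. emeasure (snd F) {p. ?h F p \<in> A})" if "A \<in> sets ?B" for A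
  proof -
    have "emeasure \<xi> A = (\<Sum>F\<leftarrow>Fs. emeasure (distr (snd F) ?B (?h F)) A)"
      unfolding \<xi>_def using that by (subst emeasure_sum_measure) (auto simp: comp_def)
    also have "\<dots> = (\<Sum>F\<leftarrow>Fs. emeasure (snd F) {p. ?h F p \<in> A})"
      using that hm by (intro arg_cong[where f=sum_list] map_cong refl, subst emeasure_distr)
        (auto simp: spc vimage_def)
    finally show ?thesis .
  qed
  have s\<xi>: "sets \<xi> = sets ?B" by (simp add: \<xi>_def)
  have "finite_measure \<xi>"
    unfolding \<xi>_def
  proof (rule finite_sum_measure)
    fix M assume "M \<in> set (map (\<lambda>F. distr (snd F) ?B (?h F)) Fs)"
    then obtain F where F: "F \<in> set Fs" "M = distr (snd F) ?B (?h F)" by auto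
    then have "finite_measure (snd F)" using adm by (auto simp: admissible_def)
    then show "sets M = sets ?B \<and> finite_measure M"
      using F hm by (auto intro: finite_measure.finite_measure_distr)
  qed
  moreover have "1 \<le> emeasure \<xi> (marked_ball V E len r x)" if "x \<in> X" for x
  proof -
    have xT: "x \<in> TP" using that X by auto
    note mb = marked_ball_measurable[OF xT, of r]
    have r0: "mass_above Fs r = 0" using above[of r] r by simp
    have "mass_over Fs x \<le> (\<Sum>F\<leftarrow>Fs. emeasure (snd F) {p. ?h F p \<in> marked_ball V E len r x})"
      unfolding mass_over_def
    proof (rule sum_list_mono)
      fix F assume F: "F \<in> set Fs"
      have sc: "short_curve (fst F)" using adm[OF F] by (simp add: admissible_def)
      have "emeasure (snd F) {p. r < snd p} = 0"
        using sum_list_zero_member[OF r0[unfolded mass_above_def] F] .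
      moreover have "{p. r < snd p} \<in> sets (snd F)"
        using F measurable_sets[OF snd_m, of "{r<..}"] by (simp add: sb vimage_def)
      ultimately have "{p. r < snd p} \<in> null_sets (snd F)" by auto
      then have AE: "AE p in snd F. snd p \<le> r"
        by (rule AE_I') auto
      show "emeasure (snd F) (balls_over (fst F) x) \<le> emeasure (snd F) {p. ?h F p \<in> marked_ball V E len r x}"
      proof (rule emeasure_mono_AE)
        show "{p. ?h F p \<in> marked_ball V E len r x} \<in> sets (snd F)"
          using measurable_sets[OF hm[OF F] mb] by (simp add: spc[OF F] vimage_def)
        show "AE p in snd F. p \<in> balls_over (fst F) x \<longrightarrow> p \<in> {p. ?h F p \<in> marked_ball V E len r x}"
          using AE
        proof eventually_elim
          case (elim p)
          obtain c s where p: "p = (c, s)" by fastforce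
          show ?case
          proof
            assume "p \<in> balls_over (fst F) x"
            then have d: "td x (fst F c) \<le> s" by (simp add: balls_over_def p)
            then have "0 \<le> s" using nonneg[of x "fst F c"] by linarith
            then have "s \<le> \<phi> s" using elim p push2[of s] by simp
            then show "p \<in> {p. ?h F p \<in> marked_ball V E len r x}"
              using d \<phi>r[of s] short_curve_in[OF sc, of c] by (simp add: p marked_ball_def)
          qed
        qed
      qed
    qed
    then show ?thesis using over[OF that] \<xi>[OF mb] by simp
  qed
  moreover have "emeasure (radius_measure \<xi>) A \<le> ennreal lam * emeasure lborel (A \<inter> {0..r})"
    if A: "A \<in> sets borel" for A
  proof -
    have sm: "snd \<in> \<xi> \<rightarrow>\<^sub>M borel"
      using snd_measurable_marked_space[of r] measurable_cong_sets[OF s\<xi> refl] by blast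
    have "emeasure (radius_measure \<xi>) A = emeasure \<xi> (snd -` A \<inter> space \<xi>)"
      unfolding radius_measure_def using sm A by (simp add: emeasure_distr)
    also have "\<dots> = (\<Sum>F\<leftarrow>Fs. emeasure (snd F) {p. ?h F p \<in> snd -` A \<inter> space \<xi>})"
      using measurable_sets[OF sm A] s\<xi> by (intro \<xi>) simp
    also have "\<dots> \<le> (\<Sum>F\<leftarrow>Fs. emeasure (snd F) {p. snd p \<in> \<phi> -` A})"
    proof (rule sum_list_mono)
      fix F assume F: "F \<in> set Fs"
      have "\<phi> -` A \<in> sets borel" using measurable_sets[OF \<phi>m A] by simp
      then have "{p. snd p \<in> \<phi> -` A} \<in> sets (snd F)"
        using F measurable_sets[OF snd_m, of "\<phi> -` A"] by (simp add: sb vimage_def)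
      then show "emeasure (snd F) {p. ?h F p \<in> snd -` A \<inter> space \<xi>} \<le> emeasure (snd F) {p. snd p \<in> \<phi> -` A}"
        by (intro emeasure_mono) auto
    qed
    also have "\<dots> = emeasure \<nu> (\<phi> -` A)"
      using measurable_sets[OF \<phi>m A] by (subst \<nu>) auto
    also have "\<dots> \<le> ennreal lam * emeasure lborel (A \<inter> {0..r})"
      using push4[OF A] by (simp add: vimage_def)
    finally show ?thesis .
  qed
  ultimately show ?thesis unfolding coverable_def using s\<xi> by blast
qed

end

section \<open>Rooted tree terms\<close>

text \<open>\<open>Graft A B\<close> joins \<open>B\<close> to \<open>A\<close> by an edge between their roots, and its root is that of \<open>A\<close>. A vertex
  with several children is a nested graft.\<close>

datatype 'a rtree = Vertex 'a | Graft "'a rtree" "'a rtree"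

text \<open>The root vertex.\<close>

primrec anchor :: "'a rtree \<Rightarrow> 'a" where
  "anchor (Vertex v) = v"
| "anchor (Graft A B) = anchor A"

primrec edge_list :: "'a rtree \<Rightarrow> 'a set list" where
  "edge_list (Vertex v) = []"
| "edge_list (Graft A B) = {anchor A, anchor B} # edge_list A @ edge_list B"

primrec vertex_list :: "'a rtree \<Rightarrow> 'a list" where
  "vertex_list (Vertex v) = [v]"
| "vertex_list (Graft A B) = vertex_list A @ vertex_list B"

lemma anchor_in_vertex_list: "anchor t \<in> set (vertex_list t)"
  by (induction t) auto

lemma edges_in_vertices: "e \<in> set (edge_list t) \<Longrightarrow> e \<subseteq> set (vertex_list t)"
  by (induction t) (auto dest: subsetD[OF _ anchor_in_vertex_list] simp: anchor_in_vertex_list)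

lemma distinct_edge_list:
  assumes "distinct (vertex_list t)" shows "distinct (edge_list t)"
  using assms
proof (induction t)
  case (Graft A B)
  have disj: "set (vertex_list A) \<inter> set (vertex_list B) = {}" using Graft.prems by simp
  note in_A = edges_in_vertices[of _ A] and in_B = edges_in_vertices[of _ B]
  note r = anchor_in_vertex_list[of A] anchor_in_vertex_list[of B]
  have "{anchor A, anchor B} \<notin> set (edge_list A)" "{anchor A, anchor B} \<notin> set (edge_list B)"
    using in_A in_B r disj by blast+
  moreover have "e \<noteq> {}" if "e \<in> set (edge_list t)" for e and t :: "'a rtree"
    using that by (induction t) auto
  then have "set (edge_list A) \<inter> set (edge_list B) = {}"
    using in_A in_B disj by blast
  ultimately show ?case using Graft by simp
qed simp

primrec attach_leaf :: "'a \<Rightarrow> 'a \<Rightarrow> 'a rtree \<Rightarrow> 'a rtree" where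
  "attach_leaf x y (Vertex v) = (if v = x then Graft (Vertex v) (Vertex y) else Vertex v)"
| "attach_leaf x y (Graft A B) = (if x \<in> set (vertex_list A) then Graft (attach_leaf x y A) B else Graft A (attach_leaf x y B))"

lemma anchor_attach_leaf [simp]: "anchor (attach_leaf x y t) = anchor t"
  by (induction t) auto

lemma vertices_attach_leaf:
  "x \<in> set (vertex_list t) \<Longrightarrow> mset (vertex_list (attach_leaf x y t)) = add_mset y (mset (vertex_list t))"
  by (induction t) auto

lemma edges_attach_leaf:
  "x \<in> set (vertex_list t) \<Longrightarrow> mset (edge_list (attach_leaf x y t)) = add_mset {x, y} (mset (edge_list t))"
  by (induction t) auto

lemma connected_in_rtree:
  "u \<in> set (vertex_list t) \<Longrightarrow> (anchor t, u) \<in> {(a, b). {a, b} \<in> set (edge_list t)}\<^sup>*"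
proof (induction t arbitrary: u)
  case (Graft A B)
  let ?R = "\<lambda>t. {(a, b). {a, b} \<in> set (edge_list t)}"
  have mono: "(?R A)\<^sup>* \<subseteq> (?R (Graft A B))\<^sup>*" "(?R B)\<^sup>* \<subseteq> (?R (Graft A B))\<^sup>*"
    by (intro rtrancl_mono; force)+
  show ?case
  proof (cases "u \<in> set (vertex_list A)")
    case True then show ?thesis using Graft.IH(1) mono(1) by auto
  next
    case False
    then have "(anchor B, u) \<in> (?R (Graft A B))\<^sup>*" using Graft mono(2) by auto
    moreover have "(anchor A, anchor B) \<in> ?R (Graft A B)" by simp
    ultimately have "(anchor A, u) \<in> (?R (Graft A B))\<^sup>*" by (rule converse_rtrancl_into_rtrancl[rotated])
    then show ?thesis by (simp only: anchor.simps)
  qed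
qed simp

text \<open>Walks are shortened to paths: a step to a vertex that was met before is replaced by cutting the walk there.\<close>

lemma simple_walk:
  assumes "(u, v) \<in> R\<^sup>*"
  shows "\<exists>c. c \<noteq> [] \<and> hd c = u \<and> last c = v \<and> distinct c \<and> (\<forall>i. Suc i < length c \<longrightarrow> (c ! i, c ! Suc i) \<in> R)"
  using assms
proof (induction rule: rtrancl_induct)
  case base show ?case by (rule exI[of _ "[u]"]) simp
next
  case (step y z)
  then obtain c where c: "c \<noteq> []" "hd c = u" "last c = y" "distinct c"
    "\<And>i. Suc i < length c \<Longrightarrow> (c ! i, c ! Suc i) \<in> R" by blast
  show ?case
  proof (cases "z \<in> set c")
    case True
    then obtain k where k: "k < length c" "c ! k = z" by (auto simp: in_set_conv_nth)
    let ?c = "take (Suc k) c"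
    have "last ?c = z" using k by (simp add: take_Suc_conv_app_nth)
    moreover have "hd ?c = u" using c by (simp add: hd_take)
    moreover have "(?c ! i, ?c ! Suc i) \<in> R" if "Suc i < length ?c" for i
      using that c(5)[of i] by simp
    ultimately show ?thesis using c(1,4) by (intro exI[of _ ?c]) simp
  next
    case False
    have "(c @ [z]) ! i = c ! i" if "i < length c" for i using that by (simp add: nth_append)
    moreover have "(c @ [z]) ! length c = z" by simp
    moreover have "c ! i = y" if "Suc i = length c" for i
      using that c by (simp add: last_conv_nth flip: that)
    ultimately have "((c @ [z]) ! i, (c @ [z]) ! Suc i) \<in> R" if "Suc i < length (c @ [z])" for i
      using that c(5)[of i] step(2) by (cases "Suc i = length c") (auto simp: nth_append)
    then show ?thesis using c False by (intro exI[of _ "c @ [z]"]) auto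
  qed
qed

context finite_metric_tree
begin

text \<open>A term with the largest number of vertices contains all vertices, by connectedness. It contains all edges,
  because any other edge would close a cycle with the path between its end points.\<close>

lemma rtree_of_tree:
  obtains t where "distinct (edge_list t)" "set (edge_list t) = E"
proof -
  \<comment> \<open>Terms for subtrees; one with the largest number of vertices is chosen.\<close>
  define P where "P t \<longleftrightarrow> distinct (vertex_list t) \<and> set (vertex_list t) \<subseteq> V \<and> set (edge_list t) \<subseteq> E" for t
  obtain v where "v \<in> V" using V_nonempty by blast
  then have "P (Vertex v)" by (simp add: P_def)
  moreover have "\<forall>t. P t \<longrightarrow> length (vertex_list t) \<le> card V"
    using finite_V by (auto simp: P_def distinct_card[symmetric] intro: card_mono)
  ultimately obtain t where t: "P t" and max: "\<And>t'. P t' \<Longrightarrow> length (vertex_list t') \<le> length (vertex_list t)"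
    using ex_has_greatest_nat[of P "Vertex v" "\<lambda>t. length (vertex_list t)" "Suc (card V)"]
    by (auto simp: less_Suc_eq_le)
  have closed: "y \<in> set (vertex_list t)" if "x \<in> set (vertex_list t)" "{x, y} \<in> E" for x y
  proof (rule ccontr)
    assume y: "y \<notin> set (vertex_list t)"
    have m: "mset (vertex_list (attach_leaf x y t)) = add_mset y (mset (vertex_list t))"
      "mset (edge_list (attach_leaf x y t)) = add_mset {x, y} (mset (edge_list t))"
      by (rule vertices_attach_leaf edges_attach_leaf; fact)+
    then have s: "set (vertex_list (attach_leaf x y t)) = insert y (set (vertex_list t))"
      "set (edge_list (attach_leaf x y t)) = insert {x, y} (set (edge_list t))"
      by (metis set_mset_add_mset_insert set_mset_mset)+
    have l: "length (vertex_list (attach_leaf x y t)) = Suc (length (vertex_list t))"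
      using arg_cong[OF m(1), of size] by simp
    have "distinct (vertex_list (attach_leaf x y t))"
      using s(1) l t y by (intro card_distinct) (simp add: P_def distinct_card)
    moreover have "y \<in> V" using edges[OF that(2)] by blast
    ultimately have "P (attach_leaf x y t)" using s t that by (auto simp: P_def)
    then show False using max l by fastforce
  qed
  have V: "v \<in> set (vertex_list t)" if "v \<in> V" for v
  proof -
    have "anchor t \<in> V" using t anchor_in_vertex_list[of t] by (auto simp: P_def)
    from connected[OF this that] show ?thesis
      by (induction rule: rtrancl_induct) (use anchor_in_vertex_list closed in auto)
  qed
  have "E \<subseteq> set (edge_list t)"
  proof
    fix e assume e: "e \<in> E"
    then obtain x y where xy: "e = {x, y}" "x \<noteq> y" using edges by (meson card_2_iff)
    then have xyV: "x \<in> V" "y \<in> V" using edges[OF e] by auto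
    show "e \<in> set (edge_list t)"
    proof (rule ccontr)
      assume n: "e \<notin> set (edge_list t)"
      let ?R = "{(a, b). {a, b} \<in> set (edge_list t)}"
      have "sym ?R" by (auto simp: sym_def insert_commute)
      then have "(x, anchor t) \<in> ?R\<^sup>*"
        using connected_in_rtree[OF V[OF xyV(1)]] by (meson sym_rtrancl symD)
      then have "(x, y) \<in> ?R\<^sup>*" using connected_in_rtree[OF V[OF xyV(2)]] by simp
      then obtain c where c: "c \<noteq> []" "hd c = x" "last c = y" "distinct c"
        "\<And>i. Suc i < length c \<Longrightarrow> (c ! i, c ! Suc i) \<in> ?R" using simple_walk by metis
      have c0: "c ! 0 = x" using c by (simp add: hd_conv_nth)
      have cl: "c ! (length c - 1) = y" using c by (simp add: last_conv_nth)
      have "length c \<noteq> 1" using c0 cl xy by auto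
      moreover have "length c \<noteq> 2" using c0 cl c(5)[of 0] n xy by auto
      ultimately have l: "3 \<le> length c" using c(1) by (cases "length c" rule: nat.exhaust) auto
      have "is_cycle E c"
        unfolding is_cycle_def
      proof (intro conjI allI impI)
        fix i assume i: "i < length c"
        show "{c ! i, c ! (Suc i mod length c)} \<in> E"
        proof (cases "Suc i = length c")
          case True
          then have "c ! i = y" using cl by (metis diff_Suc_1)
          then show ?thesis using True c0 e xy by (simp add: insert_commute)
        next
          case False
          then show ?thesis using i c(5)[of i] t by (auto simp: P_def)
        qed
      qed (use l c in auto)
      then show False using acyclic by blast
    qed
  qed
  then show thesis using that[of t] t distinct_edge_list by (auto simp: P_def)
qed

primrec height :: "'a rtree \<Rightarrow> real" where
  "height (Vertex v) = 0"
| "height (Graft A B) = max (height A) (len {anchor A, anchor B} + height B)"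

definition total_len :: "'a rtree \<Rightarrow> real" where "total_len t = (\<Sum>e\<leftarrow>edge_list t. len e)"

lemma total_len_simps [simp]:
  "total_len (Vertex v) = 0"
  "total_len (Graft A B) = len {anchor A, anchor B} + total_len A + total_len B"
  by (simp_all add: total_len_def)

abbreviation in_tree :: "'a rtree \<Rightarrow> bool" where "in_tree t \<equiv> set (edge_list t) \<subseteq> E"

lemma height_nonneg: "0 \<le> height t"
  by (induction t) auto

lemma height_le_total: "in_tree t \<Longrightarrow> height t \<le> total_len t"
proof (induction t)
  case (Graft A B)
  then have "0 < len {anchor A, anchor B}" using len_pos by auto
  then show ?case using Graft height_nonneg[of A] height_nonneg[of B] by auto
qed simp

lemma height_pos_nonempty: "0 < height t \<Longrightarrow> edge_list t \<noteq> []"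
  by (cases t) auto

lemma total_len_mset: "mset (edge_list s) = mset (edge_list t) \<Longrightarrow> total_len s = total_len t"
  unfolding total_len_def by (metis mset_map sum_mset_sum_list)

text \<open>Grafts at the same vertex commute up to the order of the edge list, so the child that determines the height can be
  made the outermost one.\<close>

lemma highest_child:
  assumes "in_tree (Graft A B)"
  obtains K C where "anchor K = anchor A"
    "mset (edge_list (Graft A B)) = mset (edge_list (Graft K C))"
    "height (Graft A B) = len {anchor K, anchor C} + height C" "height K \<le> height (Graft A B)"
    "size C < size (Graft A B)"
proof -
  have "\<exists>K C. anchor K = anchor A \<and> mset (edge_list (Graft A B)) = mset (edge_list (Graft K C)) \<and>
     height (Graft A B) = len {anchor K, anchor C} + height C \<and> height K \<le> height (Graft A B) \<and>
     size C < size (Graft A B)"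
    using assms
  proof (induction A arbitrary: B)
    case (Vertex v)
    then have "0 < len {v, anchor B}" using len_pos by auto
    then show ?case
      using height_nonneg[of B] by (intro exI[of _ "Vertex v"] exI[of _ B]) auto
  next
    case (Graft A1 A2)
    show ?case
    proof (cases "height (Graft A1 A2) \<le> len {anchor A1, anchor B} + height B")
      case True
      then show ?thesis by (intro exI[of _ "Graft A1 A2"] exI[of _ B]) auto
    next
      case False
      have "in_tree (Graft A1 A2)" using Graft.prems by auto
      from Graft.IH(1)[OF this] obtain K C where KC: "anchor K = anchor A1"
        "mset (edge_list (Graft A1 A2)) = mset (edge_list (Graft K C))"
        "height (Graft A1 A2) = len {anchor K, anchor C} + height C" "height K \<le> height (Graft A1 A2)"
        "size C < size (Graft A1 A2)" by blast
      have "height (Graft (Graft A1 A2) B) = height (Graft A1 A2)" using False by auto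
      then show ?thesis using KC False by (intro exI[of _ "Graft K B"] exI[of _ C]) auto
    qed
  qed
  then show thesis using that by blast
qed

text \<open>The midpoint of a longest path lies on some edge. It is found by moving along the highest child until
  neither side is higher than the other side together with the edge.\<close>

lemma balanced_split:
  assumes "in_tree (Graft A B)"
  obtains A' B' where "mset (edge_list (Graft A' B')) = mset (edge_list (Graft A B))"
    "height A' \<le> height B' + len {anchor A', anchor B'}" "height B' \<le> height A' + len {anchor A', anchor B'}"
proof -
  have *: "\<exists>A' B'. mset (edge_list (Graft A' B')) = mset (edge_list (Graft A B)) \<and>
      height A' \<le> height B' + len {anchor A', anchor B'} \<and> height B' \<le> height A' + len {anchor A', anchor B'}"
    if "in_tree (Graft A B)" "height A \<le> height B + len {anchor A, anchor B}" for A B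
    using that
  proof (induction "size B" arbitrary: A B rule: less_induct)
    case less
    show ?case
    proof (cases "height B \<le> height A + len {anchor A, anchor B}")
      case True then show ?thesis using less.prems by blast
    next
      case False
      have l: "0 < len {anchor A, anchor B}" using less.prems len_pos by auto
      obtain B1 B2 where B: "B = Graft B1 B2"
        using False height_nonneg[of A] l by (cases B) auto
      have "in_tree (Graft B1 B2)" using less.prems B by auto
      then obtain K C where KC: "anchor K = anchor B1"
        "mset (edge_list (Graft B1 B2)) = mset (edge_list (Graft K C))"
        "height (Graft B1 B2) = len {anchor K, anchor C} + height C" "height K \<le> height (Graft B1 B2)"
        "size C < size (Graft B1 B2)" by (rule highest_child)
      let ?A = "Graft K A"
      have m: "mset (edge_list (Graft ?A C)) = mset (edge_list (Graft A B))"
        using KC(1,2) B by (auto simp: insert_commute)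
      then have "in_tree (Graft ?A C)" using less.prems by (metis set_mset_mset)
      moreover have "height ?A \<le> height C + len {anchor ?A, anchor C}"
        using KC False B by (auto simp: insert_commute)
      moreover have "size C < size B" using KC B by simp
      ultimately obtain A' B' where "mset (edge_list (Graft A' B')) = mset (edge_list (Graft ?A C))"
        "height A' \<le> height B' + len {anchor A', anchor B'}" "height B' \<le> height A' + len {anchor A', anchor B'}"
        using less.hyps by blast
      then show ?thesis using m by metis
    qed
  qed
  show thesis
  proof (cases "height A \<le> height B + len {anchor A, anchor B}")
    case True then show thesis using *[OF assms] that by blast
  next
    case False
    have "mset (edge_list (Graft B A)) = mset (edge_list (Graft A B))" by (simp add: insert_commute)
    moreover have "in_tree (Graft B A)" using assms by (auto simp: insert_commute)
    moreover have "height B \<le> height A + len {anchor B, anchor A}"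
      using False len_pos[of "{anchor A, anchor B}"] assms by (auto simp: insert_commute)
    ultimately show thesis using *[of B A] that by metis
  qed
qed

end

section \<open>Balls whose radius is the height below their centre\<close>

lemma ennreal_le_add:
  assumes "ennreal a \<le> X" "ennreal b \<le> Y" "c \<le> a + b" "0 \<le> a" "0 \<le> b"
  shows "ennreal c \<le> X + Y"
proof -
  have "ennreal c \<le> ennreal (a + b)" using assms by (intro ennreal_leI)
  also have "\<dots> = ennreal a + ennreal b" using assms by (simp add: ennreal_plus)
  finally show ?thesis using add_mono[OF assms(1,2)] by order
qed

context finite_metric_tree
begin

text \<open>The point of the edge \<open>{v, w}\<close> at distance \<open>c\<close> from \<open>v\<close>, clamped to the edge.\<close>

definition edge_curve :: "'a \<Rightarrow> 'a \<Rightarrow> real \<Rightarrow> 'a \<Rightarrow> real" where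
  "edge_curve v w c = (let t = max 0 (min 1 (c / len {v, w})) in
     (\<lambda>x. if x = v then 1 - t else if x = w then t else 0))"

lemma edge_endpoints_distinct: "{v, w} \<in> E \<Longrightarrow> v \<noteq> w"
  using edges[of "{v, w}"] by auto

lemma edge_curve_simplex: "{v, w} \<in> E \<Longrightarrow> edge_curve v w c \<in> simplex_points {v, w}"
  using edge_endpoints_distinct[of v w]
  by (auto simp: edge_curve_def simplex_points_def Let_def)

lemma simplex_in_tree: "e \<in> E \<Longrightarrow> simplex_points e \<subseteq> TP"
  by (auto simp: tree_points_def)

lemma vertex_in_tree: "v \<in> V \<Longrightarrow> vertex_pt v \<in> TP"
  using vertex_pt_simplex[of "{v}" v] unfolding tree_points_def by blast

lemma edge_curve_start: "edge_curve v w 0 = vertex_pt v"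
  by (auto simp: edge_curve_def fun_eq_iff)

lemma edge_curve_end: "{v, w} \<in> E \<Longrightarrow> edge_curve v w (len {v, w}) = vertex_pt w"
  using edge_endpoints_distinct[of v w] len_pos[of "{v, w}"] by (auto simp: edge_curve_def fun_eq_iff)

lemma edge_point_on_curve:
  assumes "{v, w} \<in> E" "p \<in> simplex_points {v, w}"
  obtains c where "0 \<le> c" "c \<le> len {v, w}" "p = edge_curve v w c"
proof
  have vw: "v \<noteq> w" using assms(1) edge_endpoints_distinct by auto
  have l: "0 < len {v, w}" using assms(1) len_pos by auto
  have p: "0 \<le> p v" "0 \<le> p w" "p v + p w = 1" "\<And>x. x \<noteq> v \<Longrightarrow> x \<noteq> w \<Longrightarrow> p x = 0"
    using assms(2) vw by (auto simp: simplex_points_def)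
  show "0 \<le> p w * len {v, w}" using p l by simp
  show "p w * len {v, w} \<le> len {v, w}" using p l by (simp add: mult_le_cancel_right1)
  have "max 0 (min 1 (p w)) = p w" using p by auto
  then show "p = edge_curve v w (p w * len {v, w})"
    using p l vw by (auto simp: edge_curve_def fun_eq_iff Let_def)
qed

lemma tree_dist_in_edge:
  assumes "e \<in> E" "p \<in> simplex_points e" "q \<in> simplex_points e"
  shows "td p q \<le> segment_length len e p q"
proof -
  have "p \<in> TP" "q \<in> TP" using simplex_in_tree assms by auto
  then show ?thesis
    using cInf_lower[OF path_lengths_edge[OF assms] bdd_below_path_lengths] by (simp add: tree_dist_eq)
qed

lemma short_edge_curve:
  assumes "{v, w} \<in> E" shows "short_curve (edge_curve v w)"
  unfolding short_curve_def
proof (intro conjI allI)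
  have vw: "v \<noteq> w" using assms edge_endpoints_distinct by auto
  have l: "0 < len {v, w}" using assms len_pos by auto
  show "edge_curve v w c \<in> TP" for c using edge_curve_simplex simplex_in_tree assms by blast
  fix c c'
  define t where "t = (\<lambda>c. max 0 (min 1 (c / len {v, w})))"
  have "td (edge_curve v w c) (edge_curve v w c') \<le> segment_length len {v, w} (edge_curve v w c) (edge_curve v w c')"
    by (intro tree_dist_in_edge edge_curve_simplex assms)
  also have "\<dots> = len {v, w} * \<bar>t c - t c'\<bar>"
  proof -
    have "edge_curve v w c v = 1 - t c" "edge_curve v w c w = t c" for c
      using vw by (simp_all add: edge_curve_def t_def Let_def)
    moreover have "\<bar>1 - t c - (1 - t c')\<bar> = \<bar>t c - t c'\<bar>" by simp
    ultimately show ?thesis using vw by (simp add: segment_length_def)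
  qed
  also have "\<bar>t c - t c'\<bar> \<le> \<bar>c / len {v, w} - c' / len {v, w}\<bar>" by (auto simp: t_def)
  also have "len {v, w} * \<bar>c / len {v, w} - c' / len {v, w}\<bar> = \<bar>c - c'\<bar>"
    using l by (simp add: diff_divide_distrib[symmetric] abs_div_pos[symmetric])
  finally show "td (edge_curve v w c) (edge_curve v w c') \<le> \<bar>c - c'\<bar>" using l by simp
qed

definition points :: "'a rtree \<Rightarrow> ('a \<Rightarrow> real) set" where
  "points t = (\<Union>e\<in>set (edge_list t). simplex_points e)"

lemma points_simps [simp]:
  "points (Vertex v) = {}"
  "points (Graft A B) = simplex_points {anchor A, anchor B} \<union> points A \<union> points B"
  by (auto simp: points_def)

lemma points_in_tree: "in_tree t \<Longrightarrow> points t \<subseteq> TP"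
  using simplex_in_tree by (auto simp: points_def)

text \<open>One entry for each edge: the height \<open>H\<close> below its lower end, the lower end and the upper end. The point at
  distance \<open>\<sigma>\<close> above the lower end has height \<open>H + \<sigma>\<close> below it.\<close>

primrec arms :: "'a rtree \<Rightarrow> (real \<times> 'a \<times> 'a) list" where
  "arms (Vertex v) = []"
| "arms (Graft A B) = arms A @ (height B, anchor B, anchor A) # arms B"

definition arm_over :: "('a \<Rightarrow> real) \<Rightarrow> real \<times> 'a \<times> 'a \<Rightarrow> ennreal" where
  "arm_over x = (\<lambda>(H, v, w). emeasure lborel {\<sigma> \<in> {0..len {v, w}}. td x (edge_curve v w \<sigma>) \<le> H + \<sigma>})"

text \<open>The length of the set of points on an edge with more than height \<open>t\<close> below them.\<close>

definition arm_above :: "real \<Rightarrow> real \<times> 'a \<times> 'a \<Rightarrow> real" where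
  "arm_above t = (\<lambda>(H, v, w). max 0 (min (len {v, w}) (H + len {v, w} - t)))"

lemma measurable_arm:
  assumes "{v, w} \<in> E" "x \<in> TP"
  shows "{\<sigma> \<in> {0..len {v, w}}. td x (edge_curve v w \<sigma>) \<le> H + \<sigma>} \<in> sets lborel"
proof -
  have [measurable]: "(\<lambda>c. td x (edge_curve v w c)) \<in> borel_measurable borel"
    using continuous_dist_short_curve[OF short_edge_curve] assms by (auto intro: borel_measurable_continuous_onI)
  have "{\<sigma> \<in> space borel. \<sigma> \<in> {0..len {v, w}} \<and> td x (edge_curve v w \<sigma>) \<le> H + \<sigma>} \<in> sets borel"
    by measurable
  then show ?thesis by simp
qed

lemma arm_over_ge:
  assumes "{v, w} \<in> E" "x \<in> TP" "0 \<le> c" "c \<le> len {v, w}"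
    and "\<And>\<sigma>. c \<le> \<sigma> \<Longrightarrow> \<sigma> \<le> len {v, w} \<Longrightarrow> td x (edge_curve v w \<sigma>) \<le> H + \<sigma>"
  shows "ennreal (len {v, w} - c) \<le> arm_over x (H, v, w)"
proof -
  have "emeasure lborel {c..len {v, w}} \<le> arm_over x (H, v, w)"
    unfolding arm_over_def prod.case using assms by (intro emeasure_mono measurable_arm) auto
  then show ?thesis using assms by simp
qed

text \<open>The second conjunct is the aim: a point at depth \<open>a\<close> below the root \<open>p\<close> is covered with mass at least
  \<open>(a + h) / 2\<close>. The first conjunct, about points at distance \<open>b\<close> from \<open>p\<close> anywhere in the tree, is the
  same bound with depth \<open>- b\<close>. The induction needs it, as points of one branch are also covered by
  balls of the others.\<close>

definition covers_rooted :: "(real \<times> 'a \<times> 'a) list \<Rightarrow> ('a \<Rightarrow> real) \<Rightarrow> real \<Rightarrow> ('a \<Rightarrow> real) set \<Rightarrow> bool" where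
  "covers_rooted Z p h X \<longleftrightarrow>
     (\<forall>x\<in>TP. \<forall>b. td x p \<le> b \<longrightarrow> b \<le> h \<longrightarrow> ennreal ((h - b) / 2) \<le> (\<Sum>z\<leftarrow>Z. arm_over x z)) \<and>
     (\<forall>x\<in>X. \<exists>a. a \<le> h \<and> td x p \<le> a \<and> ennreal ((a + h) / 2) \<le> (\<Sum>z\<leftarrow>Z. arm_over x z))"

text \<open>Only a point in the lower of the two parts needs both parts: its own part gives \<open>(a + h) / 2\<close> and the higher
  part, seen from outside at distance \<open>a\<close>, gives \<open>(k - a) / 2\<close>.\<close>

lemma covers_rooted_join:
  assumes Z: "covers_rooted Z p h X" and Y: "covers_rooted Y p k U"
    and "X \<subseteq> TP" "U \<subseteq> TP"
  shows "covers_rooted (Z @ Y) p (max h k) (X \<union> U)"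
proof -
  let ?s = "\<lambda>Z x. \<Sum>z\<leftarrow>Z. arm_over x z"
  have out: "ennreal ((h - b) / 2) \<le> ?s Z x" if "x \<in> TP" "td x p \<le> b" "b \<le> h" for x b
    using Z that by (auto simp: covers_rooted_def)
  have out': "ennreal ((k - b) / 2) \<le> ?s Y x" if "x \<in> TP" "td x p \<le> b" "b \<le> k" for x b
    using Y that by (auto simp: covers_rooted_def)
  have 1: "ennreal ((max h k - b) / 2) \<le> ?s (Z @ Y) x" if "x \<in> TP" "td x p \<le> b" "b \<le> max h k" for x b
    using out[OF that(1,2)] out'[OF that(1,2)] that(3)
    by (cases "k \<le> h") (auto simp: max_def intro: add_increasing add_increasing2)
  have 2: "\<exists>a. a \<le> max h k \<and> td x p \<le> a \<and> ennreal ((a + max h k) / 2) \<le> ?s (Z @ Y) x" if xX: "x \<in> X" for x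
  proof -
    obtain a where a: "a \<le> h" "td x p \<le> a" "ennreal ((a + h) / 2) \<le> ?s Z x"
      using bspec[OF conjunct2[OF Z[unfolded covers_rooted_def]] xX] by blast
    have a0: "0 \<le> a" using a(2) nonneg[of x p] by linarith
    have "ennreal ((a + max h k) / 2) \<le> ?s (Z @ Y) x"
    proof (cases "k \<le> h")
      case True then show ?thesis using a by (auto simp: max_def intro: add_increasing2)
    next
      case False
      have e: "ennreal ((k - a) / 2) \<le> ?s Y x" using a out'[of x a] that assms(3) False by auto
      have "ennreal ((a + k) / 2) \<le> ?s Z x + ?s Y x"
        by (rule ennreal_le_add[OF a(3) e]) (use a(1) a0 False in \<open>simp_all add: field_simps\<close>)
      then show ?thesis using False by (simp add: max_def)
    qed
    then show ?thesis using a by (intro exI[of _ a]) auto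
  qed
  have 3: "\<exists>a. a \<le> max h k \<and> td x p \<le> a \<and> ennreal ((a + max h k) / 2) \<le> ?s (Z @ Y) x" if xU: "x \<in> U" for x
  proof -
    obtain a where a: "a \<le> k" "td x p \<le> a" "ennreal ((a + k) / 2) \<le> ?s Y x"
      using bspec[OF conjunct2[OF Y[unfolded covers_rooted_def]] xU] by blast
    have a0: "0 \<le> a" using a(2) nonneg[of x p] by linarith
    have "ennreal ((a + max h k) / 2) \<le> ?s (Z @ Y) x"
    proof (cases "h \<le> k")
      case True then show ?thesis using a by (auto simp: max_def intro: add_increasing)
    next
      case False
      have e: "ennreal ((h - a) / 2) \<le> ?s Z x" using a out[of x a] that assms(4) False by auto
      have "ennreal ((a + h) / 2) \<le> ?s Z x + ?s Y x"
        by (rule ennreal_le_add[OF e a(3)]) (use a(1) a0 False in \<open>simp_all add: field_simps\<close>)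
      then show ?thesis using False by (simp add: max_def)
    qed
    then show ?thesis using a by (intro exI[of _ a]) auto
  qed
  show ?thesis unfolding covers_rooted_def using 1 2 3 by blast
qed

text \<open>The ball about a point of the new edge contains everything below that point, so a point below the edge
  gains the whole length of the edge. Let a point on the edge or beyond it be at distance \<open>b\<close> from the lower end.
  If \<open>b \<le> H\<close>, it lies in all balls about points of the edge, and the outside bound adds \<open>(H - b) / 2\<close>.
  If \<open>b > H\<close>, those balls about points of the edge that reach it suffice.\<close>

lemma covers_rooted_plant:
  assumes Z: "covers_rooted Z (vertex_pt v) H X" and e: "{v, w} \<in> E" and H: "0 \<le> H" and X: "X \<subseteq> TP"
  shows "covers_rooted ((H, v, w) # Z) (vertex_pt w) (len {v, w} + H) (simplex_points {v, w} \<union> X)"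
proof -
  let ?s = "\<lambda>x. \<Sum>z\<leftarrow>Z. arm_over x z"
  let ?l = "len {v, w}" and ?g = "edge_curve v w"
  have l: "0 < ?l" using len_pos e by auto
  have V: "v \<in> V" "w \<in> V" using edges[OF e] by auto
  note vT = vertex_in_tree[OF V(1)] and wT = vertex_in_tree[OF V(2)]
  have gT: "?g \<sigma> \<in> TP" for \<sigma> using short_edge_curve[OF e] by (simp add: short_curve_def)
  have gd: "td (?g \<sigma>) (?g \<tau>) \<le> \<bar>\<sigma> - \<tau>\<bar>" for \<sigma> \<tau> using short_edge_curve[OF e] by (simp add: short_curve_def)
  have gv: "td (vertex_pt v) (?g \<sigma>) \<le> \<sigma>" if "0 \<le> \<sigma>" for \<sigma>
    using gd[of 0 \<sigma>] that by (simp add: edge_curve_start)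
  have gw: "td (vertex_pt w) (?g \<sigma>) \<le> ?l - \<sigma>" if "\<sigma> \<le> ?l" for \<sigma>
    using gd[of "?l" \<sigma>] that by (simp add: edge_curve_end[OF e])
  have vw: "td (vertex_pt w) (vertex_pt v) \<le> ?l"
    using gw[of 0] l by (simp add: edge_curve_start)
  have out: "ennreal ((H - b) / 2) \<le> ?s x" if "x \<in> TP" "td x (vertex_pt v) \<le> b" "b \<le> H" for x b
    using Z that by (auto simp: covers_rooted_def)
  have out': "ennreal ((?l + H - b) / 2) \<le> arm_over x (H, v, w) + ?s x"
    if x: "x \<in> TP" "td x (vertex_pt w) \<le> b" "b \<le> ?l + H" for x b
  proof -
    have b0: "0 \<le> b" using x(2) nonneg[of x "vertex_pt w"] by linarith
    have d: "td x (?g \<sigma>) \<le> b + (?l - \<sigma>)" if "\<sigma> \<le> ?l" for \<sigma>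
      using triangle[OF x(1) wT gT[of \<sigma>]] x(2) gw[OF that] by linarith
    have dv: "td x (vertex_pt v) \<le> b + ?l" using triangle[OF x(1) wT vT] x(2) vw by linarith
    show ?thesis
    proof (cases "b + ?l \<le> H")
      case True
      have "ennreal (?l - 0) \<le> arm_over x (H, v, w)"
      proof (rule arm_over_ge[OF e x(1)])
        fix \<sigma> assume "0 \<le> \<sigma>" "\<sigma> \<le> ?l"
        then show "td x (?g \<sigma>) \<le> H + \<sigma>" using d[of \<sigma>] True by linarith
      qed (use l in auto)
      moreover have "ennreal ((H - (b + ?l)) / 2) \<le> ?s x" using out[OF x(1) dv True] .
      ultimately show ?thesis using True l by (elim ennreal_le_add) (auto simp: field_simps)
    next
      case False
      have "ennreal (?l - (b + ?l - H) / 2) \<le> arm_over x (H, v, w)"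
      proof (rule arm_over_ge[OF e x(1)])
        fix \<sigma> assume "(b + ?l - H) / 2 \<le> \<sigma>" "\<sigma> \<le> ?l"
        then show "td x (?g \<sigma>) \<le> H + \<sigma>" using d[of \<sigma>] by (simp add: field_simps)
      qed (use False x in \<open>auto simp: field_simps\<close>)
      moreover have eq: "(?l + H - b) / 2 = ?l - (b + ?l - H) / 2" by (simp add: field_simps)
      ultimately show ?thesis unfolding eq by (intro add_increasing2) simp_all
    qed
  qed
  have on_edge: "\<exists>a. a \<le> ?l + H \<and> td x (vertex_pt w) \<le> a \<and>
      ennreal ((a + (?l + H)) / 2) \<le> arm_over x (H, v, w) + ?s x" if xe: "x \<in> simplex_points {v, w}" for x
  proof -
    obtain \<tau> where \<tau>: "0 \<le> \<tau>" "\<tau> \<le> ?l" "x = ?g \<tau>" by (rule edge_point_on_curve[OF e xe])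
    have xT: "x \<in> TP" using xe simplex_in_tree e by auto
    have d: "td x (?g \<sigma>) \<le> \<bar>\<tau> - \<sigma>\<bar>" for \<sigma> using gd \<tau> by simp
    have "ennreal ((?l - \<tau> + (?l + H)) / 2) \<le> arm_over x (H, v, w) + ?s x"
    proof (cases "\<tau> \<le> H")
      case True
      have "ennreal (?l - 0) \<le> arm_over x (H, v, w)"
      proof (rule arm_over_ge[OF e xT])
        fix \<sigma> assume "0 \<le> \<sigma>" "\<sigma> \<le> ?l"
        then show "td x (?g \<sigma>) \<le> H + \<sigma>" using d[of \<sigma>] True \<tau> H by linarith
      qed (use l in auto)
      moreover have "ennreal ((H - \<tau>) / 2) \<le> ?s x"
        using out[OF xT _ True] d[of 0] \<tau> by (simp add: edge_curve_start)
      ultimately show ?thesis using True l by (elim ennreal_le_add) (auto simp: field_simps)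
    next
      case False
      have "ennreal (?l - (\<tau> - H) / 2) \<le> arm_over x (H, v, w)"
      proof (rule arm_over_ge[OF e xT])
        fix \<sigma> assume \<sigma>: "(\<tau> - H) / 2 \<le> \<sigma>" "\<sigma> \<le> ?l"
        have "\<bar>\<tau> - \<sigma>\<bar> \<le> H + \<sigma>" using \<sigma>(1) H \<tau>(1) False by (auto simp: abs_le_iff field_simps)
        then show "td x (?g \<sigma>) \<le> H + \<sigma>" using d[of \<sigma>] by linarith
      qed (use False \<tau> H in \<open>auto simp: field_simps\<close>)
      moreover have eq: "(?l - \<tau> + (?l + H)) / 2 = ?l - (\<tau> - H) / 2" by (simp add: field_simps)
      ultimately show ?thesis unfolding eq by (intro add_increasing2) simp_all
    qed
    moreover have "td x (vertex_pt w) \<le> ?l - \<tau>"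
      using d[of "?l"] \<tau> by (simp add: edge_curve_end[OF e])
    ultimately show ?thesis using \<tau> H by (intro exI[of _ "?l - \<tau>"]) auto
  qed
  have above: "\<exists>a. a \<le> ?l + H \<and> td x (vertex_pt w) \<le> a \<and>
      ennreal ((a + (?l + H)) / 2) \<le> arm_over x (H, v, w) + ?s x" if xX: "x \<in> X" for x
  proof -
    obtain a where a: "a \<le> H" "td x (vertex_pt v) \<le> a" "ennreal ((a + H) / 2) \<le> ?s x"
      using bspec[OF conjunct2[OF Z[unfolded covers_rooted_def]] xX] by blast
    have xT: "x \<in> TP" using xX X by auto
    have a0: "0 \<le> a" using a(2) nonneg[of x "vertex_pt v"] by linarith
    have e1: "ennreal (?l - 0) \<le> arm_over x (H, v, w)"
    proof (rule arm_over_ge[OF e xT])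
      fix \<sigma> assume "0 \<le> \<sigma>" "\<sigma> \<le> ?l"
      then show "td x (?g \<sigma>) \<le> H + \<sigma>"
        using triangle[OF xT vT gT[of \<sigma>]] a gv[of \<sigma>] by linarith
    qed (use l in auto)
    have "ennreal ((a + ?l + (?l + H)) / 2) \<le> arm_over x (H, v, w) + ?s x"
      by (rule ennreal_le_add[OF e1 a(3)]) (use a0 H l in \<open>simp_all add: field_simps\<close>)
    moreover have "td x (vertex_pt w) \<le> a + ?l"
      using triangle[OF xT vT wT] a vw commute[of "vertex_pt v" "vertex_pt w"] by linarith
    ultimately show ?thesis using a a0 l H
      by (intro exI[of _ "a + ?l"]) auto
  qed
  show ?thesis unfolding covers_rooted_def using out' on_edge above by auto
qed

lemma arms_cover: "in_tree t \<Longrightarrow> covers_rooted (arms t) (vertex_pt (anchor t)) (height t) (points t)"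
proof (induction t)
  case (Vertex v)
  have "0 \<le> b" if "td x p \<le> b" for x p b using that nonneg[of x p] by linarith
  then show ?case by (auto simp: covers_rooted_def ennreal_neg)
next
  case (Graft A B)
  then have i: "in_tree A" "in_tree B" "{anchor B, anchor A} \<in> E" by (auto simp: insert_commute)
  have "covers_rooted ((height B, anchor B, anchor A) # arms B) (vertex_pt (anchor A))
     (len {anchor B, anchor A} + height B) (simplex_points {anchor B, anchor A} \<union> points B)"
    using Graft i points_in_tree height_nonneg by (intro covers_rooted_plant) auto
  then have "covers_rooted (arms A @ (height B, anchor B, anchor A) # arms B) (vertex_pt (anchor A))
      (max (height A) (len {anchor B, anchor A} + height B))
      (points A \<union> (simplex_points {anchor B, anchor A} \<union> points B))"
    using Graft.IH(1) i points_in_tree simplex_in_tree by (intro covers_rooted_join) auto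
  moreover have "points A \<union> (simplex_points {anchor B, anchor A} \<union> points B) = points (Graft A B)"
    by (auto simp: insert_commute)
  ultimately show ?case by (simp add: insert_commute)
qed

text \<open>Heights below the points of a longest descending path are uniform on \<open>[0, height t]\<close>; this path is responsible for
  the last term. All other parts of the tree have no more than their fair share \<open>(\<rho> - s) / \<rho>\<close> of points with
  height above \<open>s\<close> below them, since each is a union of descending paths of length at most \<open>\<rho>\<close> with uniform
  heights starting in \<open>0\<close>.\<close>

lemma arms_tail:
  assumes "in_tree t" "height t \<le> \<rho>" "0 \<le> s" "s \<le> \<rho>"
  shows "\<rho> * (\<Sum>z\<leftarrow>arms t. arm_above s z) \<le> (total_len t - height t) * (\<rho> - s) + \<rho> * max 0 (height t - s)"
  using assms(1,2)
proof (induction t)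
  case (Vertex v) then show ?case using assms by simp
next
  case (Graft A B)
  define l where "l = len {anchor A, anchor B}"
  have l: "0 < l" using Graft.prems len_pos by (auto simp: l_def)
  define P where "P = arm_above s (height B, anchor B, anchor A) + (\<Sum>z\<leftarrow>arms B. arm_above s z)"
  have hB: "0 \<le> height B" "height B \<le> total_len B" using height_nonneg height_le_total Graft.prems by auto
  have hA: "0 \<le> height A" "height A \<le> total_len A" using height_nonneg height_le_total Graft.prems by auto
  have \<rho>: "0 \<le> \<rho>" using assms by simp
  have bd: "height A \<le> \<rho>" "l + height B \<le> \<rho>" using Graft.prems by (auto simp: l_def)
  have IA: "\<rho> * (\<Sum>z\<leftarrow>arms A. arm_above s z) \<le> (total_len A - height A) * (\<rho> - s) + \<rho> * max 0 (height A - s)"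
    using Graft bd by auto
  have IB: "\<rho> * (\<Sum>z\<leftarrow>arms B. arm_above s z) \<le> (total_len B - height B) * (\<rho> - s) + \<rho> * max 0 (height B - s)"
    using Graft bd l by auto
  have "arm_above s (height B, anchor B, anchor A) = max 0 (min l (height B + l - s))"
    by (simp add: arm_above_def l_def insert_commute)
  then have "arm_above s (height B, anchor B, anchor A) + max 0 (height B - s) = max 0 (l + height B - s)"
    using l by auto
  then have "\<rho> * arm_above s (height B, anchor B, anchor A) + \<rho> * max 0 (height B - s) = \<rho> * max 0 (l + height B - s)"
    by (metis distrib_left)
  then have IP: "\<rho> * P \<le> (total_len B - height B) * (\<rho> - s) + \<rho> * max 0 (l + height B - s)"
    using IB by (simp add: P_def distrib_left)
  have low: "\<rho> * max 0 (m - s) \<le> m * (\<rho> - s)" if "0 \<le> m" "m \<le> \<rho>" for m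
  proof (cases "m \<le> s")
    case True then show ?thesis using that assms by simp
  next
    case False
    have "m * s \<le> \<rho> * s" using that assms by (intro mult_right_mono) auto
    then show ?thesis using False by (simp add: algebra_simps)
  qed
  have "\<rho> * (\<Sum>z\<leftarrow>arms (Graft A B). arm_above s z) = \<rho> * (\<Sum>z\<leftarrow>arms A. arm_above s z) + \<rho> * P"
    by (simp add: P_def distrib_left)
  also have "\<dots> \<le> (total_len A - height A + (total_len B - height B)) * (\<rho> - s)
      + \<rho> * max 0 (height A - s) + \<rho> * max 0 (l + height B - s)"
    using IA IP by (simp add: algebra_simps)
  also have "\<dots> \<le> (total_len (Graft A B) - height (Graft A B)) * (\<rho> - s) + \<rho> * max 0 (height (Graft A B) - s)"
  proof (cases "height A \<le> l + height B")
    case True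
    then show ?thesis using low[OF hA(1) bd(1)] by (simp add: l_def[symmetric] max_absorb2 algebra_simps)
  next
    case False
    then have "height (Graft A B) = height A" by (simp add: l_def)
    then show ?thesis using low[of "l + height B"] bd l hB by (simp add: l_def[symmetric] algebra_simps)
  qed
  finally show ?case .
qed

end

section \<open>Stretched windows on an interval\<close>

lemma emeasure_between_graphs:
  fixes A :: "(real \<times> real) set"
  assumes A: "A \<in> sets borel" and sub: "\<And>u s. (u, s) \<in> A \<Longrightarrow> a \<le> u \<and> u \<le> b \<and> c u \<le> s \<and> s \<le> c u + L"
    and L: "0 \<le> L" and "a \<le> b"
  shows "emeasure lborel A \<le> ennreal (L * (b - a))"
proof -
  have A': "A \<in> sets (lborel \<Otimes>\<^sub>M lborel)" using A unfolding lborel_prod by simp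
  have "emeasure lborel A = (\<integral>\<^sup>+u. emeasure lborel (Pair u -` A) \<partial>lborel)"
    using lborel.emeasure_pair_measure_alt[OF A'] unfolding lborel_prod by simp
  also have "\<dots> \<le> (\<integral>\<^sup>+u. ennreal L * indicator {a..b} u \<partial>lborel)"
  proof (rule nn_integral_mono)
    fix u
    show "emeasure lborel (Pair u -` A) \<le> ennreal L * indicator {a..b} u"
    proof (cases "u \<in> {a..b}")
      case True
      have "emeasure lborel (Pair u -` A) \<le> emeasure lborel {c u..c u + L}"
        using sub by (intro emeasure_mono) auto
      then show ?thesis using True L by simp
    next
      case False
      then have "Pair u -` A = {}" using sub by auto
      then show ?thesis by simp
    qed
  qed
  also have "\<dots> = ennreal (L * (b - a))"
    using assms by (simp add: nn_integral_cmult_indicator ennreal_mult)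
  finally show ?thesis .
qed

lemma emeasure_vertical_line: "emeasure lborel {p :: real \<times> real. fst p = c} = 0"
proof -
  have "{p :: real \<times> real. fst p = c} = {c} \<times> UNIV" by auto
  moreover have "emeasure (lborel \<Otimes>\<^sub>M lborel) ({c} \<times> (UNIV :: real set)) = emeasure lborel {c} * emeasure lborel (UNIV :: real set)"
    by (intro lborel.emeasure_pair_measure_Times) auto
  ultimately show ?thesis unfolding lborel_prod by simp
qed

lemma emeasure_horizontal_line: "emeasure lborel {p :: real \<times> real. snd p = c} = 0"
proof -
  have "{p :: real \<times> real. snd p = c} = UNIV \<times> {c}" by auto
  moreover have "emeasure (lborel \<Otimes>\<^sub>M lborel) ((UNIV :: real set) \<times> {c}) = emeasure lborel (UNIV :: real set) * emeasure lborel {c}"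
    by (intro lborel.emeasure_pair_measure_Times) auto
  ultimately show ?thesis unfolding lborel_prod by simp
qed

text \<open>A ball that covers an interval of the spine contains the whole bush \<open>(q, h)\<close> if the interval contains
  \<open>[q - h, q + h]\<close>.\<close>

definition fits :: "real \<Rightarrow> real \<Rightarrow> real \<times> real \<Rightarrow> bool" where
  "fits \<rho> u = (\<lambda>(q, h). u \<le> q - h \<and> q + h \<le> u + 2 * \<rho>)"

text \<open>The right end of the left half of the window \<open>[u, u + 2 * \<rho>]\<close>, cut at \<open>u + 2 * s\<close>: it is moved to the right
  to cover all bushes \<open>(q, h)\<close> that fit into the window and have their foot \<open>q\<close> to the left of the cut.\<close>

primrec reach :: "real \<Rightarrow> (real \<times> real) list \<Rightarrow> real \<Rightarrow> real \<Rightarrow> real" where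
  "reach \<rho> [] u s = u + 2 * s"
| "reach \<rho> (z # Q) u s = (if fits \<rho> u z \<and> fst z \<le> u + 2 * s then max (fst z + snd z) (reach \<rho> Q u s)
     else reach \<rho> Q u s)"

lemma reach_ge: "u + 2 * s \<le> reach \<rho> Q u s"
  by (induction Q) auto

lemma reach_ge_bush:
  "z \<in> set Q \<Longrightarrow> fits \<rho> u z \<Longrightarrow> fst z \<le> u + 2 * s \<Longrightarrow> fst z + snd z \<le> reach \<rho> Q u s"
  by (induction Q) auto

lemma reach_cases: "reach \<rho> Q u s = u + 2 * s \<or> (\<exists>z\<in>set Q. reach \<rho> Q u s = fst z + snd z)"
  by (induction Q) (auto simp: max_def)

lemma measurable_reach [measurable]: "(\<lambda>p. reach \<rho> Q (fst p) (snd p)) \<in> borel_measurable borel"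
proof (induction Q)
  case Nil
  show ?case by (simp add: borel_prod[symmetric])
next
  case (Cons z Q)
  have [measurable]: "(\<lambda>p. reach \<rho> Q (fst p) (snd p)) \<in> borel_measurable (borel \<Otimes>\<^sub>M borel)"
    using Cons by (simp add: borel_prod)
  have "(\<lambda>p. if (fst p \<le> fst z - snd z \<and> fst z + snd z \<le> fst p + 2 * \<rho>) \<and> fst z \<le> fst p + 2 * snd p
      then max (fst z + snd z) (reach \<rho> Q (fst p) (snd p)) else reach \<rho> Q (fst p) (snd p))
    \<in> borel_measurable (borel \<Otimes>\<^sub>M (borel :: real measure))"
    by measurable
  then show ?case by (simp add: fits_def case_prod_beta borel_prod)
qed

definition window_region :: "real \<Rightarrow> real \<Rightarrow> (real \<times> real) set" where
  "window_region D \<rho> = {0..D - 2 * \<rho>} \<times> {0..\<rho>}"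

lemma window_region_borel [measurable]: "window_region D \<rho> \<in> sets borel"
  unfolding window_region_def by (intro borel_closed closed_Times) auto

text \<open>Centre and radius of the ball that covers the left half. The right halves are left halves of the reflected
  interval.\<close>

definition window_ball :: "real \<Rightarrow> (real \<times> real) list \<Rightarrow> real \<times> real \<Rightarrow> real \<times> real" where
  "window_ball \<rho> Q p = ((fst p + reach \<rho> Q (fst p) (snd p)) / 2, (reach \<rho> Q (fst p) (snd p) - fst p) / 2)"

lemma measurable_window_ball [measurable]: "window_ball \<rho> Q \<in> borel_measurable borel"
proof -
  have [measurable]: "(\<lambda>p. reach \<rho> Q (fst p) (snd p)) \<in> borel_measurable (borel \<Otimes>\<^sub>M borel)"
    using measurable_reach by (simp add: borel_prod)
  have "(\<lambda>p. ((fst p + reach \<rho> Q (fst p) (snd p)) / 2, (reach \<rho> Q (fst p) (snd p) - fst p) / 2))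
    \<in> borel \<Otimes>\<^sub>M borel \<rightarrow>\<^sub>M borel \<Otimes>\<^sub>M borel" by measurable
  then show ?thesis by (simp add: window_ball_def[abs_def] borel_prod)
qed

lemma window_tail_set:
  "{p \<in> window_region D \<rho>. t < (reach \<rho> Q (fst p) (snd p) - fst p) / 2} \<in> sets borel"
proof -
  have "open {p :: real \<times> real. t < snd p}" by (intro open_Collect_less continuous_intros)
  then have "window_ball \<rho> Q -` {p. t < snd p} \<inter> space borel \<in> sets borel"
    by (intro measurable_sets[OF measurable_window_ball borel_open])
  then have "window_region D \<rho> \<inter> (window_ball \<rho> Q -` {p. t < snd p} \<inter> space borel) \<in> sets borel"
    using window_region_borel by blast
  then show ?thesis by (simp add: window_ball_def vimage_def Collect_conj_eq)
qed

text \<open>For fixed \<open>u\<close> the cuts at which a bush lifts the radius above \<open>t\<close> satisfy \<open>q \<le> u + 2 * s \<le> u + 2 * t < q + h\<close>,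
  so \<open>s\<close> varies by at most \<open>h / 2\<close>, and by at most \<open>t / 2\<close> if \<open>t < h\<close>. The positions \<open>u\<close> that occur form an interval of
  length at most \<open>2 * (\<rho> - t)\<close>, respectively \<open>2 * (\<rho> - h)\<close>.\<close>

lemma stretch_measure:
  assumes \<rho>: "0 < \<rho>" and h: "0 \<le> h" "h \<le> \<rho>" and t: "0 \<le> t" "t \<le> \<rho>"
    and A: "A \<in> sets borel"
    and sub: "\<And>u s. (u, s) \<in> A \<Longrightarrow> fits \<rho> u (q, h) \<and> q \<le> u + 2 * s \<and> s \<le> t \<and> u + 2 * t < q + h"
  shows "emeasure lborel A \<le> ennreal (h * (\<rho> - t) - \<rho> * max 0 (h - t))"
proof (cases "h \<le> t")
  case True
  have "emeasure lborel A \<le> ennreal (h / 2 * ((q + h - 2 * t) - (q + h - 2 * \<rho>)))"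
  proof (rule emeasure_between_graphs[OF A, where c = "\<lambda>u. (q - u) / 2"])
    fix u s assume "(u, s) \<in> A"
    from sub[OF this] show "q + h - 2 * \<rho> \<le> u \<and> u \<le> q + h - 2 * t \<and> (q - u) / 2 \<le> s \<and> s \<le> (q - u) / 2 + h / 2"
      by (auto simp: fits_def field_simps)
  qed (use h t in auto)
  also have "h / 2 * ((q + h - 2 * t) - (q + h - 2 * \<rho>)) = h * (\<rho> - t)" by (simp add: field_simps)
  finally show ?thesis using True by simp
next
  case False
  have "emeasure lborel A \<le> ennreal (t / 2 * ((q - h) - (q + h - 2 * \<rho>)))"
  proof (rule emeasure_between_graphs[OF A, where c = "\<lambda>u. (q - u) / 2"])
    fix u s assume "(u, s) \<in> A"
    from sub[OF this] False show "q + h - 2 * \<rho> \<le> u \<and> u \<le> q - h \<and> (q - u) / 2 \<le> s \<and> s \<le> (q - u) / 2 + t / 2"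
      by (auto simp: fits_def field_simps)
  qed (use h t in auto)
  also have "t / 2 * ((q - h) - (q + h - 2 * \<rho>)) = h * (\<rho> - t) - \<rho> * max 0 (h - t)"
    using False by (simp add: field_simps)
  finally show ?thesis .
qed

lemma window_tail:
  assumes \<rho>: "0 < \<rho>" "2 * \<rho> \<le> D" and Q: "\<And>q h. (q, h) \<in> set Q \<Longrightarrow> 0 \<le> h \<and> h \<le> \<rho>"
    and t: "0 \<le> t" "t \<le> \<rho>"
  shows "emeasure lborel {p \<in> window_region D \<rho>. t < (reach \<rho> Q (fst p) (snd p) - fst p) / 2}
    \<le> ennreal ((D - 2 * \<rho>) * (\<rho> - t) + (\<Sum>(q, h)\<leftarrow>Q. h * (\<rho> - t) - \<rho> * max 0 (h - t)))"
  using Q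
proof (induction Q)
  case Nil
  let ?A = "{p \<in> window_region D \<rho>. t < (reach \<rho> [] (fst p) (snd p) - fst p) / 2}"
  have "emeasure lborel ?A \<le> ennreal ((\<rho> - t) * ((D - 2 * \<rho>) - 0))"
    by (rule emeasure_between_graphs[OF window_tail_set, where c = "\<lambda>_. t"])
      (use \<rho> t in \<open>auto simp: window_region_def\<close>)
  then show ?case by (simp add: mult.commute)
next
  case (Cons z Q)
  obtain q h where z: "z = (q, h)" by fastforce
  have h: "0 \<le> h" "h \<le> \<rho>" using Cons.prems z by auto
  let ?A = "\<lambda>Q. {p \<in> window_region D \<rho>. t < (reach \<rho> Q (fst p) (snd p) - fst p) / 2}"
  let ?X = "?A (z # Q) - ?A Q"
  have m: "?A Q \<in> sets borel" for Q by (rule window_tail_set)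
  have X: "emeasure lborel ?X \<le> ennreal (h * (\<rho> - t) - \<rho> * max 0 (h - t))"
  proof (rule stretch_measure[OF \<rho>(1) h t, where q = q])
    show "?X \<in> sets borel" by (intro sets.Diff m)
    fix u s assume "(u, s) \<in> ?X"
    then show "fits \<rho> u (q, h) \<and> q \<le> u + 2 * s \<and> s \<le> t \<and> u + 2 * t < q + h"
      using reach_ge[of u s \<rho> Q] by (auto simp: z split: if_splits)
  qed
  have nonneg: "0 \<le> h * (\<rho> - t) - \<rho> * max 0 (h - t)" if "0 \<le> h" "h \<le> \<rho>" for h
  proof (cases "h \<le> t")
    case False
    have "h * t \<le> \<rho> * t" using that t by (intro mult_right_mono) auto
    then show ?thesis using False by (simp add: algebra_simps)
  qed (use that t in auto)
  have nonneg': "0 \<le> (\<Sum>(q, h)\<leftarrow>Q. h * (\<rho> - t) - \<rho> * max 0 (h - t))"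
  proof (rule sum_list_nonneg)
    fix y assume "y \<in> set (map (\<lambda>(q, h). h * (\<rho> - t) - \<rho> * max 0 (h - t)) Q)"
    then obtain k b where b: "(k, b) \<in> set Q" "y = b * (\<rho> - t) - \<rho> * max 0 (b - t)" by auto
    then have "0 \<le> b" "b \<le> \<rho>" using Cons.prems[of k b] by auto
    then show "0 \<le> y" unfolding b(2) by (rule nonneg)
  qed
  have mX: "?X \<in> sets borel" by (intro sets.Diff m)
  have "emeasure lborel (?A (z # Q)) \<le> emeasure lborel (?A Q \<union> ?X)"
  proof (rule emeasure_mono)
    show "?A (z # Q) \<subseteq> ?A Q \<union> ?X" by blast
    show "?A Q \<union> ?X \<in> sets lborel" unfolding sets_lborel by (intro sets.Un m mX)
  qed
  also have "\<dots> \<le> emeasure lborel (?A Q) + emeasure lborel ?X"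
    by (rule emeasure_subadditive; unfold sets_lborel; intro m mX)
  also have "\<dots> \<le> ennreal ((D - 2 * \<rho>) * (\<rho> - t) + (\<Sum>(q, h)\<leftarrow>Q. h * (\<rho> - t) - \<rho> * max 0 (h - t)))
      + ennreal (h * (\<rho> - t) - \<rho> * max 0 (h - t))"
    by (intro add_mono X Cons.IH) (use Cons.prems in auto)
  also have "\<dots> = ennreal ((D - 2 * \<rho>) * (\<rho> - t) + (\<Sum>(q, h)\<leftarrow>z # Q. h * (\<rho> - t) - \<rho> * max 0 (h - t)))"
    using nonneg' nonneg[OF h] \<rho> t by (subst ennreal_plus[symmetric]) (auto simp: z)
  finally show ?case .
qed

text \<open>A lower bound for the measure of the cuts \<open>s\<close> at which the left half of the window at \<open>u\<close> covers a point at
  height \<open>a\<close> in a bush of height \<open>h\<close> at \<open>q\<close>: the stretched half covers it if the foot of the bush lies in the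
  half, an unstretched half if it contains \<open>q + a\<close>.\<close>

definition window_share :: "real \<Rightarrow> real \<Rightarrow> real \<Rightarrow> real \<Rightarrow> real \<Rightarrow> real \<Rightarrow> real" where
  "window_share D \<rho> q h a u = (if u \<in> {0..D - 2 * \<rho>} then
      if fits \<rho> u (q, h) then \<rho> - (q - u) / 2
      else if fits \<rho> u (q, a) then \<rho> - (q + a - u) / 2 else 0 else 0)"

lemma measurable_window_share [measurable]: "window_share D \<rho> q h a \<in> borel_measurable borel"
  unfolding window_share_def[abs_def] fits_def prod.case by measurable

text \<open>Left and right half together: a window into which the bush fits covers the point at every cut, a window into
  which only \<open>[q - a, q + a]\<close> fits misses it for cuts in that interval.\<close>

lemma window_share_reflect:
  assumes "0 \<le> a" "a \<le> h"
  shows "window_share D \<rho> q h a u + window_share D \<rho> (D - q) h a (D - 2 * \<rho> - u) =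
    (\<rho> - a) * indicator {max 0 (q + a - 2 * \<rho>)..min (D - 2 * \<rho>) (q - a)} u
    + a * indicator {max 0 (q + h - 2 * \<rho>)..min (D - 2 * \<rho>) (q - h)} u"
  using assms unfolding window_share_def fits_def prod.case indicator_def
  by (auto simp: field_simps)

lemma window_share_nonneg: "0 \<le> a \<Longrightarrow> 0 \<le> h \<Longrightarrow> 0 \<le> window_share D \<rho> q h a u"
  unfolding window_share_def fits_def by (auto simp: field_simps)

lemma window_share_total:
  assumes "0 \<le> a" "a \<le> h" "h \<le> q" "h \<le> D - q" "h \<le> \<rho>" "2 * \<rho> \<le> D"
  shows "(\<integral>\<^sup>+u. ennreal (window_share D \<rho> q h a u) \<partial>lborel)
      + (\<integral>\<^sup>+u. ennreal (window_share D \<rho> (D - q) h a u) \<partial>lborel)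
    = ennreal ((\<rho> - a) * (min (D - 2 * \<rho>) (q - a) - max 0 (q + a - 2 * \<rho>))
       + a * (min (D - 2 * \<rho>) (q - h) - max 0 (q + h - 2 * \<rho>)))"
proof -
  let ?J = "\<lambda>a. {max 0 (q + a - 2 * \<rho>)..min (D - 2 * \<rho>) (q - a)}"
  have J: "emeasure lborel (?J b) = ennreal (min (D - 2 * \<rho>) (q - b) - max 0 (q + b - 2 * \<rho>))"
    "0 \<le> min (D - 2 * \<rho>) (q - b) - max 0 (q + b - 2 * \<rho>)" if "b \<le> h" for b
    using that assms by auto
  have "(\<integral>\<^sup>+u. ennreal (window_share D \<rho> (D - q) h a u) \<partial>lborel)
      = (\<integral>\<^sup>+u. ennreal (window_share D \<rho> (D - q) h a (D - 2 * \<rho> - u)) \<partial>lborel)"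
    using nn_integral_real_affine[of "\<lambda>u. ennreal (window_share D \<rho> (D - q) h a u)" "-1" "D - 2 * \<rho>"]
    by simp
  then have "(\<integral>\<^sup>+u. ennreal (window_share D \<rho> q h a u) \<partial>lborel)
      + (\<integral>\<^sup>+u. ennreal (window_share D \<rho> (D - q) h a u) \<partial>lborel)
    = (\<integral>\<^sup>+u. ennreal (window_share D \<rho> q h a u) + ennreal (window_share D \<rho> (D - q) h a (D - 2 * \<rho> - u)) \<partial>lborel)"
    by (simp add: nn_integral_add)
  also have "\<dots> = (\<integral>\<^sup>+u. ennreal (\<rho> - a) * indicator (?J a) u + ennreal a * indicator (?J h) u \<partial>lborel)"
  proof (rule nn_integral_cong)
    fix u
    have "ennreal (window_share D \<rho> q h a u) + ennreal (window_share D \<rho> (D - q) h a (D - 2 * \<rho> - u))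
      = ennreal ((\<rho> - a) * indicator (?J a) u + a * indicator (?J h) u)"
      using assms window_share_nonneg[of a h] unfolding window_share_reflect[OF assms(1,2), symmetric]
      by (simp add: ennreal_plus)
    also have "\<dots> = ennreal (\<rho> - a) * indicator (?J a) u + ennreal a * indicator (?J h) u"
      using assms by (auto simp: indicator_def ennreal_plus)
    finally show "ennreal (window_share D \<rho> q h a u) + ennreal (window_share D \<rho> (D - q) h a (D - 2 * \<rho> - u))
      = ennreal (\<rho> - a) * indicator (?J a) u + ennreal a * indicator (?J h) u" .
  qed
  also have "\<dots> = ennreal (\<rho> - a) * emeasure lborel (?J a) + ennreal a * emeasure lborel (?J h)"
    by (subst nn_integral_add) (simp_all add: nn_integral_cmult_indicator)
  also have "\<dots> = ennreal ((\<rho> - a) * (min (D - 2 * \<rho>) (q - a) - max 0 (q + a - 2 * \<rho>))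
       + a * (min (D - 2 * \<rho>) (q - h) - max 0 (q + h - 2 * \<rho>)))"
    using J[of a] J[of h] assms by (simp add: ennreal_mult ennreal_plus del: min_less_iff_conj)
  finally show ?thesis .
qed

text \<open>The right hand side collects what end balls, windows and bush balls give to a point at height \<open>a\<close> in a bush of
  height \<open>h\<close> at \<open>q\<close>. Let \<open>J\<close> and \<open>G\<close> be the lengths of the sets of windows that contain \<open>[q - a, q + a]\<close> and
  \<open>[q - h, q + h]\<close>. If all windows in the first set were stretched, end balls and windows would give \<open>2 * \<rho> * (\<rho> - a)\<close>,
  and the bush balls leave a surplus of \<open>\<rho> * (h - a)\<close>. This pays for the loss \<open>a * (J - G)\<close>, because by \<open>short\<close>
  windows can miss the longer interval on one side only, whence \<open>J - G \<le> h - a\<close>, and \<open>a \<le> \<rho>\<close>.\<close>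

lemma comb_inequality:
  fixes q a h D \<rho> :: real
  assumes "0 \<le> a" "a \<le> h" "h \<le> q" "h \<le> D - q" "h \<le> \<rho>" "2 * \<rho> \<le> D" "0 < \<rho>"
    and short: "h = 0 \<or> q + h \<le> 2 * \<rho> \<or> D - q + h \<le> 2 * \<rho>"
  shows "2 * \<rho> * \<rho> \<le> \<rho> * max 0 (2 * \<rho> - q - a) + \<rho> * max 0 (2 * \<rho> - (D - q) - a)
    + ((\<rho> - a) * (min (D - 2 * \<rho>) (q - a) - max 0 (q + a - 2 * \<rho>))
       + a * (min (D - 2 * \<rho>) (q - h) - max 0 (q + h - 2 * \<rho>))) + \<rho> * (a + h)"
proof -
  define J where "J = min (D - 2 * \<rho>) (q - a) - max 0 (q + a - 2 * \<rho>)"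
  define G where "G = min (D - 2 * \<rho>) (q - h) - max 0 (q + h - 2 * \<rho>)"
  have total: "max 0 (2 * \<rho> - q - a) + max 0 (2 * \<rho> - (D - q) - a) + J = 2 * \<rho> - 2 * a"
    using assms by (auto simp: J_def max_def min_def)
  have lost: "a * (J - G) \<le> \<rho> * (h - a)"
  proof (cases "h = 0")
    case True then show ?thesis using assms by simp
  next
    case False
    then have "J - G \<le> h - a" using assms by (auto simp: J_def G_def max_def min_def)
    then have "a * (J - G) \<le> a * (h - a)" using assms by (intro mult_left_mono) auto
    also have "\<dots> \<le> \<rho> * (h - a)" using assms by (intro mult_right_mono) auto
    finally show ?thesis .
  qed
  have "\<rho> * max 0 (2 * \<rho> - q - a) + \<rho> * max 0 (2 * \<rho> - (D - q) - a) + ((\<rho> - a) * J + a * G) + \<rho> * (a + h)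
    = \<rho> * (max 0 (2 * \<rho> - q - a) + max 0 (2 * \<rho> - (D - q) - a) + J) - a * (J - G) + \<rho> * (a + h)"
    by (simp add: algebra_simps)
  also have "\<dots> = \<rho> * (2 * \<rho> - 2 * a) - a * (J - G) + \<rho> * (a + h)" unfolding total ..
  also have "\<dots> \<ge> 2 * \<rho> * \<rho>" using lost by (simp add: algebra_simps)
  finally show ?thesis by (simp add: J_def G_def)
qed

context finite_metric_tree
begin

section \<open>End balls and windows as families of balls\<close>

definition end_family :: "real \<Rightarrow> (real \<Rightarrow> 'a \<Rightarrow> real) \<Rightarrow> 'a family" where
  "end_family \<rho> g = (g, image_of_region (2 * \<rho>) {0..\<rho>} (\<lambda>s. (s, s)))"

definition window_family :: "real \<Rightarrow> real \<Rightarrow> (real \<times> real) list \<Rightarrow> (real \<Rightarrow> 'a \<Rightarrow> real) \<Rightarrow> 'a family" where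
  "window_family D \<rho> Q g = (g, image_of_region 1 (window_region D \<rho>) (window_ball \<rho> Q))"

lemma admissible_image:
  fixes S :: "'c::euclidean_space set"
  assumes "short_curve g" and S: "S \<in> sets borel" "bounded S" and f: "f \<in> borel_measurable borel"
    and pos: "\<And>p. p \<in> S \<Longrightarrow> 0 \<le> snd (f p)"
    and null: "\<And>t. emeasure lborel {p \<in> S. snd (f p) = t} = 0"
  shows "admissible (g, image_of_region w S f)"
proof -
  have snd_m: "(snd :: real \<times> real \<Rightarrow> real) \<in> borel_measurable borel"
    unfolding borel_prod[symmetric] by measurable
  have X: "{p :: real \<times> real. snd p \<in> B} \<in> sets borel" if "B \<in> sets borel" for B
    using measurable_sets[OF snd_m that] by (simp add: vimage_def)
  have X1: "{p :: real \<times> real. snd p < 0} \<in> sets borel" using X[of "{..<0}"] by simp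
  have X2: "{p :: real \<times> real. snd p = t} \<in> sets borel" for t using X[of "{t}"] by simp
  have neg: "{p \<in> S. snd (f p) < 0} = {}" using pos by force
  then show ?thesis
    unfolding admissible_def
    using assms(1) finite_image_of_region[OF S(1) f emeasure_bounded_finite[OF S(2)]]
      emeasure_image_of_region[OF S(1) f X1, of w] emeasure_image_of_region[OF S(1) f X2, of w] null
    by (simp add: neg)
qed

lemma measurable_lift: "(\<lambda>\<sigma>. (\<sigma>, \<sigma> + H) :: real \<times> real) \<in> borel_measurable borel"
  by (intro borel_measurable_continuous_onI continuous_intros)

lemma measurable_pair_self: "(\<lambda>s. (s, s) :: real \<times> real) \<in> borel_measurable borel"
  using measurable_lift[of 0] by simp

lemma admissible_end: "short_curve g \<Longrightarrow> admissible (end_family \<rho> g)"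
  unfolding end_family_def
proof (rule admissible_image)
  show "(\<lambda>s. (s, s) :: real \<times> real) \<in> borel_measurable borel" by (rule measurable_pair_self)
  show "emeasure lborel {p \<in> {0..\<rho>}. snd (p, p) = t} = 0" for t
  proof -
    have "emeasure lborel {p \<in> {0..\<rho>}. snd (p, p) = t} \<le> emeasure lborel {t}" by (intro emeasure_mono) auto
    then show ?thesis by simp
  qed
qed auto

lemma admissible_window: "short_curve g \<Longrightarrow> admissible (window_family D \<rho> Q g)"
  unfolding window_family_def
proof (rule admissible_image)
  show "bounded (window_region D \<rho>)" unfolding window_region_def by (intro bounded_Times) auto
  show "0 \<le> snd (window_ball \<rho> Q p)" if "p \<in> window_region D \<rho>" for p
    using that reach_ge[of "fst p" "snd p" \<rho> Q] by (auto simp: window_region_def window_ball_def)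
  fix t
  let ?Z = "insert {p :: real \<times> real. snd p = t} ((\<lambda>z. {p :: real \<times> real. fst p = fst z + snd z - 2 * t}) ` set Q)"
  have null: "Z \<in> null_sets lborel" if "Z \<in> ?Z" for Z
  proof -
    have "{p :: real \<times> real. snd p = t} \<in> sets borel" "{p :: real \<times> real. fst p = c} \<in> sets borel" for c
      by (intro borel_closed closed_Collect_eq continuous_intros)+
    then show ?thesis using that emeasure_vertical_line emeasure_horizontal_line by (auto intro!: null_setsI)
  qed
  have "\<Union> ?Z \<in> null_sets lborel" by (rule null_sets.finite_Union) (use null in auto)
  moreover have "{p \<in> window_region D \<rho>. snd (window_ball \<rho> Q p) = t} \<subseteq> \<Union> ?Z"
  proof
    fix p assume "p \<in> {p \<in> window_region D \<rho>. snd (window_ball \<rho> Q p) = t}"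
    then have "reach \<rho> Q (fst p) (snd p) = fst p + 2 * t" by (auto simp: window_ball_def field_simps)
    then consider "snd p = t" | z where "z \<in> set Q" "fst p = fst z + snd z - 2 * t"
      using reach_cases[of \<rho> Q "fst p" "snd p"] by fastforce
    then show "p \<in> \<Union> ?Z" by cases auto
  qed
  ultimately show "emeasure lborel {p \<in> window_region D \<rho>. snd (window_ball \<rho> Q p) = t} = 0"
    using emeasure_mono[of "{p \<in> window_region D \<rho>. snd (window_ball \<rho> Q p) = t}" "\<Union> ?Z" lborel]
    by (simp add: null_sets_def)
qed simp_all

lemma end_above:
  assumes "0 \<le> t" "t \<le> \<rho>"
  shows "emeasure (snd (end_family \<rho> g)) {p. t < snd p} \<le> ennreal (2 * \<rho> * (\<rho> - t))"
proof -
  note m = measurable_pair_self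
  have X: "{p :: real \<times> real. t < snd p} \<in> sets borel"
    by (intro borel_open open_Collect_less continuous_intros)
  have "emeasure (snd (end_family \<rho> g)) {p. t < snd p} = ennreal (2 * \<rho>) * emeasure lborel {s \<in> {0..\<rho>}. t < s}"
    using emeasure_image_of_region[OF _ m X, of "{0..\<rho>}"] by (simp add: end_family_def)
  also have "\<dots> \<le> ennreal (2 * \<rho>) * emeasure lborel {t..\<rho>}"
    by (intro mult_left_mono emeasure_mono) auto
  finally show ?thesis using assms by (simp add: ennreal_mult)
qed

lemma window_above:
  assumes "0 < \<rho>" "2 * \<rho> \<le> D" "\<And>q h. (q, h) \<in> set Q \<Longrightarrow> 0 \<le> h \<and> h \<le> \<rho>" "0 \<le> t" "t \<le> \<rho>"
  shows "emeasure (snd (window_family D \<rho> Q g)) {p. t < snd p}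
    \<le> ennreal ((D - 2 * \<rho>) * (\<rho> - t) + (\<Sum>(q, h)\<leftarrow>Q. h * (\<rho> - t) - \<rho> * max 0 (h - t)))"
proof -
  have X: "{p :: real \<times> real. t < snd p} \<in> sets borel"
    by (intro borel_open open_Collect_less continuous_intros)
  show ?thesis
    using window_tail[OF assms] emeasure_image_of_region[OF window_region_borel measurable_window_ball X, of 1 D \<rho> \<rho> Q]
    by (simp add: window_family_def window_ball_def)
qed

lemma end_over:
  assumes g: "short_curve g" and x: "x \<in> TP" and d: "\<And>c. 0 \<le> c \<Longrightarrow> c \<le> \<rho> \<Longrightarrow> td x (g c) \<le> \<bar>c - q\<bar> + a"
    and "0 \<le> a" "a \<le> q" "0 \<le> \<rho>"
  shows "ennreal (\<rho> * max 0 (2 * \<rho> - q - a)) \<le> emeasure (snd (end_family \<rho> g)) (balls_over g x)"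
proof -
  note m = measurable_pair_self
  note X = balls_over_measurable[OF g x]
  have meas: "{s \<in> {0..\<rho>}. (s, s) \<in> balls_over g x} \<in> sets borel"
    using measurable_sets[OF m X] by (simp add: vimage_def Collect_conj_eq)
  have "ennreal (\<rho> * max 0 (2 * \<rho> - q - a)) = ennreal (2 * \<rho>) * ennreal (max 0 (\<rho> - (q + a) / 2))"
  proof -
    have eq: "\<rho> * max 0 (2 * \<rho> - q - a) = 2 * \<rho> * max 0 (\<rho> - (q + a) / 2)"
      by (auto simp: max_def field_simps)
    show ?thesis unfolding eq by (rule ennreal_mult) (use assms in auto)
  qed
  also have "ennreal (max 0 (\<rho> - (q + a) / 2)) = emeasure lborel {(q + a) / 2..\<rho>}"
    by (auto simp: max_def)
  also have "\<dots> \<le> emeasure lborel {s \<in> {0..\<rho>}. (s, s) \<in> balls_over g x}"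
  proof (rule emeasure_mono)
    show "{(q + a) / 2..\<rho>} \<subseteq> {s \<in> {0..\<rho>}. (s, s) \<in> balls_over g x}"
    proof
      fix s assume s: "s \<in> {(q + a) / 2..\<rho>}"
      then have s': "0 \<le> s" "s \<le> \<rho>" using assms by auto
      have "\<bar>s - q\<bar> + a \<le> s" using s assms by (auto simp: abs_le_iff)
      then show "s \<in> {s \<in> {0..\<rho>}. (s, s) \<in> balls_over g x}"
        using d[OF s'] s' by (simp add: balls_over_def)
    qed
  qed (use meas in simp)
  also have "ennreal (2 * \<rho>) * emeasure lborel {s \<in> {0..\<rho>}. (s, s) \<in> balls_over g x}
      = emeasure (snd (end_family \<rho> g)) (balls_over g x)"
    using emeasure_image_of_region[OF _ m X, of "{0..\<rho>}"] by (simp add: end_family_def)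
  finally show ?thesis by (simp add: mult_left_mono)
qed

lemma window_over:
  assumes g: "short_curve g" and x: "x \<in> TP" and d: "\<And>c. 0 \<le> c \<Longrightarrow> c \<le> D \<Longrightarrow> td x (g c) \<le> \<bar>c - q\<bar> + a"
    and a: "0 \<le> a" "a \<le> h" and \<rho>: "0 < \<rho>" "2 * \<rho> \<le> D"
    and Q: "(q, h) \<in> set Q \<or> a = 0 \<and> h = 0"
    and Qr: "\<And>z. z \<in> set Q \<Longrightarrow> 0 \<le> snd z \<and> fst z + snd z \<le> D"
  shows "(\<integral>\<^sup>+u. ennreal (window_share D \<rho> q h a u) \<partial>lborel)
    \<le> emeasure (snd (window_family D \<rho> Q g)) (balls_over g x)"
proof -
  note X = balls_over_measurable[OF g x]
  let ?A = "{p \<in> window_region D \<rho>. window_ball \<rho> Q p \<in> balls_over g x}"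
  have A: "?A \<in> sets borel"
    using measurable_sets[OF measurable_window_ball X] window_region_borel
    by (auto simp: vimage_def Collect_conj_eq)
  then have A': "?A \<in> sets (lborel \<Otimes>\<^sub>M lborel)" unfolding lborel_prod by simp
  have hit: "(u, s) \<in> ?A"
    if u: "u \<in> {0..D - 2 * \<rho>}" and s: "s \<in> {0..\<rho>}"
      and c: "fits \<rho> u (q, h) \<and> q \<le> u + 2 * s \<or> fits \<rho> u (q, a) \<and> q + a \<le> u + 2 * s" for u s
  proof -
    define e where "e = reach \<rho> Q u s"
    have e: "q + a \<le> e" "u \<le> q - a"
      using c Q a reach_ge[of u s \<rho> Q] reach_ge_bush[of "(q, h)" Q \<rho> u s]
      by (auto simp: e_def fits_def)
    have eD: "e \<le> D" using reach_cases[of \<rho> Q u s] Qr u s by (auto simp: e_def)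
    have "td x (g ((u + e) / 2)) \<le> \<bar>(u + e) / 2 - q\<bar> + a"
      using e eD u a by (intro d) auto
    also have "\<bar>(u + e) / 2 - q\<bar> \<le> (e - u) / 2 - a"
      by (rule abs_leI) (use e in \<open>auto simp: field_simps\<close>)
    finally show ?thesis
      using u s by (simp add: window_region_def window_ball_def balls_over_def e_def)
  qed
  have "(\<integral>\<^sup>+u. ennreal (window_share D \<rho> q h a u) \<partial>lborel) \<le> (\<integral>\<^sup>+u. emeasure lborel (Pair u -` ?A) \<partial>lborel)"
  proof (rule nn_integral_mono)
    fix u
    have mA: "Pair u -` ?A \<in> sets lborel" using sets_Pair1[OF A'] by simp
    consider "u \<in> {0..D - 2 * \<rho>}" "fits \<rho> u (q, h)"
      | "u \<in> {0..D - 2 * \<rho>}" "\<not> fits \<rho> u (q, h)" "fits \<rho> u (q, a)"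
      | "u \<notin> {0..D - 2 * \<rho>}" | "\<not> fits \<rho> u (q, h)" "\<not> fits \<rho> u (q, a)" by blast
    then show "ennreal (window_share D \<rho> q h a u) \<le> emeasure lborel (Pair u -` ?A)"
    proof cases
      case 1
      then have "window_share D \<rho> q h a u = \<rho> - (q - u) / 2" by (simp add: window_share_def)
      moreover have "(q - u) / 2 \<le> \<rho>" "0 \<le> (q - u) / 2" using 1(2) a by (auto simp: fits_def)
      ultimately have "ennreal (window_share D \<rho> q h a u) = emeasure lborel {(q - u) / 2..\<rho>}" by simp
      also have "\<dots> \<le> emeasure lborel (Pair u -` ?A)"
      proof (rule emeasure_mono[OF subsetI mA])
        fix s assume s: "s \<in> {(q - u) / 2..\<rho>}"
        then have "s \<in> {0..\<rho>}" "q \<le> u + 2 * s" using \<open>0 \<le> (q - u) / 2\<close> by auto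
        then show "s \<in> Pair u -` ?A" using hit[OF 1(1)] 1(2) by blast
      qed
      finally show ?thesis .
    next
      case 2
      then have "window_share D \<rho> q h a u = \<rho> - (q + a - u) / 2" by (simp add: window_share_def)
      moreover have "(q + a - u) / 2 \<le> \<rho>" "0 \<le> (q + a - u) / 2" using 2(3) a by (auto simp: fits_def)
      ultimately have "ennreal (window_share D \<rho> q h a u) = emeasure lborel {(q + a - u) / 2..\<rho>}" by simp
      also have "\<dots> \<le> emeasure lborel (Pair u -` ?A)"
      proof (rule emeasure_mono[OF subsetI mA])
        fix s assume s: "s \<in> {(q + a - u) / 2..\<rho>}"
        then have "s \<in> {0..\<rho>}" "q + a \<le> u + 2 * s" using \<open>0 \<le> (q + a - u) / 2\<close> by auto
        then show "s \<in> Pair u -` ?A" using hit[OF 2(1)] 2(3) by blast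
      qed
      finally show ?thesis .
    next
      case 3 then show ?thesis unfolding window_share_def by (subst if_not_P) auto
    next
      case 4 then show ?thesis by (simp add: window_share_def)
    qed
  qed
  also have "\<dots> = emeasure lborel ?A"
    using lborel.emeasure_pair_measure_alt[OF A'] unfolding lborel_prod by simp
  also have "\<dots> = emeasure (snd (window_family D \<rho> Q g)) (balls_over g x)"
    using emeasure_image_of_region[OF window_region_borel measurable_window_ball X, of 1 D \<rho> \<rho> Q]
    by (simp add: window_family_def)
  finally show ?thesis .
qed

end

section \<open>A spine with bushes\<close>

lemma ennreal_add5:
  assumes "0 \<le> a" "0 \<le> b" "0 \<le> c" "0 \<le> d" "0 \<le> e"
  shows "ennreal a + (ennreal b + (ennreal c + (ennreal d + ennreal e))) = ennreal (a + (b + (c + (d + e))))"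
  using assms by simp

context finite_metric_tree
begin

lemma mass_over_append [simp]: "mass_over (Fs @ Gs) x = mass_over Fs x + mass_over Gs x"
  by (simp add: mass_over_def)

lemma mass_above_append [simp]: "mass_above (Fs @ Gs) t = mass_above Fs t + mass_above Gs t"
  by (simp add: mass_above_def)

lemma mass_above_antimono:
  assumes "\<And>F. F \<in> set Fs \<Longrightarrow> admissible F" "s \<le> t"
  shows "mass_above Fs t \<le> mass_above Fs s"
  unfolding mass_above_def
proof (rule sum_list_mono)
  fix F assume "F \<in> set Fs"
  then have "sets (snd F) = sets borel" using assms(1) by (simp add: admissible_def)
  moreover have "{p :: real \<times> real. s < snd p} \<in> sets borel"
    by (intro borel_open open_Collect_less continuous_intros)
  ultimately show "emeasure (snd F) {p. t < snd p} \<le> emeasure (snd F) {p. s < snd p}"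
    using assms(2) by (intro emeasure_mono) auto
qed

lemma coverable_of_scaled_families:
  assumes adm: "\<And>F. F \<in> set Fs \<Longrightarrow> admissible F"
    and pos: "0 < k" "0 < lam" and r: "0 \<le> r"
    and above: "\<And>t. 0 \<le> t \<Longrightarrow> t \<le> r \<Longrightarrow> mass_above Fs t \<le> ennreal (k * lam * (r - t))"
    and X: "X \<subseteq> TP" and over: "\<And>x. x \<in> X \<Longrightarrow> ennreal k \<le> mass_over Fs x"
  shows "coverable r lam X"
proof -
  define Gs where "Gs = map (\<lambda>F. (fst F, scale_measure (ennreal (1 / k)) (snd F))) Fs"
  have mult: "(\<Sum>F\<leftarrow>Fs. c * f F) = c * (\<Sum>F\<leftarrow>Fs. f F)" for c :: ennreal and f
    by (induction Fs) (auto simp: distrib_left)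
  have k: "ennreal (1 / k) * ennreal (k * y) = ennreal y" if "0 \<le> y" for y
    using pos that by (simp add: ennreal_mult[symmetric])
  show ?thesis
  proof (rule coverable_of_families[of Gs])
    fix F assume "F \<in> set Gs"
    then obtain G where G: "G \<in> set Fs" "F = (fst G, scale_measure (ennreal (1 / k)) (snd G))"
      by (auto simp: Gs_def)
    have "finite_measure (scale_measure (ennreal (1 / k)) (snd G))"
      using adm[OF G(1)] finite_measure.emeasure_finite[of "snd G" "space (snd G)"]
      by (intro finite_measureI) (auto simp: admissible_def space_scale_measure ennreal_mult_eq_top_iff)
    then show "admissible F" using adm[OF G(1)] by (simp add: G(2) admissible_def)
  next
    fix t assume t: "0 \<le> t" "t \<le> r"
    have "mass_above Gs t = ennreal (1 / k) * mass_above Fs t"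
      by (simp add: mass_above_def Gs_def comp_def mult)
    also have "\<dots> \<le> ennreal (1 / k) * ennreal (k * (lam * (r - t)))"
      using above[OF t] by (intro mult_left_mono) (auto simp: mult.assoc)
    also have "\<dots> = ennreal (lam * (r - t))" using pos t by (intro k) auto
    finally show "mass_above Gs t \<le> ennreal (lam * (r - t))" .
  next
    fix x assume x: "x \<in> X"
    have "1 = ennreal (1 / k) * ennreal (k * 1)" using k[of 1] by simp
    also have "\<dots> \<le> ennreal (1 / k) * mass_over Fs x"
      using over[OF x] by (intro mult_left_mono) auto
    also have "\<dots> = mass_over Gs x"
      by (simp add: mass_over_def Gs_def comp_def mult)
    finally show "1 \<le> mass_over Gs x" .
  qed (use pos r X in auto)
qed

definition arm_family :: "real \<Rightarrow> real \<times> 'a \<times> 'a \<Rightarrow> 'a family" where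
  "arm_family \<rho> = (\<lambda>(H, v, w).
     (edge_curve v w, image_of_region (2 * \<rho>) {0..len {v, w}} (\<lambda>\<sigma>. (\<sigma>, \<sigma> + H))))"

lemma arms_in_tree: "in_tree t \<Longrightarrow> (H, v, w) \<in> set (arms t) \<Longrightarrow> {v, w} \<in> E \<and> 0 \<le> H"
  by (induction t) (auto simp: insert_commute height_nonneg)

lemma admissible_arm:
  assumes "{v, w} \<in> E" "0 \<le> H" shows "admissible (arm_family \<rho> (H, v, w))"
  unfolding arm_family_def prod.case
proof (rule admissible_image)
  show "emeasure lborel {\<sigma> \<in> {0..len {v, w}}. snd (\<sigma>, \<sigma> + H) = t} = 0" for t
  proof -
    have "emeasure lborel {\<sigma> \<in> {0..len {v, w}}. snd (\<sigma>, \<sigma> + H) = t} \<le> emeasure lborel {t - H}"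
      by (intro emeasure_mono) auto
    then show ?thesis by simp
  qed
qed (use assms short_edge_curve measurable_lift in auto)

lemma arms_mass_over:
  assumes "in_tree t" "x \<in> TP"
  shows "mass_over (map (arm_family \<rho>) (arms t)) x = ennreal (2 * \<rho>) * (\<Sum>z\<leftarrow>arms t. arm_over x z)"
proof -
  have *: "emeasure (snd (arm_family \<rho> z)) (balls_over (fst (arm_family \<rho> z)) x) = ennreal (2 * \<rho>) * arm_over x z"
    if "z \<in> set (arms t)" for z
  proof -
    obtain H v w where z: "z = (H, v, w)" by (metis prod_cases3)
    have e: "{v, w} \<in> E" using arms_in_tree[OF assms(1)] that z by blast
    have "{\<sigma> \<in> {0..len {v, w}}. (\<sigma>, \<sigma> + H) \<in> balls_over (edge_curve v w) x}
      = {\<sigma> \<in> {0..len {v, w}}. td x (edge_curve v w \<sigma>) \<le> H + \<sigma>}"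
      by (auto simp: balls_over_def add.commute)
    then show ?thesis
      using emeasure_image_of_region[OF _ measurable_lift balls_over_measurable[OF short_edge_curve[OF e] assms(2)], of "{0..len {v, w}}"]
      by (simp add: z arm_family_def arm_over_def)
  qed
  have "mass_over (map (arm_family \<rho>) (arms t)) x = (\<Sum>z\<leftarrow>arms t. ennreal (2 * \<rho>) * arm_over x z)"
    unfolding mass_over_def map_map comp_def using * by (intro arg_cong[where f = sum_list] map_cong) auto
  also have "\<dots> = ennreal (2 * \<rho>) * (\<Sum>z\<leftarrow>arms t. arm_over x z)"
    by (induction "arms t") (auto simp: sum_list_const_mult)
  finally show ?thesis .
qed

lemma arms_mass_above:
  assumes "in_tree t" "0 \<le> \<rho>"
  shows "mass_above (map (arm_family \<rho>) (arms t)) s \<le> ennreal (2 * \<rho> * (\<Sum>z\<leftarrow>arms t. arm_above s z))"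
proof -
  have X: "{p :: real \<times> real. s < snd p} \<in> sets borel"
    by (intro borel_open open_Collect_less continuous_intros)
  have *: "emeasure (snd (arm_family \<rho> z)) {p. s < snd p} \<le> ennreal (2 * \<rho> * arm_above s z)" for z
  proof -
    obtain H v w where z: "z = (H, v, w)" by (metis prod_cases3)
    have "emeasure (snd (arm_family \<rho> z)) {p. s < snd p}
        = ennreal (2 * \<rho>) * emeasure lborel {\<sigma> \<in> {0..len {v, w}}. s < \<sigma> + H}"
      using emeasure_image_of_region[OF _ measurable_lift X, of "{0..len {v, w}}"]
      by (simp add: z arm_family_def)
    also have "\<dots> \<le> ennreal (2 * \<rho>) * emeasure lborel {max 0 (s - H)..len {v, w}}"
      by (intro mult_left_mono emeasure_mono) auto
    also have "\<dots> \<le> ennreal (2 * \<rho>) * ennreal (arm_above s z)"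
      by (intro mult_left_mono) (auto simp: z arm_above_def max_def min_def)
    also have "\<dots> = ennreal (2 * \<rho> * arm_above s z)"
      using assms(2) by (intro ennreal_mult[symmetric]) (auto simp: z arm_above_def)
    finally show ?thesis .
  qed
  have nonneg: "0 \<le> arm_above s z" for z by (auto simp: arm_above_def split: prod.split)
  have "(\<Sum>z\<leftarrow>zs. emeasure (snd (arm_family \<rho> z)) {p. s < snd p}) \<le> ennreal (2 * \<rho> * (\<Sum>z\<leftarrow>zs. arm_above s z))" for zs
  proof (induction zs)
    case (Cons z zs)
    have "0 \<le> (\<Sum>z\<leftarrow>zs. arm_above s z)" by (intro sum_list_nonneg) (auto simp: nonneg)
    then have "ennreal (2 * \<rho> * (\<Sum>z\<leftarrow>z # zs. arm_above s z))
      = ennreal (2 * \<rho> * arm_above s z) + ennreal (2 * \<rho> * (\<Sum>z\<leftarrow>zs. arm_above s z))"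
      using assms(2) nonneg[of z] by (subst ennreal_plus[symmetric]) (auto simp: distrib_left)
    then show ?case using add_mono[OF *[of z] Cons] by simp
  qed simp
  then show ?thesis by (simp add: mass_above_def comp_def)
qed

definition disc_family :: "real \<Rightarrow> real \<Rightarrow> real \<Rightarrow> ('a \<Rightarrow> real) \<Rightarrow> 'a family" where
  "disc_family w a b p = ((\<lambda>_. p), image_of_region w {a..b} (\<lambda>s. (s, s)))"

lemma short_constant: "p \<in> TP \<Longrightarrow> short_curve (\<lambda>_. p)"
  by (simp add: short_curve_def)

lemma admissible_disc:
  assumes "p \<in> TP" "0 \<le> a" shows "admissible (disc_family w a b p)"
  unfolding disc_family_def
proof (rule admissible_image)
  show "emeasure lborel {s \<in> {a..b}. snd (s, s) = t} = 0" for t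
  proof -
    have "emeasure lborel {s \<in> {a..b}. snd (s, s) = t} \<le> emeasure lborel {t}" by (intro emeasure_mono) auto
    then show ?thesis by simp
  qed
qed (use assms measurable_pair_self short_constant in auto)

lemma disc_above:
  assumes "0 \<le> w" "max a t \<le> b"
  shows "emeasure (snd (disc_family w a b p)) {p. t < snd p} \<le> ennreal (w * (b - max a t))"
proof -
  have X: "{p :: real \<times> real. t < snd p} \<in> sets borel"
    by (intro borel_open open_Collect_less continuous_intros)
  have "emeasure (snd (disc_family w a b p)) {p. t < snd p} = ennreal w * emeasure lborel {s \<in> {a..b}. t < s}"
    using emeasure_image_of_region[OF _ measurable_pair_self X, of "{a..b}"] by (simp add: disc_family_def)
  also have "\<dots> \<le> ennreal w * emeasure lborel {max a t..b}"
    by (intro mult_left_mono emeasure_mono) auto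
  also have "\<dots> = ennreal (w * (b - max a t))" using assms by (simp add: ennreal_mult)
  finally show ?thesis .
qed

lemma disc_over:
  assumes "p \<in> TP" "x \<in> TP" "0 \<le> w" "a \<le> b" "a < b \<Longrightarrow> td x p \<le> a"
  shows "ennreal (w * (b - a)) \<le> emeasure (snd (disc_family w a b p)) (balls_over (fst (disc_family w a b p)) x)"
proof (cases "a < b")
  case True
  then have d: "td x p \<le> a" using assms by simp
  have "{s \<in> {a..b}. (s, s) \<in> balls_over (\<lambda>_. p) x} = {a..b}" using d by (auto simp: balls_over_def)
  then show ?thesis
    using emeasure_image_of_region[OF _ measurable_pair_self balls_over_measurable[OF short_constant[OF assms(1)] assms(2)], of "{a..b}"] True assms
    by (simp add: disc_family_def ennreal_mult)
qed (use assms in simp)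

text \<open>The curve \<open>g\<close> is the spine on \<open>[0, D]\<close>, and \<open>Bs\<close> lists the bushes with the coordinates of their feet. All masses are
  taken times \<open>2 * r\<^sup>2\<close>. The right halves of the windows and the balls at the right end are the left ones of the
  reflected spine \<open>g'\<close> with the bushes \<open>Q'\<close>.\<close>

lemma comb_coverable:
  fixes Bs :: "('a rtree \<times> real) list" and r D L :: real
  defines "\<rho> \<equiv> min (D / 2) r"
  assumes g: "short_curve g" and r: "0 < r" and D: "0 < D"
    and L: "L = D + (\<Sum>(K, q)\<leftarrow>Bs. total_len K)" "2 * r \<le> L"
    and B: "\<And>K q. (K, q) \<in> set Bs \<Longrightarrow> in_tree K \<and> g q = vertex_pt (anchor K) \<and> height K \<le> q \<and> height K \<le> D - q \<and>
      (height K = 0 \<or> q + height K \<le> 2 * \<rho> \<or> D - q + height K \<le> 2 * \<rho>)"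
    and X: "X \<subseteq> g ` {0..D} \<union> (\<Union>(K, q)\<in>set Bs. points K)"
  shows "coverable r (L / r\<^sup>2) X"
proof -
  define Q where "Q = map (\<lambda>(K, q). (q, height K)) Bs"
  define Q' where "Q' = map (\<lambda>(K, q). (D - q, height K)) Bs"
  define g' where "g' c = g (D - c)" for c
  define own where "own = concat (map (\<lambda>(K, q). map (arm_family \<rho>) (arms K)) Bs)"
  \<comment> \<open>\<open>Fs\<close> gives mass \<open>2 * \<rho>\<^sup>2\<close> to every point; the weight is chosen to supply the missing \<open>2 * (r\<^sup>2 - \<rho>\<^sup>2)\<close>.\<close>
  define disc where "disc = disc_family (2 * (r + \<rho>)) \<rho> r (g (D / 2))"
  define Fs where "Fs = [end_family \<rho> g, window_family D \<rho> Q g, end_family \<rho> g', window_family D \<rho> Q' g'] @ own"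
  have \<rho>: "0 < \<rho>" "\<rho> \<le> r" "2 * \<rho> \<le> D" using r D by (auto simp: \<rho>_def)
  have gT: "g c \<in> TP" for c using g by (simp add: short_curve_def)
  have gd: "td (g c) (g c') \<le> \<bar>c - c'\<bar>" for c c' using g by (simp add: short_curve_def)
  have g': "short_curve g'"
    unfolding short_curve_def g'_def
  proof (intro conjI allI)
    fix c c'
    show "td (g (D - c)) (g (D - c')) \<le> \<bar>c - c'\<bar>" using gd[of "D - c" "D - c'"] by (simp add: abs_minus_commute)
  qed (rule gT)
  have h: "0 \<le> height K" "height K \<le> \<rho>" "height K \<le> q" "height K \<le> D - q" "in_tree K"
    "g q = vertex_pt (anchor K)" "height K = 0 \<or> q + height K \<le> 2 * \<rho> \<or> D - q + height K \<le> 2 * \<rho>"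
    if "(K, q) \<in> set Bs" for K q
    using B[OF that] height_nonneg[of K] \<rho> by auto
  have own_set: "\<exists>K q H v w. (K, q) \<in> set Bs \<and> (H, v, w) \<in> set (arms K) \<and> F = arm_family \<rho> (H, v, w)"
    if "F \<in> set own" for F using that by (force simp: own_def)
  have own_adm: "admissible F" if F: "F \<in> set own" for F
  proof -
    obtain K q H v w where K: "(K, q) \<in> set Bs" "(H, v, w) \<in> set (arms K)" "F = arm_family \<rho> (H, v, w)"
      using own_set[OF F] by blast
    show ?thesis unfolding K(3) using arms_in_tree[OF h(5)[OF K(1)] K(2)] by (intro admissible_arm) auto
  qed
  have adm: "admissible F" if "F \<in> set Fs" for F
    using that own_adm[of F] admissible_end[OF g] admissible_end[OF g'] admissible_window[OF g] admissible_window[OF g']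
    by (auto simp: Fs_def)
  have disc_adm: "admissible disc" unfolding disc_def using \<rho> gT by (intro admissible_disc) auto
  have QB: "0 \<le> b \<and> b \<le> \<rho>" if "(q, b) \<in> set Q" for q b using that h by (auto simp: Q_def)
  have Q'B: "0 \<le> b \<and> b \<le> \<rho>" if "(q, b) \<in> set Q'" for q b using that h by (auto simp: Q'_def)
  have QD: "0 \<le> snd z \<and> fst z + snd z \<le> D" if z: "z \<in> set Q" for z
  proof -
    obtain K q where "(K, q) \<in> set Bs" "z = (q, height K)" using z by (auto simp: Q_def)
    then show ?thesis using h(1)[of K q] h(4)[of K q] by simp
  qed
  have Q'D: "0 \<le> snd z \<and> fst z + snd z \<le> D" if z: "z \<in> set Q'" for z
  proof -
    obtain K q where "(K, q) \<in> set Bs" "z = (D - q, height K)" using z by (auto simp: Q'_def)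
    then show ?thesis using h(1)[of K q] h(3)[of K q] by simp
  qed
  have L0: "0 < L" using L r by linarith

  \<comment> \<open>The bush balls and the stretching of windows on both sides of a bush together use its share of the radii.\<close>
  have low: "mass_above Fs t \<le> ennreal (2 * L * (\<rho> - t))" if t: "0 \<le> t" "t \<le> \<rho>" for t
  proof -
    define st where "st h = h * (\<rho> - t) - \<rho> * max 0 (h - t)" for h
    have st0: "0 \<le> st h" if "0 \<le> h" "h \<le> \<rho>" for h
    proof (cases "h \<le> t")
      case False
      have "h * t \<le> \<rho> * t" using that t by (intro mult_right_mono) auto
      then show ?thesis using False by (simp add: st_def algebra_simps)
    qed (use that t in \<open>auto simp: st_def\<close>)
    define S where "S = (\<Sum>(K, q)\<leftarrow>Bs. st (height K))"
    define Ow where "Ow = (\<Sum>(K, q)\<leftarrow>Bs. 2 * \<rho> * (\<Sum>z\<leftarrow>arms K. arm_above t z))"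
    have arm0: "0 \<le> arm_above t z" for z by (auto simp: arm_above_def split: prod.split)
    have S0: "0 \<le> S" unfolding S_def
      by (rule sum_list_nonneg) (use h st0 in auto)
    have armK0: "0 \<le> 2 * \<rho> * (\<Sum>z\<leftarrow>arms K. arm_above t z)" for K
      using \<rho> arm0 by (intro mult_nonneg_nonneg sum_list_nonneg) auto
    then have O0: "0 \<le> Ow" unfolding Ow_def by (intro sum_list_nonneg) auto
    have w: "emeasure (snd (window_family D \<rho> Q g)) {p. t < snd p} \<le> ennreal ((D - 2 * \<rho>) * (\<rho> - t) + S)"
    proof -
      have "(\<Sum>(q, h)\<leftarrow>Q. h * (\<rho> - t) - \<rho> * max 0 (h - t)) = S"
        by (simp add: Q_def S_def st_def comp_def case_prod_unfold)
      then show ?thesis using window_above[OF \<rho>(1,3) _ t, of Q, where g = g] QB by simp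
    qed
    have w': "emeasure (snd (window_family D \<rho> Q' g')) {p. t < snd p} \<le> ennreal ((D - 2 * \<rho>) * (\<rho> - t) + S)"
    proof -
      have "(\<Sum>(q, h)\<leftarrow>Q'. h * (\<rho> - t) - \<rho> * max 0 (h - t)) = S"
        by (simp add: Q'_def S_def st_def comp_def case_prod_unfold)
      then show ?thesis using window_above[OF \<rho>(1,3) _ t, of Q', where g = g'] Q'B by simp
    qed
    have o: "mass_above own t \<le> ennreal Ow"
    proof -
      have "mass_above (concat (map (\<lambda>(K, q). map (arm_family \<rho>) (arms K)) Cs)) t
          \<le> ennreal (\<Sum>(K, q)\<leftarrow>Cs. 2 * \<rho> * (\<Sum>z\<leftarrow>arms K. arm_above t z))" if "set Cs \<subseteq> set Bs" for Cs
        using that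
      proof (induction Cs)
        case Nil then show ?case by (simp add: mass_above_def)
      next
        case (Cons C Cs)
        obtain K q where C: "C = (K, q)" by fastforce
        have i: "in_tree K" using Cons.prems h(5)[of K q] C by auto
        have nn: "0 \<le> (\<Sum>(K, q)\<leftarrow>Cs. 2 * \<rho> * (\<Sum>z\<leftarrow>arms K. arm_above t z))"
          using armK0 by (intro sum_list_nonneg) auto
        have "mass_above (map (arm_family \<rho>) (arms K)) t \<le> ennreal (2 * \<rho> * (\<Sum>z\<leftarrow>arms K. arm_above t z))"
          using arms_mass_above[OF i] \<rho> by simp
        moreover have "mass_above (concat (map (\<lambda>(K, q). map (arm_family \<rho>) (arms K)) Cs)) t
          \<le> ennreal (\<Sum>(K, q)\<leftarrow>Cs. 2 * \<rho> * (\<Sum>z\<leftarrow>arms K. arm_above t z))"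
          using Cons by auto
        ultimately show ?case using nn armK0[of K] by (simp add: C ennreal_plus add_mono)
      qed
      then show ?thesis by (simp add: own_def Ow_def)
    qed
    have e: "emeasure (snd (end_family \<rho> k)) {p. t < snd p} \<le> ennreal (2 * \<rho> * (\<rho> - t))" for k
      using end_above t by simp
    let ?W = "(D - 2 * \<rho>) * (\<rho> - t) + S" and ?N = "2 * \<rho> * (\<rho> - t)"
    have nn: "0 \<le> ?W" "0 \<le> ?N" using S0 \<rho> t by auto
    have "mass_above Fs t = emeasure (snd (end_family \<rho> g)) {p. t < snd p}
       + (emeasure (snd (window_family D \<rho> Q g)) {p. t < snd p}
       + (emeasure (snd (end_family \<rho> g')) {p. t < snd p}
       + (emeasure (snd (window_family D \<rho> Q' g')) {p. t < snd p} + mass_above own t)))"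
      by (simp add: Fs_def mass_above_def add.assoc)
    also have "\<dots> \<le> ennreal ?N + (ennreal ?W + (ennreal ?N + (ennreal ?W + ennreal Ow)))"
      by (intro add_mono e w w' o)
    also have "\<dots> = ennreal (?N + (?W + (?N + (?W + Ow))))"
      by (rule ennreal_add5[OF nn(2,1,2,1) O0])
    also have "\<dots> \<le> ennreal (2 * L * (\<rho> - t))"
    proof (rule ennreal_leI)
      have "(\<Sum>(K, q)\<leftarrow>Cs. 2 * \<rho> * (\<Sum>z\<leftarrow>arms K. arm_above t z)) + 2 * (\<Sum>(K, q)\<leftarrow>Cs. st (height K))
          \<le> 2 * (\<Sum>(K, q)\<leftarrow>Cs. total_len K) * (\<rho> - t)" if "set Cs \<subseteq> set Bs" for Cs
        using that
      proof (induction Cs)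
        case (Cons C Cs)
        obtain K q where C: "C = (K, q)" by fastforce
        have K: "(K, q) \<in> set Bs" using Cons.prems C by auto
        have "\<rho> * (\<Sum>z\<leftarrow>arms K. arm_above t z) \<le> (total_len K - height K) * (\<rho> - t) + \<rho> * max 0 (height K - t)"
          using arms_tail[OF h(5)[OF K] h(2)[OF K] t] .
        then have "2 * \<rho> * (\<Sum>z\<leftarrow>arms K. arm_above t z) + 2 * st (height K) \<le> 2 * total_len K * (\<rho> - t)"
          by (simp add: st_def algebra_simps)
        then show ?case using Cons C by (simp add: algebra_simps)
      qed simp
      from this[of Bs] show "?N + (?W + (?N + (?W + Ow))) \<le> 2 * L * (\<rho> - t)"
        by (simp add: Ow_def S_def L(1) algebra_simps)
    qed
    finally show ?thesis .
  qed

  show ?thesis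
  proof (rule coverable_of_scaled_families[of "Fs @ [disc]" "2 * r\<^sup>2"])
    show "admissible F" if "F \<in> set (Fs @ [disc])" for F using that adm[of F] disc_adm by auto
    show "X \<subseteq> TP"
    proof
      fix x assume "x \<in> X"
      with X consider c where "x = g c" | K q where "(K, q) \<in> set Bs" "x \<in> points K" by blast
      then show "x \<in> TP"
      proof cases
        case 2 then show ?thesis using points_in_tree[OF h(5)[OF 2(1)]] by blast
      qed (simp add: gT)
    qed
  next
    fix t assume t: "0 \<le> t" "t \<le> r"
    define t' where "t' = min t \<rho>"
    have t': "0 \<le> t'" "t' \<le> \<rho>" "t' \<le> t" using t \<rho> by (auto simp: t'_def)
    have "mass_above Fs t \<le> ennreal (2 * L * (\<rho> - t'))"
      using mass_above_antimono[OF adm t'(3)] low[OF t'(1,2)] by (rule order_trans)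
    moreover have "mass_above [disc] t \<le> ennreal (2 * (r + \<rho>) * (r - max \<rho> t))"
      using disc_above[of "2 * (r + \<rho>)" \<rho> t r "g (D / 2)"] \<rho> r t by (simp add: mass_above_def disc_def)
    ultimately have "mass_above (Fs @ [disc]) t \<le> ennreal (2 * L * (\<rho> - t')) + ennreal (2 * (r + \<rho>) * (r - max \<rho> t))"
      unfolding mass_above_append by (rule add_mono)
    also have "\<dots> = ennreal (2 * L * (\<rho> - t') + 2 * (r + \<rho>) * (r - max \<rho> t))"
      using L0 \<rho> t t' r by (intro ennreal_plus[symmetric]) auto
    also have "\<dots> \<le> ennreal (2 * L * (r - t))"
    proof (rule ennreal_leI)
      have "2 * (r + \<rho>) * (r - max \<rho> t) \<le> 2 * L * (r - max \<rho> t)"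
        using L \<rho> t by (intro mult_right_mono) auto
      moreover have "\<rho> - t' + (r - max \<rho> t) = r - t" by (auto simp: t'_def)
      then have "2 * L * (\<rho> - t') + 2 * L * (r - max \<rho> t) = 2 * L * (r - t)" by (metis distrib_left)
      ultimately show "2 * L * (\<rho> - t') + 2 * (r + \<rho>) * (r - max \<rho> t) \<le> 2 * L * (r - t)" by linarith
    qed
    also have "2 * L * (r - t) = 2 * r\<^sup>2 * (L / r\<^sup>2) * (r - t)" using r by simp
    finally show "mass_above (Fs @ [disc]) t \<le> ennreal (2 * r\<^sup>2 * (L / r\<^sup>2) * (r - t))" .
  next
    fix x assume x: "x \<in> X"
    obtain q a b where xq: "x \<in> TP" "\<And>c. td x (g c) \<le> \<bar>c - q\<bar> + a" "0 \<le> a" "a \<le> b" "b \<le> q" "b \<le> D - q" "b \<le> \<rho>"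
      "b = 0 \<or> q + b \<le> 2 * \<rho> \<or> D - q + b \<le> 2 * \<rho>" "(q, b) \<in> set Q \<or> a = 0 \<and> b = 0"
      and own_x: "ennreal (\<rho> * (a + b)) \<le> mass_over own x"
    proof (cases "x \<in> g ` {0..D}")
      case True
      then obtain y where y: "y \<in> {0..D}" "x = g y" by blast
      show thesis
      proof (rule that[of y 0 0])
        show "td x (g c) \<le> \<bar>c - y\<bar> + 0" for c using gd[of y c] y by (simp add: abs_minus_commute)
      qed (use y gT \<rho> in auto)
    next
      case False
      then obtain K q where K: "(K, q) \<in> set Bs" "x \<in> points K" using x X by blast
      note hK = h[OF K(1)]
      have xT: "x \<in> TP" using points_in_tree[OF hK(5)] K(2) by auto
      obtain a where a: "a \<le> height K" "td x (vertex_pt (anchor K)) \<le> a"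
        "ennreal ((a + height K) / 2) \<le> (\<Sum>z\<leftarrow>arms K. arm_over x z)"
        using bspec[OF conjunct2[OF arms_cover[OF hK(5), unfolded covers_rooted_def]] K(2)] by blast
      have a0: "0 \<le> a" using a(2) nonneg[of x "vertex_pt (anchor K)"] by linarith
      show thesis
      proof (rule that[OF xT _ a0 a(1) hK(3,4,2,7)])
        show "td x (g c) \<le> \<bar>c - q\<bar> + a" for c
          using triangle[OF xT gT[of q] gT[of c]] gd[of q c] a(2) hK(6) by (simp add: abs_minus_commute)
        show "(q, height K) \<in> set Q \<or> a = 0 \<and> height K = 0" using K(1) by (force simp: Q_def)
        have "ennreal (\<rho> * (a + height K)) = ennreal (2 * \<rho>) * ennreal ((a + height K) / 2)"
          using a0 hK(1) \<rho> by (simp add: ennreal_mult[symmetric])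
        also have "\<dots> \<le> ennreal (2 * \<rho>) * (\<Sum>z\<leftarrow>arms K. arm_over x z)"
          using a(3) by (intro mult_left_mono) auto
        also have "\<dots> = mass_over (map (arm_family \<rho>) (arms K)) x" using arms_mass_over[OF hK(5) xT] by simp
        also have "\<dots> \<le> mass_over own x"
        proof -
          obtain Bs1 Bs2 where "Bs = Bs1 @ (K, q) # Bs2" using split_list[OF K(1)] by blast
          then show ?thesis by (auto simp: own_def intro: add_increasing add_increasing2)
        qed
        finally show "ennreal (\<rho> * (a + height K)) \<le> mass_over own x" .
      qed
    qed
    have d': "td x (g' c) \<le> \<bar>c - (D - q)\<bar> + a" for c
      using xq(2)[of "D - c"] by (simp add: g'_def abs_minus_commute algebra_simps)
    have mem': "(D - q, b) \<in> set Q' \<or> a = 0 \<and> b = 0" using xq(9) by (force simp: Q_def Q'_def)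
    define W where "W = (\<rho> - a) * (min (D - 2 * \<rho>) (q - a) - max 0 (q + a - 2 * \<rho>))
       + a * (min (D - 2 * \<rho>) (q - b) - max 0 (q + b - 2 * \<rho>))"
    have W0: "0 \<le> W" unfolding W_def using xq \<rho>
      by (intro add_nonneg_nonneg mult_nonneg_nonneg) auto
    have e1: "ennreal (\<rho> * max 0 (2 * \<rho> - q - a)) \<le> emeasure (snd (end_family \<rho> g)) (balls_over g x)"
      using xq \<rho> by (intro end_over[OF g xq(1) xq(2)]) auto
    have e2: "ennreal (\<rho> * max 0 (2 * \<rho> - (D - q) - a)) \<le> emeasure (snd (end_family \<rho> g')) (balls_over g' x)"
      using xq \<rho> by (intro end_over[OF g' xq(1) d']) auto
    have w1: "(\<integral>\<^sup>+u. ennreal (window_share D \<rho> q b a u) \<partial>lborel)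
        \<le> emeasure (snd (window_family D \<rho> Q g)) (balls_over g x)"
      by (rule window_over[OF g xq(1) xq(2) xq(3,4) \<rho>(1,3) xq(9) QD])
    have w2: "(\<integral>\<^sup>+u. ennreal (window_share D \<rho> (D - q) b a u) \<partial>lborel)
        \<le> emeasure (snd (window_family D \<rho> Q' g')) (balls_over g' x)"
      by (rule window_over[OF g' xq(1) d' xq(3,4) \<rho>(1,3) mem' Q'D])
    have w: "ennreal W \<le> emeasure (snd (window_family D \<rho> Q g)) (balls_over g x)
        + emeasure (snd (window_family D \<rho> Q' g')) (balls_over g' x)"
      using add_mono[OF w1 w2] window_share_total[OF xq(3-7) \<rho>(3)] by (simp add: W_def)
    have c: "ennreal (2 * (r + \<rho>) * (r - \<rho>)) \<le> mass_over [disc] x"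
    proof -
      have "td x (g (D / 2)) \<le> \<rho>" if "\<rho> < r"
      proof -
        have "\<bar>D / 2 - q\<bar> + a \<le> D / 2" using xq by (auto simp: abs_if)
        moreover have "\<rho> = D / 2" using that by (auto simp: \<rho>_def min_def split: if_splits)
        ultimately show ?thesis using xq(2)[of "D / 2"] by linarith
      qed
      then show ?thesis
        using disc_over[OF gT xq(1), of "2 * (r + \<rho>)" \<rho> r "D / 2"] \<rho> r by (simp add: mass_over_def disc_def)
    qed
    let ?e1 = "\<rho> * max 0 (2 * \<rho> - q - a)" and ?e2 = "\<rho> * max 0 (2 * \<rho> - (D - q) - a)"
    have nn: "0 \<le> ?e1" "0 \<le> ?e2" "0 \<le> \<rho> * (a + b)" "0 \<le> 2 * (r + \<rho>) * (r - \<rho>)" using \<rho> r xq by auto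
    have "2 * r\<^sup>2 \<le> ?e1 + (?e2 + (W + (\<rho> * (a + b) + 2 * (r + \<rho>) * (r - \<rho>))))"
      using comb_inequality[OF xq(3-7) \<rho>(3,1) xq(8)]
      by (simp add: W_def power2_eq_square algebra_simps)
    then have "ennreal (2 * r\<^sup>2) \<le> ennreal (?e1 + (?e2 + (W + (\<rho> * (a + b) + 2 * (r + \<rho>) * (r - \<rho>)))))"
      by (rule ennreal_leI)
    also have "\<dots> = ennreal ?e1 + (ennreal ?e2 + (ennreal W + (ennreal (\<rho> * (a + b)) + ennreal (2 * (r + \<rho>) * (r - \<rho>)))))"
      by (rule ennreal_add5[symmetric, OF nn(1,2) W0 nn(3,4)])
    also have "\<dots> \<le> emeasure (snd (end_family \<rho> g)) (balls_over g x) + (emeasure (snd (end_family \<rho> g')) (balls_over g' x)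
       + ((emeasure (snd (window_family D \<rho> Q g)) (balls_over g x)
        + emeasure (snd (window_family D \<rho> Q' g')) (balls_over g' x)) + (mass_over own x + mass_over [disc] x)))"
      by (intro add_mono e1 e2 w own_x c)
    also have "\<dots> = mass_over (Fs @ [disc]) x"
      by (simp add: Fs_def mass_over_def end_family_def window_family_def ac_simps)
    finally show "ennreal (2 * r\<^sup>2) \<le> mass_over (Fs @ [disc]) x" .
  qed (use r L0 in auto)
qed

end

context finite_metric_tree
begin

section \<open>Finding a spine or a division into three parts\<close>

lemma short_curve_concat:
  assumes g: "short_curve g" and k: "short_curve k" and "g H = k 0"
  shows "short_curve (\<lambda>c. if c \<le> H then g c else k (c - H))" (is "short_curve ?f")
proof -
  have gT: "g c \<in> TP" and kT: "k c \<in> TP" for c using g k by (auto simp: short_curve_def)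
  have gd: "td (g c) (g c') \<le> \<bar>c - c'\<bar>" and kd: "td (k c) (k c') \<le> \<bar>c - c'\<bar>" for c c'
    using g k by (auto simp: short_curve_def)
  have mixed: "td (g c) (k (c' - H)) \<le> c' - c" if "c \<le> H" "H < c'" for c c'
    using triangle[OF gT[of c] gT[of H] kT[of "c' - H"]] gd[of c H] kd[of 0 "c' - H"] that assms(3) by simp
  have "td (?f c) (?f c') \<le> \<bar>c - c'\<bar>" for c c'
  proof (cases "c \<le> H"; cases "c' \<le> H")
    assume "c \<le> H" "\<not> c' \<le> H"
    then show ?thesis using mixed[of c c'] by simp
  next
    assume "\<not> c \<le> H" "c' \<le> H"
    then show ?thesis using mixed[of c' c] commute[of "g c'"] by simp
  next
    assume "\<not> c \<le> H" "\<not> c' \<le> H"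
    then show ?thesis using kd[of "c - H" "c' - H"] by simp
  qed (use gd in auto)
  then show ?thesis using gT kT by (auto simp: short_curve_def)
qed

lemma points_mset: "mset (edge_list s) = mset (edge_list t) \<Longrightarrow> points s = points t"
  unfolding points_def by (metis set_mset_mset)

lemma in_tree_mset: "mset (edge_list s) = mset (edge_list t) \<Longrightarrow> in_tree s = in_tree t"
  by (metis set_mset_mset)

text \<open>A path \<open>g\<close> from a deepest vertex, at parameter \<open>0\<close>, to the root. The bush at parameter \<open>q\<close> has height at most \<open>q\<close>,
  because the path goes through the highest child at every vertex.\<close>

definition spine :: "'a rtree \<Rightarrow> (real \<Rightarrow> 'a \<Rightarrow> real) \<Rightarrow> ('a rtree \<times> real) list \<Rightarrow> bool" where
  "spine A g Bs \<longleftrightarrow> short_curve g \<and> g (height A) = vertex_pt (anchor A) \<and>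
     points A \<subseteq> g ` {0..height A} \<union> (\<Union>(K, q)\<in>set Bs. points K) \<and>
     total_len A = height A + (\<Sum>(K, q)\<leftarrow>Bs. total_len K) \<and>
     (\<forall>(K, q)\<in>set Bs. in_tree K \<and> g q = vertex_pt (anchor K) \<and> height K \<le> q \<and> q \<le> height A)"

text \<open>A bush \<open>K\<close> with its two neighbouring parts \<open>C\<close> and \<open>U\<close>, at distance \<open>q = len {anchor K, anchor C} + height C\<close>
  from the nearer end of a spine of length \<open>D\<close>, such that \<open>q + height K\<close> exceeds the bound \<open>m\<close>.\<close>

definition three_way :: "real \<Rightarrow> real \<Rightarrow> 'a rtree \<Rightarrow> bool" where
  "three_way D m t \<longleftrightarrow> (\<exists>K C U. mset (edge_list t) = mset (edge_list (Graft (Graft K C) U)) \<and>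
     0 < height K \<and> height K \<le> len {anchor K, anchor C} + height C \<and>
     m < height K + (len {anchor K, anchor C} + height C) \<and>
     2 * (len {anchor K, anchor C} + height C) \<le> D \<and>
     D \<le> (len {anchor K, anchor C} + height C) + (len {anchor K, anchor U} + height U))"

text \<open>Descend from \<open>A\<close> along the highest children. The rest of the tree is \<open>U\<close>; after a step downwards it also contains
  the bush left behind, and it reaches at least as far.\<close>

lemma spine_or_three_way:
  assumes "in_tree (Graft A U)" and "D \<le> height A + len {anchor A, anchor U} + height U"
    and "2 * height A \<le> D"
  shows "three_way D m (Graft A U) \<or>
    (\<exists>g Bs. spine A g Bs \<and> (\<forall>(K, q)\<in>set Bs. height K = 0 \<or> q + height K \<le> m))"
  using assms
proof (induction "size A" arbitrary: A U rule: less_induct)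
  case less
  show ?case
  proof (cases A)
    case (Vertex v)
    have "{v, anchor U} \<in> E" using less.prems Vertex by auto
    then have "v \<in> V" using edges[of "{v, anchor U}"] by blast
    then have "spine A (\<lambda>_. vertex_pt v) []"
      using Vertex vertex_in_tree short_constant by (simp add: spine_def)
    then show ?thesis by (intro disjI2 exI[of _ "\<lambda>_. vertex_pt v"] exI[of _ "[]"]) simp
  next
    case (Graft A1 A2)
    have "in_tree (Graft A1 A2)" using less.prems Graft by auto
    then obtain K C where KC: "anchor K = anchor A1"
      "mset (edge_list (Graft A1 A2)) = mset (edge_list (Graft K C))"
      "height (Graft A1 A2) = len {anchor K, anchor C} + height C" "height K \<le> height (Graft A1 A2)"
      "size C < size (Graft A1 A2)" by (rule highest_child)
    define q where "q = height A"
    define l where "l = len {anchor K, anchor C}"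
    have q: "q = l + height C" "height K \<le> q" using KC Graft by (simp_all add: q_def l_def)
    have mA: "mset (edge_list A) = mset (edge_list (Graft K C))" using KC(2) Graft by simp
    have aA: "anchor A = anchor K" using KC(1) Graft by simp
    have mAU: "mset (edge_list (Graft A U)) = mset (edge_list (Graft (Graft K C) U))"
      using mA aA by simp
    have in_all: "in_tree K" "in_tree C" "{anchor C, anchor K} \<in> E" "in_tree U" "{anchor K, anchor U} \<in> E"
      using less.prems(1) in_tree_mset[OF mAU] by (auto simp: insert_commute)
    have l: "0 < l" using in_all len_pos by (auto simp: l_def insert_commute)
    have qD: "2 * q \<le> D" using less.prems(3) by (simp add: q_def)
    have D: "D \<le> q + (len {anchor K, anchor U} + height U)" using less.prems(2) aA by (simp add: q_def)
    show ?thesis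
    proof (cases "0 < height K \<and> m < height K + q")
      case True
      then have "three_way D m (Graft A U)"
        unfolding three_way_def using mAU q D qD by (intro exI[of _ K] exI[of _ C] exI[of _ U]) (simp add: l_def)
      then show ?thesis ..
    next
      case False
      let ?U = "Graft K U"
      have m': "mset (edge_list (Graft C ?U)) = mset (edge_list (Graft A U))"
        unfolding mAU by (simp add: insert_commute)
      have "in_tree (Graft C ?U)" using less.prems(1) in_tree_mset[OF m'] by simp
      moreover have "D \<le> height C + len {anchor C, anchor ?U} + height ?U"
        using D q by (auto simp: l_def insert_commute)
      moreover have "2 * height C \<le> D" using qD q l by simp
      moreover have "size C < size A" using KC(5) Graft by simp
      ultimately have "three_way D m (Graft C ?U) \<or>
        (\<exists>g Bs. spine C g Bs \<and> (\<forall>(K, q)\<in>set Bs. height K = 0 \<or> q + height K \<le> m))"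
        using less.hyps by blast
      then show ?thesis
      proof
        assume "three_way D m (Graft C ?U)"
        then have "three_way D m (Graft A U)" unfolding three_way_def m' .
        then show ?thesis ..
      next
        assume "\<exists>g Bs. spine C g Bs \<and> (\<forall>(K, q)\<in>set Bs. height K = 0 \<or> q + height K \<le> m)"
        then obtain g Bs where g: "spine C g Bs" "\<forall>(K, q)\<in>set Bs. height K = 0 \<or> q + height K \<le> m" by blast
        define e where "e = edge_curve (anchor C) (anchor K)"
        define f where "f c = (if c \<le> height C then g c else e (c - height C))" for c
        have e: "short_curve e" "e 0 = vertex_pt (anchor C)" "e l = vertex_pt (anchor K)"
          using in_all(3) short_edge_curve edge_curve_start edge_curve_end[OF in_all(3)]
          by (simp_all add: e_def l_def insert_commute)
        have f: "short_curve f"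
          unfolding f_def using g(1) e by (intro short_curve_concat) (simp_all add: spine_def)
        have f_low: "f c = g c" if "c \<le> height C" for c using that by (simp add: f_def)
        have f_high: "f (height C + c) = e c" if "0 \<le> c" for c
          using that g(1) e(2) by (cases "c = 0") (auto simp: f_def spine_def)
        have "spine A f ((K, q) # Bs)"
          unfolding spine_def
        proof (intro conjI)
          show "short_curve f" by (rule f)
          show "f (height A) = vertex_pt (anchor A)"
            using f_high[of l] e(3) l q aA by (simp add: q_def add.commute)
          show "total_len A = height A + (\<Sum>(K, q)\<leftarrow>(K, q) # Bs. total_len K)"
            using g(1) total_len_mset[OF mA] q by (simp add: spine_def l_def q_def)
          show "\<forall>(K, q')\<in>set ((K, q) # Bs). in_tree K \<and> f q' = vertex_pt (anchor K) \<and> height K \<le> q' \<and> q' \<le> height A"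
            using g(1) in_all q f_high[of l] e(3) l f_low
            by (auto simp: spine_def q_def[symmetric] add.commute)
          show "points A \<subseteq> f ` {0..height A} \<union> (\<Union>(K, q)\<in>set ((K, q) # Bs). points K)"
          proof
            fix x assume "x \<in> points A"
            then consider "x \<in> simplex_points {anchor C, anchor K}" | "x \<in> points K" | "x \<in> points C"
              using points_mset[OF mA] by (auto simp: insert_commute)
            then show "x \<in> f ` {0..height A} \<union> (\<Union>(K, q)\<in>set ((K, q) # Bs). points K)"
            proof cases
              case 1
              obtain c where c: "0 \<le> c" "c \<le> len {anchor C, anchor K}" "x = edge_curve (anchor C) (anchor K) c"
                by (rule edge_point_on_curve[OF in_all(3) 1])
              then have "x = f (height C + c)" using f_high by (simp add: e_def)
              moreover have "height C + c \<in> {0..height A}"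
                using c height_nonneg[of C] q by (auto simp: q_def l_def insert_commute)
              ultimately show ?thesis by blast
            next
              case 2 then show ?thesis by simp
            next
              case 3
              then have "x \<in> g ` {0..height C} \<or> x \<in> (\<Union>(K, q)\<in>set Bs. points K)"
              proof -
                have "points C \<subseteq> g ` {0..height C} \<union> (\<Union>(K, q)\<in>set Bs. points K)"
                  using g(1) unfolding spine_def by (elim conjE)
                then show ?thesis using 3 by blast
              qed
              then show ?thesis
              proof
                assume "x \<in> g ` {0..height C}"
                then obtain c where c: "c \<in> {0..height C}" "x = g c" by blast
                then have "x = f c" "c \<in> {0..height A}" using f_low q l by (auto simp: q_def)
                then show ?thesis by blast
              qed auto
            qed
          qed
        qed
        moreover have "\<forall>(K, q)\<in>set ((K, q) # Bs). height K = 0 \<or> q + height K \<le> m"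
          using g(2) False height_nonneg[of K] by auto
        ultimately show ?thesis by blast
      qed
    qed
  qed
qed

lemma coverable_mono: "coverable r lam Y \<Longrightarrow> X \<subseteq> Y \<Longrightarrow> coverable r lam X"
  unfolding coverable_def by (meson subsetD)

text \<open>Every point of \<open>W\<close> lies in two of the three sets, so half the sum of the three covers is a cover of \<open>W\<close>.\<close>

lemma coverable_average:
  assumes c: "coverable r a X" "coverable r b Y" "coverable r c Z" and nn: "0 \<le> a" "0 \<le> b" "0 \<le> c"
    and sub: "W \<subseteq> (X \<inter> Y) \<union> (X \<inter> Z) \<union> (Y \<inter> Z)" "W \<subseteq> TP"
  shows "coverable r ((a + b + c) / 2) W"
proof -
  let ?B = "borel_of_top (marked_space V E len r)"
  obtain \<xi>1 where 1: "sets \<xi>1 = sets ?B" "finite_measure \<xi>1"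
    "\<And>x. x \<in> X \<Longrightarrow> 1 \<le> emeasure \<xi>1 (marked_ball V E len r x)"
    "\<And>A. A \<in> sets borel \<Longrightarrow> emeasure (radius_measure \<xi>1) A \<le> ennreal a * emeasure lborel (A \<inter> {0..r})"
    using c(1) unfolding coverable_def by blast
  obtain \<xi>2 where 2: "sets \<xi>2 = sets ?B" "finite_measure \<xi>2"
    "\<And>x. x \<in> Y \<Longrightarrow> 1 \<le> emeasure \<xi>2 (marked_ball V E len r x)"
    "\<And>A. A \<in> sets borel \<Longrightarrow> emeasure (radius_measure \<xi>2) A \<le> ennreal b * emeasure lborel (A \<inter> {0..r})"
    using c(2) unfolding coverable_def by blast
  obtain \<xi>3 where 3: "sets \<xi>3 = sets ?B" "finite_measure \<xi>3"
    "\<And>x. x \<in> Z \<Longrightarrow> 1 \<le> emeasure \<xi>3 (marked_ball V E len r x)"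
    "\<And>A. A \<in> sets borel \<Longrightarrow> emeasure (radius_measure \<xi>3) A \<le> ennreal c * emeasure lborel (A \<inter> {0..r})"
    using c(3) unfolding coverable_def by blast
  let ?h = "scale_measure (ennreal (1 / 2))"
  define \<xi> where "\<xi> = sum_measure ?B [?h \<xi>1, ?h \<xi>2, ?h \<xi>3]"
  have s: "sets \<xi> = sets ?B" by (simp add: \<xi>_def)
  have e: "emeasure \<xi> A = ennreal (1 / 2) * (emeasure \<xi>1 A + emeasure \<xi>2 A + emeasure \<xi>3 A)" if "A \<in> sets ?B" for A
    unfolding \<xi>_def using that by (subst emeasure_sum_measure) (auto simp: 1(1) 2(1) 3(1) distrib_left add.assoc)
  have half: "finite_measure (?h M)" if "finite_measure M" for M :: "(('a \<Rightarrow> real) \<times> real) measure"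
    using finite_measure.emeasure_finite[OF that, of "space M"]
    by (intro finite_measureI) (simp add: space_scale_measure ennreal_mult_eq_top_iff)
  have "finite_measure \<xi>"
    unfolding \<xi>_def
  proof (rule finite_sum_measure)
    fix M assume "M \<in> set [?h \<xi>1, ?h \<xi>2, ?h \<xi>3]"
    then consider "M = ?h \<xi>1" | "M = ?h \<xi>2" | "M = ?h \<xi>3" by auto
    then show "sets M = sets ?B \<and> finite_measure M"
      by cases (simp_all only: half[OF 1(2)] half[OF 2(2)] half[OF 3(2)] sets_scale_measure 1(1) 2(1) 3(1))
  qed
  moreover have "1 \<le> emeasure \<xi> (marked_ball V E len r x)" if x: "x \<in> W" for x
  proof -
    let ?b = "marked_ball V E len r x"
    have b: "?b \<in> sets ?B" using marked_ball_measurable x sub by blast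
    have two: "2 \<le> m + n" if "1 \<le> m" "1 \<le> n" for m n :: ennreal
      using add_mono[OF that] by simp
    note c1 = 1(3) and c2 = 2(3) and c3 = 3(3)
    have sum: "2 \<le> emeasure \<xi>1 ?b + emeasure \<xi>2 ?b + emeasure \<xi>3 ?b"
    proof -
      consider "x \<in> X" "x \<in> Y" | "x \<in> X" "x \<in> Z" | "x \<in> Y" "x \<in> Z" using sub x by blast
      then show ?thesis
      proof cases
        case 1
        show ?thesis using two[OF c1[OF \<open>x \<in> X\<close>] c2[OF \<open>x \<in> Y\<close>]] by (rule order_trans) simp
      next
        case 2
        show ?thesis using two[OF c1[OF \<open>x \<in> X\<close>] c3[OF \<open>x \<in> Z\<close>]] by (rule order_trans) (simp add: add_increasing2 add_right_mono)
      next
        case 3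
        show ?thesis using two[OF c2[OF \<open>x \<in> Y\<close>] c3[OF \<open>x \<in> Z\<close>]] by (rule order_trans) (simp add: add_increasing add_right_mono)
      qed
    qed
    have "1 = ennreal (1 / 2 + 1 / 2)" by simp
    also have "\<dots> = ennreal (1 / 2) + ennreal (1 / 2)" by (rule ennreal_plus) auto
    also have "\<dots> = ennreal (1 / 2) * 2" by (rule mult_2_right[symmetric])
    also have "\<dots> \<le> emeasure \<xi> ?b" unfolding e[OF b] by (intro mult_left_mono sum) auto
    finally show ?thesis .
  qed
  moreover have "emeasure (radius_measure \<xi>) A \<le> ennreal ((a + b + c) / 2) * emeasure lborel (A \<inter> {0..r})"
    if A: "A \<in> sets borel" for A
  proof -
    have rad: "emeasure (radius_measure M) A = emeasure M (snd -` A \<inter> space ?B)" if "sets M = sets ?B" for M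
    proof -
      have "snd \<in> M \<rightarrow>\<^sub>M borel"
        using snd_measurable_marked_space[of r] measurable_cong_sets[OF that refl] by blast
      then show ?thesis
        unfolding radius_measure_def using A sets_eq_imp_space_eq[OF that] by (simp add: emeasure_distr)
    qed
    have m: "snd -` A \<inter> space ?B \<in> sets ?B" using measurable_sets[OF snd_measurable_marked_space A] .
    have "emeasure (radius_measure \<xi>) A = ennreal (1 / 2) *
       (emeasure (radius_measure \<xi>1) A + emeasure (radius_measure \<xi>2) A + emeasure (radius_measure \<xi>3) A)"
      unfolding rad[OF s] rad[OF 1(1)] rad[OF 2(1)] rad[OF 3(1)] by (rule e[OF m])
    also have "\<dots> \<le> ennreal (1 / 2) * (ennreal a * emeasure lborel (A \<inter> {0..r})
       + ennreal b * emeasure lborel (A \<inter> {0..r}) + ennreal c * emeasure lborel (A \<inter> {0..r}))"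
      by (intro mult_left_mono add_mono 1(4) 2(4) 3(4) A) auto
    also have "\<dots> = ennreal (1 / 2) * ennreal (a + b + c) * emeasure lborel (A \<inter> {0..r})"
      using nn by (simp add: distrib_right mult.assoc)
    also have "ennreal (1 / 2) * ennreal (a + b + c) = ennreal (1 / 2 * (a + b + c))"
      using nn by (intro ennreal_mult[symmetric]) auto
    also have "1 / 2 * (a + b + c) = (a + b + c) / 2" by simp
    finally show ?thesis .
  qed
  ultimately show ?thesis unfolding coverable_def using s by blast
qed

text \<open>Each union of two of the three parts in \<open>three_way\<close> has length at least \<open>2 * r\<close> and fewer edges. Every edge occurs
  in two of the unions, so half the sum of their lengths is the length of the tree. Without such a bush the spines of
  the two sides of a balanced edge join to a spine of the tree, and \<open>comb_coverable\<close> applies.\<close>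

lemma rtree_coverable:
  assumes "in_tree t" "0 < r" "2 * r \<le> total_len t"
  shows "coverable r (total_len t / r\<^sup>2) (points t)"
  using assms(1,3)
proof (induction "length (edge_list t)" arbitrary: t rule: less_induct)
  case less
  have "t \<noteq> Vertex v" for v using less.prems assms(2) by auto
  then obtain A0 B0 where t: "t = Graft A0 B0" by (cases t) auto
  then obtain A B where AB: "mset (edge_list (Graft A B)) = mset (edge_list t)"
    "height A \<le> height B + len {anchor A, anchor B}" "height B \<le> height A + len {anchor A, anchor B}"
    using balanced_split less.prems(1) by metis
  have tAB: "total_len t = total_len (Graft A B)" "points t = points (Graft A B)"
    using total_len_mset[OF AB(1)] points_mset[OF AB(1)] by simp_all
  have mBA: "mset (edge_list (Graft B A)) = mset (edge_list (Graft A B))" by (simp add: insert_commute)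
  have iAB: "in_tree (Graft A B)" using less.prems(1) in_tree_mset[OF AB(1)] by simp
  have iBA: "in_tree (Graft B A)" using iAB in_tree_mset[OF mBA] by simp
  define l where "l = len {anchor A, anchor B}"
  have l': "len {anchor B, anchor A} = l" by (simp add: l_def insert_commute)
  have l: "0 < l" using iAB len_pos by (auto simp: l_def)
  define D where "D = height A + l + height B"
  have hD: "0 \<le> height A" "0 \<le> height B" "2 * height A \<le> D" "2 * height B \<le> D" "0 < D"
    using AB(2,3) height_nonneg[of A] height_nonneg[of B] l by (auto simp: D_def l_def)
  define \<rho> where "\<rho> = min (D / 2) r"
  show ?case
  proof (cases "three_way D (2 * \<rho>) t")
    case True
    then obtain K C U where KCU: "mset (edge_list t) = mset (edge_list (Graft (Graft K C) U))"
      "0 < height K" "height K \<le> len {anchor K, anchor C} + height C"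
      "2 * \<rho> < height K + (len {anchor K, anchor C} + height C)"
      "2 * (len {anchor K, anchor C} + height C) \<le> D"
      "D \<le> (len {anchor K, anchor C} + height C) + (len {anchor K, anchor U} + height U)"
      unfolding three_way_def by blast
    \<comment> \<open>If \<open>\<rho>\<close> were \<open>D / 2\<close>, the bound \<open>height K \<le> q \<le> D / 2\<close> would exclude the division.\<close>
    have r: "\<rho> = r" "2 * r \<le> D" using KCU(3,4,5) by (auto simp: \<rho>_def min_def split: if_splits)
    \<comment> \<open>Two of the three parts at a time: the bush with either side, and the two sides joined at the foot of the bush.\<close>
    let ?X = "Graft K C" and ?Y = "Graft K U" and ?Z = "Graft (Graft (Vertex (anchor K)) C) U"
    have ins: "in_tree K" "in_tree C" "in_tree U" "{anchor K, anchor C} \<in> E" "{anchor K, anchor U} \<in> E"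
      using less.prems(1) in_tree_mset[OF KCU(1)] by auto
    have tot: "height K \<le> total_len K" "height C \<le> total_len C" "height U \<le> total_len U"
      using ins height_le_total by auto
    have num: "length (edge_list t) = 2 + length (edge_list K) + length (edge_list C) + length (edge_list U)"
      using arg_cong[OF KCU(1), of size] by simp
    have K1: "0 < length (edge_list K)" using height_pos_nonempty[OF KCU(2)] by simp
    have X: "coverable r (total_len ?X / r\<^sup>2) (points ?X)"
      using less.hyps[of ?X] ins tot num KCU r by simp
    have Y: "coverable r (total_len ?Y / r\<^sup>2) (points ?Y)"
      using less.hyps[of ?Y] ins tot num KCU r by simp
    have Z: "coverable r (total_len ?Z / r\<^sup>2) (points ?Z)"
      using less.hyps[of ?Z] ins tot num K1 KCU r by simp
    have nn: "0 \<le> total_len s / r\<^sup>2" if "in_tree s" for s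
      using height_le_total[OF that] height_nonneg[of s] by simp
    have pt: "points t = points (Graft (Graft K C) U)" by (rule points_mset[OF KCU(1)])
    have "coverable r ((total_len ?X / r\<^sup>2 + total_len ?Y / r\<^sup>2 + total_len ?Z / r\<^sup>2) / 2) (points t)"
    proof (rule coverable_average[OF X Y Z])
      show "points t \<subseteq> points ?X \<inter> points ?Y \<union> points ?X \<inter> points ?Z \<union> points ?Y \<inter> points ?Z"
        unfolding pt by auto
      show "points t \<subseteq> TP" by (rule points_in_tree[OF less.prems(1)])
    qed (rule nn; use ins in simp)+
    moreover have "(total_len ?X / r\<^sup>2 + total_len ?Y / r\<^sup>2 + total_len ?Z / r\<^sup>2) / 2 = total_len t / r\<^sup>2"
      using total_len_mset[OF KCU(1)] by (simp add: add_divide_distrib)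
    ultimately show ?thesis by simp
  next
    case False
    have "\<not> three_way D (2 * \<rho>) (Graft A B)" "\<not> three_way D (2 * \<rho>) (Graft B A)"
      using False unfolding three_way_def mBA AB(1) by auto
    moreover have "D \<le> height A + len {anchor A, anchor B} + height B"
      "D \<le> height B + len {anchor B, anchor A} + height A" unfolding l' by (simp_all add: D_def l_def)
    ultimately have "\<exists>g Bs. spine A g Bs \<and> (\<forall>(K, q)\<in>set Bs. height K = 0 \<or> q + height K \<le> 2 * \<rho>)"
      "\<exists>g Bs. spine B g Bs \<and> (\<forall>(K, q)\<in>set Bs. height K = 0 \<or> q + height K \<le> 2 * \<rho>)"
      using spine_or_three_way[OF iAB _ hD(3)] spine_or_three_way[OF iBA _ hD(4)] by blast+
    then obtain gA BsA gB BsB where A: "spine A gA BsA" and B: "spine B gB BsB"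
      and A2: "\<forall>(K, q)\<in>set BsA. height K = 0 \<or> q + height K \<le> 2 * \<rho>"
      and B2: "\<forall>(K, q)\<in>set BsB. height K = 0 \<or> q + height K \<le> 2 * \<rho>" by blast
    have eE: "{anchor A, anchor B} \<in> E" using iAB by simp
    define e where "e = edge_curve (anchor A) (anchor B)"
    define f where "f c = (if c \<le> height A then gA c else e (c - height A))" for c
    define \<gamma> where "\<gamma> c = (if c \<le> height A + l then f c else gB (height B - (c - (height A + l))))" for c
    have e: "short_curve e" "e 0 = vertex_pt (anchor A)" "e l = vertex_pt (anchor B)"
      using short_edge_curve[OF eE] edge_curve_start edge_curve_end[OF eE] by (simp_all add: e_def l_def)
    have gA: "short_curve gA" "gA (height A) = vertex_pt (anchor A)" using A by (simp_all add: spine_def)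
    have gB: "short_curve gB" "gB (height B) = vertex_pt (anchor B)" using B by (simp_all add: spine_def)
    have f: "short_curve f" unfolding f_def using gA e by (intro short_curve_concat) simp_all
    have f_end: "f (height A + l) = vertex_pt (anchor B)" using l e by (simp add: f_def)
    have rev: "short_curve (\<lambda>c. gB (height B - c))"
      unfolding short_curve_def
    proof (intro conjI allI)
      fix c c'
      have "td (gB (height B - c)) (gB (height B - c')) \<le> \<bar>(height B - c) - (height B - c')\<bar>"
        using gB(1) unfolding short_curve_def by blast
      then show "td (gB (height B - c)) (gB (height B - c')) \<le> \<bar>c - c'\<bar>" by (simp add: abs_minus_commute)
    qed (use gB in \<open>simp add: short_curve_def\<close>)
    have \<gamma>: "short_curve \<gamma>"
      unfolding \<gamma>_def by (rule short_curve_concat[OF f rev]) (simp add: f_end gB(2))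
    have on_A: "\<gamma> c = gA c" if "c \<le> height A" for c using that l by (simp add: \<gamma>_def f_def)
    have on_e: "\<gamma> (height A + c) = e c" if "0 \<le> c" "c \<le> l" for c
      using that gA e by (cases "c = 0") (auto simp: \<gamma>_def f_def)
    have on_B: "\<gamma> (D - c) = gB c" if "c \<le> height B" for c
      using that f_end gB by (cases "c = height B") (auto simp: \<gamma>_def D_def)
    define Bs where "Bs = BsA @ map (\<lambda>(K, q). (K, D - q)) BsB"
    have "coverable r (total_len t / r\<^sup>2) (points t)"
    proof (rule comb_coverable[OF \<gamma> assms(2) hD(5), of "total_len t" Bs])
      have "(\<Sum>(K, q)\<leftarrow>Bs. total_len K) = (\<Sum>(K, q)\<leftarrow>BsA. total_len K) + (\<Sum>(K, q)\<leftarrow>BsB. total_len K)"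
        by (simp add: Bs_def comp_def case_prod_unfold)
      then show "total_len t = D + (\<Sum>(K, q)\<leftarrow>Bs. total_len K)"
        using A B by (simp add: tAB spine_def D_def l_def)
      show "2 * r \<le> total_len t" by (rule less.prems(2))
    next
      fix K q assume "(K, q) \<in> set Bs"
      then consider "(K, q) \<in> set BsA" | "(K, D - q) \<in> set BsB" by (auto simp: Bs_def)
      then show "in_tree K \<and> \<gamma> q = vertex_pt (anchor K) \<and> height K \<le> q \<and> height K \<le> D - q \<and>
        (height K = 0 \<or> q + height K \<le> 2 * min (D / 2) r \<or> D - q + height K \<le> 2 * min (D / 2) r)"
      proof cases
        case 1
        then have "in_tree K \<and> gA q = vertex_pt (anchor K) \<and> height K \<le> q \<and> q \<le> height A"
          using A unfolding spine_def by blast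
        then show ?thesis using bspec[OF A2 1] on_A hD by (auto simp: \<rho>_def[symmetric])
      next
        case 2
        then have "in_tree K \<and> gB (D - q) = vertex_pt (anchor K) \<and> height K \<le> D - q \<and> D - q \<le> height B"
          using B unfolding spine_def by blast
        then show ?thesis using bspec[OF B2 2] on_B[of "D - q"] hD by (auto simp: \<rho>_def[symmetric])
      qed
    next
      show "points t \<subseteq> \<gamma> ` {0..D} \<union> (\<Union>(K, q)\<in>set Bs. points K)"
      proof
        fix x assume "x \<in> points t"
        then consider "x \<in> simplex_points {anchor A, anchor B}" | "x \<in> points A" | "x \<in> points B"
          by (auto simp: tAB)
        then show "x \<in> \<gamma> ` {0..D} \<union> (\<Union>(K, q)\<in>set Bs. points K)"
        proof cases
          case 1
          obtain c where c: "0 \<le> c" "c \<le> len {anchor A, anchor B}" "x = edge_curve (anchor A) (anchor B) c"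
            by (rule edge_point_on_curve[OF eE 1])
          then have "x = \<gamma> (height A + c)" using on_e by (simp add: e_def l_def)
          moreover have "height A + c \<in> {0..D}" using c hD by (simp add: D_def l_def)
          ultimately show ?thesis by blast
        next
          case 2
          have "points A \<subseteq> gA ` {0..height A} \<union> (\<Union>(K, q)\<in>set BsA. points K)"
            using A unfolding spine_def by (elim conjE)
          then consider c where "c \<in> {0..height A}" "x = gA c" | "x \<in> (\<Union>(K, q)\<in>set BsA. points K)"
            using 2 by blast
          then show ?thesis
          proof cases
            case 1
            then have "x = \<gamma> c" "c \<in> {0..D}" using on_A hD by auto
            then show ?thesis by blast
          qed (auto simp: Bs_def)
        next
          case 3
          have "points B \<subseteq> gB ` {0..height B} \<union> (\<Union>(K, q)\<in>set BsB. points K)"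
            using B unfolding spine_def by (elim conjE)
          then consider c where "c \<in> {0..height B}" "x = gB c" | "x \<in> (\<Union>(K, q)\<in>set BsB. points K)"
            using 3 by blast
          then show ?thesis
          proof cases
            case 1
            then have "x = \<gamma> (D - c)" "D - c \<in> {0..D}" using on_B hD by auto
            then show ?thesis by blast
          qed (auto simp: Bs_def)
        qed
      qed
    qed
    then show ?thesis .
  qed
qed

end

theorem proposition3p13:
  fixes V :: "'a set" and E :: "'a set set" and len :: "'a set \<Rightarrow> real" and r :: real
  assumes "finite_metric_tree V E len"
    and "0 < r" and "2 * r \<le> tree_length E len"
  shows "\<exists>\<xi>. fractional_marked_ball_cover V E len r \<xi> \<and>
    (\<forall>A\<in>sets borel. emeasure (radius_measure \<xi>) A \<le> emeasure (Lambda E len r) A)"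
proof -
  interpret finite_metric_tree V E len by fact
  obtain t where t: "distinct (edge_list t)" "set (edge_list t) = E" by (rule rtree_of_tree)
  have total: "total_len t = tree_length E len"
    using t by (simp add: total_len_def tree_length_def sum_list_distinct_conv_sum_set)
  have "E \<noteq> {}" using assms(2,3) by (auto simp: tree_length_def)
  have points: "tree_points V E \<subseteq> points t"
  proof
    fix x assume "x \<in> tree_points V E"
    then consider v where "v \<in> V" "x \<in> simplex_points {v}" | "x \<in> points t"
      using t by (auto simp: tree_points_def points_def)
    then show "x \<in> points t"
    proof cases
      case 1
      obtain e where e: "e \<in> E" "v \<in> e"
      proof -
        obtain e0 where e0: "e0 \<in> E" using \<open>E \<noteq> {}\<close> by blast
        then have "e0 \<noteq> {}" using edges[OF e0] by auto
        then obtain u where u: "u \<in> e0" "u \<in> V" using edges[OF e0] by blast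
        have "(v, u) \<in> {(a, b). {a, b} \<in> E}\<^sup>*" using connected[OF 1(1) u(2)] .
        then show thesis by (cases rule: converse_rtranclE) (use that e0 u in auto)
      qed
      have "x = vertex_pt v" using 1(2) by (auto simp: simplex_points_def fun_eq_iff)
      then have "x \<in> simplex_points e" using vertex_pt_simplex[OF finite_edge[OF e(1)] e(2)] by simp
      then show ?thesis using e t by (auto simp: points_def)
    qed
  qed
  have "coverable r (total_len t / r\<^sup>2) (points t)"
    using t assms(2,3) total by (intro rtree_coverable) auto
  then have "coverable r (tree_length E len / r\<^sup>2) (tree_points V E)"
    using coverable_mono[OF _ points] total by simp
  then obtain \<xi> where \<xi>: "sets \<xi> = sets (borel_of_top (marked_space V E len r))" "finite_measure \<xi>"
    "\<forall>x\<in>tree_points V E. 1 \<le> emeasure \<xi> (marked_ball V E len r x)"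
    "\<forall>A\<in>sets borel. emeasure (radius_measure \<xi>) A \<le> ennreal (tree_length E len / r\<^sup>2) * emeasure lborel (A \<inter> {0..r})"
    unfolding coverable_def by blast
  have "emeasure (Lambda E len r) A = ennreal (tree_length E len / r\<^sup>2) * emeasure lborel (A \<inter> {0..r})"
    if A: "A \<in> sets borel" for A
  proof -
    have "emeasure (Lambda E len r) A
      = ennreal (tree_length E len / r) * (emeasure lborel ({0..r} \<inter> A) / ennreal r)"
      using A assms(2) by (simp add: Lambda_def)
    also have "\<dots> = ennreal (tree_length E len / r) * ennreal (1 / r) * emeasure lborel (A \<inter> {0..r})"
      using assms(2) by (simp add: divide_ennreal_def inverse_ennreal inverse_eq_divide ac_simps)
    also have "ennreal (tree_length E len / r) * ennreal (1 / r) = ennreal (tree_length E len / r\<^sup>2)"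
      using assms by (simp add: ennreal_mult[symmetric] power2_eq_square)
    finally show ?thesis .
  qed
  then show ?thesis using \<xi> unfolding fractional_marked_ball_cover_def by auto
qed

end
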